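(* Let $x\ge 0$ and $0<\tau\le T$. Then $$R_1^{\mathrm{LTO}}\le\frac{8C_h\left(2+e^{\underline{\gamma}x/2}\right)}{\sigma^2\underline{\gamma}(2\gamma-\underline{\gamma})},$$ $$R_3^{\mathrm{LTO}}\le\frac{8C_h\left(2+e^{\underline{\gamma}K_h/2}\left(4+e^{\underline{\gamma}x/2}\right)\right)}{\sigma^2\underline{\gamma}(2\gamma-\underline{\gamma})},$$ $$R_5^{\mathrm{LTO}}\le\frac{8C_h\left(2+e^{\underline{\gamma}(x+K_h)/2}\right)}{\sigma^2\underline{\gamma}(2\gamma-\underline{\gamma})}.$$
   Context: Setting. $B$ is a standard Brownian motion on a filtered probability space $(\Omega,\mathcal F,\{\mathcal F_t\},\mathbb P)$ (adapted to $\{\mathcal F_t\}$, increments after $t$ independent of $\mathcal F_t$); $\theta<0$, $\sigma>0$, $\gamma:=-2\theta/\sigma^2$; $\underline{\gamma}>0$ is a known constant with $\underline{\gamma}\le\gamma$. Assumption on $h:\mathbb R\to[0,\infty)$: (i) $h$ is continuous; $h$ is strictly increasing on $[0,\infty)$; $h$ is continuously differentiable on $(-\infty,0)$ with $h'(x)<0$ there; (ii) $\lim_{x\to-\infty}h(x)=+\infty$; (iii) there is a constant $0<b<\underline{\gamma}/2$ with $\limsup_{x\to+\infty}h(x)/e^{bx}<+\infty$. Reflected Brownian motion. For $s\ge 0$ and $\mathcal F_s$-measurable (possibly random) $r$ and $y\ge r$, $(Z_r^{s,y},Y_r^{s,y})$ is the unique continuous adapted pair on $[s,\infty)$ with $Z_r^{s,y}(t)=y+\theta(t-s)+\sigma(B(t)-B(s))+Y_r^{s,y}(t)\ge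 r$, $Y_r^{s,y}$ nondecreasing, $Y_r^{s,y}(s)=0$, $\int_s^t\mathbf 1_{\{Z_r^{s,y}(u)>r\}}\,dY_r^{s,y}(u)=0$ for $t\ge s$. Write $Z_r:=Z_r^{0,x}$, where $x$ is the initial state; $\mathbb E_x$ is expectation with initial state $x$. Cost. $C(u,r):=u\int_r^\infty h(z)e^{-u(z-r)}\,dz$ and $F(u,r):=C(u,r)-h(r)$. For each $u\ge\underline{\gamma}$ the equation $F(u,r)=0$ has a unique solution $r\in\mathbb R$, which is negative; it is denoted $r(u)$. $r^*:=r(\gamma)$. Constants. $K_h>0$ is a constant such that $r(u)\in(-K_h,0)$ for all $u\ge\underline{\gamma}$ (such a constant exists). $a>0$ is such that $h(x)\le ae^{bx}$ for $x\ge0$, $H_K>0$ is such that $h(x)\le H_K$ for $-K_h\le x\le 0$, and $C_h:=\max\{a,H_K\}$. LTO algorithm with learning interval length $\tau$. On $[0,\tau)$ the state is $Z_0(t)$. At time $\tau$, $\hat\gamma:=\max\{(\frac1\tau\int_0^\tau Z_0(t)\,dt)^{-1},\underline{\gamma}\}$, $\hat r_\tau:=r(\hat\gamma)$, $X:=Z_0(\tau)$. For $t\ge\tau$ the state is $Z^{\tau,X}_{\hat r_\tau}(t)$. Transient regret terms. $R_1^{\mathrm{LTO}}:=\mathbb E_x[\int_0^\tau(h(Z_0(t))-C(\gamma,0))\,dt]$; $R_3^{\mathrm{LTO}}:=\mathbb E_x[\int_\tau^T(h(Z^{\tau,X}_{\hat r_\tau}(t))-C(\gamma,\hat r_\tau))\,dt]$;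 $R_5^{\mathrm{LTO}}:=\mathbb E_x[\int_0^T(C(\gamma,r^* )-h(Z_{r^*}(t)))\,dt]$. *)

theory Defs
  imports "HOL-Probability.Probability"
begin

text \<open>Only times \<open>t \<ge> 0\<close> matter. A filtration indexed by \<open>[0, \<infinity>)\<close> fits into the library locale
  over all reals by setting \<open>F t = F 0\<close> for \<open>t < 0\<close>.\<close>

locale filtered_prob_space = prob_space M + filtration "space M" F
  for M :: "'a measure" and F :: "real \<Rightarrow> 'a measure" +
  assumes sets_F_subset: "\<And>t. sets (F t) \<subseteq> sets M"

locale brownian_motion = filtered_prob_space M F
  for M :: "'a measure" and F :: "real \<Rightarrow> 'a measure" +
  fixes B :: "real \<Rightarrow> 'a \<Rightarrow> real"
  assumes adapted_B: "\<And>t. 0 \<le> t \<Longrightarrow> B t \<in> borel_measurable (F t)"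
    and B_0: "AE \<omega> in M. B 0 \<omega> = 0"
    and continuous_B: "\<And>\<omega>. \<omega> \<in> space M \<Longrightarrow> continuous_on {0..} (\<lambda>t. B t \<omega>)"
    and normal_increments: "\<And>s t. 0 \<le> s \<Longrightarrow> s < t \<Longrightarrow>
          distributed M lborel (\<lambda>\<omega>. B t \<omega> - B s \<omega>)
            (\<lambda>z. ennreal (normal_density 0 (sqrt (t - s)) z))"
    and indep_increments: "\<And>s t. 0 \<le> s \<Longrightarrow> s < t \<Longrightarrow>
          indep_set (sets (F s)) (sets (vimage_algebra (space M) (\<lambda>\<omega>. B t \<omega> - B s \<omega>) borel))"

text \<open>\<open>(Z, Y)\<close> is a reflected Brownian motion with its regulator, started at time \<open>s\<close> in the
  (possibly random) state \<open>y\<close> and kept above the (possibly random) level \<open>r\<close>. The conditions hold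
  on every path; values of \<open>Z\<close> and \<open>Y\<close> before time \<open>s\<close> are irrelevant. Since
  \<^const>\<open>interval_measure\<close> expects an integrator on the whole line, the path of \<open>Y\<close> is extended
  by its value at \<open>s\<close>; its Stieltjes measure then has no mass on \<open>(-\<infinity>, s]\<close>.\<close>

definition reflected_bm ::
  "(real \<Rightarrow> 'a measure) \<Rightarrow> (real \<Rightarrow> 'a \<Rightarrow> real) \<Rightarrow> real \<Rightarrow> real \<Rightarrow> real \<Rightarrow> ('a \<Rightarrow> real) \<Rightarrow> ('a \<Rightarrow> real)
    \<Rightarrow> (real \<Rightarrow> 'a \<Rightarrow> real) \<Rightarrow> (real \<Rightarrow> 'a \<Rightarrow> real) \<Rightarrow> bool" where
  "reflected_bm F B \<theta> \<sigma> s r y Z Y \<longleftrightarrow>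
     (\<forall>t\<ge>s. Z t \<in> borel_measurable (F t) \<and> Y t \<in> borel_measurable (F t)) \<and>
     (\<forall>\<omega>\<in>space (F s).
        continuous_on {s..} (\<lambda>t. Z t \<omega>) \<and>
        continuous_on {s..} (\<lambda>t. Y t \<omega>) \<and>
        mono_on {s..} (\<lambda>t. Y t \<omega>) \<and>
        Y s \<omega> = 0 \<and>
        (\<forall>t\<ge>s.
           Z t \<omega> = y \<omega> + \<theta> * (t - s) + \<sigma> * (B t \<omega> - B s \<omega>) + Y t \<omega> \<and>
           Z t \<omega> \<ge> r \<omega> \<and>
           (\<integral>\<^sup>+u\<in>{s..t}. indicator {u. Z u \<omega> > r \<omega>} u
              \<partial>interval_measure (\<lambda>u. Y (max s u) \<omega>)) = 0))"

definition admissible_cost :: "real \<Rightarrow> real \<Rightarrow> (real \<Rightarrow> real) \<Rightarrow> bool" where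
  "admissible_cost \<gamma>\<^sub>0 b h \<longleftrightarrow>
     (\<forall>x. 0 \<le> h x) \<and>
     continuous_on UNIV h \<and>
     strict_mono_on {0..} h \<and>
     (\<forall>x<0. h differentiable (at x)) \<and>
     continuous_on {..<0} (deriv h) \<and>
     (\<forall>x<0. deriv h x < 0) \<and>
     filterlim h at_top at_bot \<and>
     0 < b \<and> b < \<gamma>\<^sub>0 / 2 \<and>
     Limsup at_top (\<lambda>x. ereal (h x / exp (b * x))) < \<infinity>"

definition cost :: "(real \<Rightarrow> real) \<Rightarrow> real \<Rightarrow> real \<Rightarrow> real" where
  "cost h u r = u * (LBINT z:{r..}. h z * exp (- u * (z - r)))"

definition cost_gap :: "(real \<Rightarrow> real) \<Rightarrow> real \<Rightarrow> real \<Rightarrow> real" where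
  "cost_gap h u r = cost h u r - h r"

definition opt_level :: "(real \<Rightarrow> real) \<Rightarrow> real \<Rightarrow> real" where
  "opt_level h u = (THE r. cost_gap h u r = 0)"

text \<open>The time average of \<open>Z\<close> is positive almost surely. On the exceptional null set the inverse
  is \<open>0\<close> and the estimate equals \<open>\<gamma>\<^sub>0\<close>.\<close>

definition rate_estimate :: "real \<Rightarrow> real \<Rightarrow> (real \<Rightarrow> 'a \<Rightarrow> real) \<Rightarrow> 'a \<Rightarrow> real" where
  "rate_estimate \<gamma>\<^sub>0 \<tau> Z \<omega> = max (inverse (1 / \<tau> * (LBINT t:{0..\<tau>}. Z t \<omega>))) \<gamma>\<^sub>0"

definition lto_level :: "(real \<Rightarrow> real) \<Rightarrow> real \<Rightarrow> real \<Rightarrow> (real \<Rightarrow> 'a \<Rightarrow> real) \<Rightarrow> 'a \<Rightarrow> real" where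
  "lto_level h \<gamma>\<^sub>0 \<tau> Z \<omega> = opt_level h (rate_estimate \<gamma>\<^sub>0 \<tau> Z \<omega>)"

definition R1_LTO ::
  "'a measure \<Rightarrow> (real \<Rightarrow> real) \<Rightarrow> real \<Rightarrow> real \<Rightarrow> (real \<Rightarrow> 'a \<Rightarrow> real) \<Rightarrow> real" where
  "R1_LTO M h \<gamma> \<tau> Z = (LINT \<omega>|M. (LBINT t:{0..\<tau>}. (h (Z t \<omega>) - cost h \<gamma> 0)))"

definition R3_LTO ::
  "'a measure \<Rightarrow> (real \<Rightarrow> real) \<Rightarrow> real \<Rightarrow> real \<Rightarrow> real \<Rightarrow> ('a \<Rightarrow> real) \<Rightarrow> (real \<Rightarrow> 'a \<Rightarrow> real) \<Rightarrow> real" where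
  "R3_LTO M h \<gamma> \<tau> T r Z = (LINT \<omega>|M. (LBINT t:{\<tau>..T}. (h (Z t \<omega>) - cost h \<gamma> (r \<omega>))))"

definition R5_LTO ::
  "'a measure \<Rightarrow> (real \<Rightarrow> real) \<Rightarrow> real \<Rightarrow> real \<Rightarrow> (real \<Rightarrow> 'a \<Rightarrow> real) \<Rightarrow> real" where
  "R5_LTO M h \<gamma> T Z = (LINT \<omega>|M. (LBINT t:{0..T}. (cost h \<gamma> (opt_level h \<gamma>) - h (Z t \<omega>))))"

end

theory Submission
  imports Defs
begin

text \<open>
  Each of the three regrets is, up to sign, the expectation of the integral of \<open>h (Z t) - C r\<close> for
  a reflected motion \<open>Z\<close> with level \<open>r\<close>, where \<open>C = cost h \<gamma>\<close>. The discounted cost satisfies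
  \<open>C' = \<gamma> * (C - h)\<close>. Hence the function \<open>W\<close> with slope \<open>2 / (\<sigma>\<^sup>2 * \<gamma>) * (C r - C z)\<close> solves
  the Poisson equation \<open>\<sigma>\<^sup>2 / 2 * W'' + \<theta> * W' = h - C r\<close>, and its slope vanishes at the level.
  Dynkin's formula therefore expresses the regret as the expected increment of \<open>W\<close> between the
  initial and the final state (\<open>regret_identity\<close>).

  Dynkin's formula is obtained without stochastic integration. The path is compared with the
  walk that is pushed back to the level only at the times of a grid. Along this walk \<open>W\<close> is
  expanded to second order; the steps are independent of the past, so that the expansion has the
  right mean. A push by \<open>p\<close> costs only a multiple of the square of \<open>p\<close>, since \<open>W\<close> is flat at the
  level; the pushes are small and their total mean is bounded (\<open>reflected_step_expansion\<close>,
  \<open>push_mean\<close>). The walk lies below the path, and it falls behind by at most the oscillation of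
  the path over one cell, because on a cell with a push the path visits the level
  (\<open>path_le_refl_walk\<close>). This gives the formula for bounded uniformly continuous costs; growing
  costs are cut off.

  It remains to bound the increment of \<open>W\<close>. Costs are at most a multiple of \<open>exp (l * z)\<close> with
  \<open>l = \<gamma>\<^sub>0 / 2 \<le> \<gamma> / 2\<close>, hence so is \<open>C\<close>. A walk started at the level is
  stochastically dominated by the exponential law of rate \<open>\<gamma>\<close> (\<open>reflected_step_tail\<close>), whose moment
  generating function at \<open>l\<close> is at most \<open>2\<close>; this controls the ascent of the path above
  its initial state uniformly in time. In the learning phase and in the phase after it, a descent costs at most
  the integral of \<open>C\<close> below the initial state, and an ascent at most \<open>C r\<close> times its height
  (\<open>regret_upper\<close>). For the benchmark with the optimal level the signs are reversed; there the level minimizes \<open>C\<close> on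
  the states that are visited, so that only an ascent can contribute (\<open>regret_lower\<close>).
  The estimated level is random, but known when the second phase starts; this requires that the
  optimal level depends measurably on the rate (\<open>opt_level_measurable\<close>).
\<close>


section \<open>Discounted costs\<close>

lemma has_bochner_integral_exp_Ici:
  fixes u z :: real
  assumes "0 < u"
  shows "has_bochner_integral lborel (\<lambda>v. indicator {z..} v *\<^sub>R exp (- u * v)) (exp (- u * z) / u)"
proof (rule has_bochner_integral_nn_integral)
  have "((\<lambda>x. - inverse u * exp (- u * x)) \<longlongrightarrow> - inverse u * 0) at_top"
  proof (intro tendsto_mult tendsto_const)
    have "filterlim (\<lambda>x. u * x) at_top at_top"
      by (rule filterlim_tendsto_pos_mult_at_top[OF tendsto_const assms filterlim_ident])
    then show "((\<lambda>x. exp (- u * x)) \<longlongrightarrow> 0) at_top"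
      by (intro filterlim_compose[OF exp_at_bot]) (simp add: filterlim_uminus_at_bot)
  qed
  then have "(\<integral>\<^sup>+v. ennreal (exp (- u * v)) * indicator {z..} v \<partial>lborel)
      = ennreal (0 - (- inverse u * exp (- u * z)))"
    using assms by (intro nn_integral_FTC_atLeast) (auto intro!: derivative_eq_intros)
  moreover have "(\<integral>\<^sup>+v. ennreal (indicator {z..} v *\<^sub>R exp (- u * v)) \<partial>lborel)
      = (\<integral>\<^sup>+v. ennreal (exp (- u * v)) * indicator {z..} v \<partial>lborel)"
    by (intro nn_integral_cong) (auto split: split_indicator)
  ultimately show "(\<integral>\<^sup>+v. ennreal (indicator {z..} v *\<^sub>R exp (- u * v)) \<partial>lborel)
      = ennreal (exp (- u * z) / u)"
    by (simp add: field_simps)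
qed (use assms in auto)

lemma set_integrable_exp_Ici:
  "0 < u \<Longrightarrow> set_integrable lborel {z..} (\<lambda>v. exp (- u * v :: real))"
  using has_bochner_integral_exp_Ici[of u z]
  by (auto simp: set_integrable_def has_bochner_integral_iff)

lemma set_integral_exp_Ici:
  "0 < u \<Longrightarrow> (LBINT v:{z..}. exp (- u * v :: real)) = exp (- u * z) / u"
  using has_bochner_integral_exp_Ici[of u z]
  by (auto simp: set_lebesgue_integral_def has_bochner_integral_iff)

lemma cost_eq_tail:
  "cost h u z = u * exp (u * z) * (LBINT v:{z..}. h v * exp (- u * v))"
proof -
  have "(\<lambda>v. h v * exp (- u * (v - z))) = (\<lambda>v. exp (u * z) * (h v * exp (- u * v)))"
    by (auto simp: algebra_simps exp_add exp_diff exp_minus field_simps)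
  then show ?thesis by (simp add: cost_def)
qed

lemma cost_const: "0 < u \<Longrightarrow> cost (\<lambda>_. c) u z = c"
proof -
  assume u: "0 < u"
  have "(LBINT v:{z..}. c * exp (- u * v)) = c * (exp (- u * z) / u)"
    by (simp only: set_integral_mult_right set_integral_exp_Ici[OF u])
  then show ?thesis
    using u by (simp add: cost_eq_tail exp_minus)
qed

lemma cost_exp:
  assumes "l < u" "0 < u"
  shows "cost (\<lambda>v. A * exp (l * (v + k))) u z = A * u / (u - l) * exp (l * (z + k))"
proof -
  have "(\<lambda>v. A * exp (l * (v + k)) * exp (- u * v)) = (\<lambda>v. A * exp (l * k) * exp (- (u - l) * v))"
    by (auto simp: algebra_simps exp_add exp_diff exp_minus field_simps)
  then have "(LBINT v:{z..}. A * exp (l * (v + k)) * exp (- u * v))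
      = A * exp (l * k) * (exp (- (u - l) * z) / (u - l))"
    using set_integral_exp_Ici[of "u - l" z] assms by simp
  then show ?thesis
    using assms by (simp add: cost_eq_tail algebra_simps exp_add exp_diff exp_minus field_simps)
qed

lemma set_integrable_exp_growth:
  fixes u l :: real
  assumes "l < u"
  shows "set_integrable lborel {z..} (\<lambda>v. A * exp (l * (v + k)) * exp (- u * v))"
proof -
  have "(\<lambda>v. A * exp (l * (v + k)) * exp (- u * v)) = (\<lambda>v. A * exp (l * k) * exp (- (u - l) * v))"
    by (auto simp: algebra_simps exp_add exp_diff exp_minus field_simps)
  then show ?thesis
    using set_integrable_exp_Ici[of "u - l" z] assms by (simp del: minus_diff_eq mult_minus_left)
qed

text \<open>Integrability is required on every half line \<open>{z..}\<close>, because the level at which the cost is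
  evaluated varies.\<close>

locale discounted_cost =
  fixes h :: "real \<Rightarrow> real" and u :: real
  assumes u_pos: "0 < u"
    and h_cont: "continuous_on UNIV h"
    and h_integrable: "set_integrable lborel {z..} (\<lambda>v. h v * exp (- u * v))"
begin

abbreviation "C \<equiv> cost h u"

lemma h_borel [measurable]: "h \<in> borel_measurable borel"
  using h_cont by (rule borel_measurable_continuous_onI)

lemma cost_mono:
  assumes "discounted_cost g u" "\<And>v. z \<le> v \<Longrightarrow> h v \<le> g v"
  shows "C z \<le> cost g u z"
  unfolding cost_eq_tail using assms u_pos h_integrable discounted_cost.h_integrable[OF assms(1)]
  by (intro mult_left_mono set_integral_mono) (auto intro!: mult_right_mono)

lemma cost_ge:
  assumes "\<And>v. z \<le> v \<Longrightarrow> c \<le> h v"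
  shows "c \<le> C z"
proof -
  interpret c: discounted_cost "\<lambda>_. c" u
    by unfold_locales (use u_pos set_integrable_exp_Ici[of u] in auto)
  show ?thesis
    using c.cost_mono[OF discounted_cost_axioms assms] cost_const[OF u_pos] by simp
qed

lemma cost_nonneg: "(\<And>v. z \<le> v \<Longrightarrow> 0 \<le> h v) \<Longrightarrow> 0 \<le> C z"
  by (rule cost_ge)

lemma cost_le_exp:
  assumes "\<And>v. z \<le> v \<Longrightarrow> h v \<le> A * exp (l * (v + k))" "l < u"
  shows "C z \<le> A * u / (u - l) * exp (l * (z + k))"
proof -
  interpret e: discounted_cost "\<lambda>v. A * exp (l * (v + k))" u
    by unfold_locales
      (use u_pos assms set_integrable_exp_growth[of l u] in \<open>auto intro!: continuous_intros\<close>)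
  show ?thesis
    using cost_mono[OF e.discounted_cost_axioms assms(1)] cost_exp[OF assms(2) u_pos] by simp
qed

text \<open>Moving the lower limit of the integral contributes \<open>- u * h z\<close>, and the discount factor
  contributes \<open>u * C z\<close>. Through this linear equation the cost determines the solution of the
  Poisson equation of the reflected motion.\<close>

lemma cost_has_derivative: "(C has_real_derivative u * (C z - h z)) (at z)"
proof -
  define f where "f = (\<lambda>v. h v * exp (- u * v))"
  define J where "J = (\<lambda>z. LBINT v:{z..}. f v)"
  have f_cont: "continuous_on S f" for S
    unfolding f_def by (intro continuous_intros continuous_on_subset[OF h_cont]) auto
  have split: "J x = integral {x..z + 1} f + J (z + 1)" if "x \<le> z + 1" for x
  proof -
    have "J x = (LBINT v:{x..<z+1} \<union> {z+1..}. f v)"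
      unfolding J_def using that by (intro arg_cong[where f="\<lambda>A. set_lebesgue_integral lborel A f"]) auto
    also have "\<dots> = (LBINT v:{x..<z+1}. f v) + J (z + 1)"
      unfolding J_def f_def using that
      by (intro set_integral_Un set_integrable_subset[OF h_integrable[of x]]) auto
    also have "(LBINT v:{x..<z+1}. f v) = (LBINT v:{x..z+1}. f v)"
      by (rule set_integral_cong_set)
         (auto simp: set_borel_measurable_def f_def intro!: AE_I[of _ _ "{z+1}"])
    also have "\<dots> = integral {x..z+1} f"
      by (intro set_borel_integral_eq_integral(2) borel_integrable_atLeastAtMost' f_cont)
    finally show ?thesis .
  qed
  have "((\<lambda>x. integral {x..z+1} f + J (z + 1)) has_real_derivative - f z + 0) (at z within {z-1..z+1})"
    by (intro DERIV_add integral_has_real_derivative' f_cont DERIV_const) auto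
  then have "((\<lambda>x. integral {x..z+1} f + J (z + 1)) has_real_derivative - f z) (at z)"
    by (simp add: at_within_Icc_at)
  then have "(J has_real_derivative - f z) (at z)"
    by (rule has_field_derivative_transform_within[where d=1])
       (auto simp: dist_real_def intro!: split[symmetric])
  then have "((\<lambda>z. u * exp (u * z) * J z) has_real_derivative
      u * (exp (u * z) * u) * J z + - f z * (u * exp (u * z))) (at z)"
    by (auto intro!: derivative_eq_intros)
  moreover have "(\<lambda>z. u * exp (u * z) * J z) = C"
    by (auto simp: cost_eq_tail J_def f_def)
  moreover have "u * (exp (u * z) * u) * J z + - f z * (u * exp (u * z)) = u * (C z - h z)"
    by (simp add: cost_eq_tail J_def f_def algebra_simps exp_minus)
  ultimately show ?thesis by simp
qed

lemma cost_cont: "continuous_on S C"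
  by (intro continuous_at_imp_continuous_on ballI DERIV_isCont[OF cost_has_derivative])

lemma cost_borel [measurable]: "C \<in> borel_measurable borel"
  by (rule borel_measurable_continuous_onI[OF cost_cont])

end

section \<open>The potential of the reflected motion\<close>

text \<open>For \<open>C = cost h \<gamma>\<close> put \<open>W z = 2 / (\<sigma>\<^sup>2 * \<gamma>) * potential C r r z\<close>. The differential
  equation for \<open>C\<close> gives \<open>\<sigma>\<^sup>2 / 2 * W'' + \<theta> * W' = h - C r\<close>, and the slope of \<open>W\<close> vanishes at
  \<open>r\<close>: this is the Poisson equation with reflection at \<open>r\<close>. The second initial point \<open>y\<close> makes
  the potential an increment of \<open>W\<close>, so that it telescopes along a path.\<close>

definition potential :: "(real \<Rightarrow> real) \<Rightarrow> real \<Rightarrow> real \<Rightarrow> real \<Rightarrow> real" where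
  "potential C r y z = C r * (z - y) - (LBINT v=y..z. C v)"

lemma potential_refl [simp]: "potential C r y y = 0"
  by (simp add: potential_def)

lemma antiderivative_ex:
  fixes C :: "real \<Rightarrow> real"
  assumes "continuous_on UNIV C"
  obtains P where "\<And>x. (P has_real_derivative C x) (at x)"
    and "\<And>r y z. potential C r y z = C r * (z - y) - (P z - P y)"
proof -
  have "\<exists>P. \<forall>x::real. -\<infinity> < ereal x \<longrightarrow> ereal x < \<infinity> \<longrightarrow> (P has_vector_derivative C x) (at x)"
    using assms by (intro einterval_antiderivative) (auto simp: continuous_on_eq_continuous_at)
  then obtain P where P: "\<And>x. (P has_real_derivative C x) (at x)"
    by (auto simp: has_real_derivative_iff_has_vector_derivative)
  have "(LBINT v=y..z. C v) = P z - P y" for y z :: real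
    using P by (intro interval_integral_FTC_finite continuous_on_subset[OF assms])
      (auto simp: has_real_derivative_iff_has_vector_derivative intro: has_vector_derivative_at_within)
  then show thesis by (intro that[of P] P) (simp add: potential_def)
qed

context
  fixes C :: "real \<Rightarrow> real"
  assumes cont: "continuous_on UNIV C"
begin

lemma potential_add: "potential C r y z + potential C r z w = potential C r y w"
proof (rule antiderivative_ex[OF cont])
  fix P assume "\<And>r y z. potential C r y z = C r * (z - y) - (P z - P y)"
  then show ?thesis by (simp only:) (simp add: algebra_simps)
qed

lemma potential_has_derivative:
  "((\<lambda>z. potential C r y z) has_real_derivative C r - C z) (at z)"
proof (rule antiderivative_ex[OF cont])
  fix P assume P: "\<And>x. (P has_real_derivative C x) (at x)"
    "\<And>r y z. potential C r y z = C r * (z - y) - (P z - P y)"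
  show ?thesis
    unfolding P(2) by (auto intro!: derivative_eq_intros P(1))
qed

lemma potential_measurable:
  assumes [measurable]: "X \<in> borel_measurable N" "Y \<in> borel_measurable N" "Z \<in> borel_measurable N"
  shows "(\<lambda>\<omega>. potential C (X \<omega>) (Y \<omega>) (Z \<omega>)) \<in> borel_measurable N"
proof (rule antiderivative_ex[OF cont])
  fix P assume P: "\<And>x. (P has_real_derivative C x) (at x)"
    "\<And>r y z. potential C r y z = C r * (z - y) - (P z - P y)"
  have [measurable]: "P \<in> borel_measurable borel"
    by (intro borel_measurable_continuous_onI continuous_at_imp_continuous_on ballI DERIV_isCont[OF P(1)])
  have [measurable]: "C \<in> borel_measurable borel"
    by (rule borel_measurable_continuous_onI[OF cont])
  show ?thesis
    unfolding P(2) by measurable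
qed

lemma potential_mvt: "\<exists>t. \<bar>t - y\<bar> \<le> \<bar>z - y\<bar> \<and> potential C r y z = (z - y) * (C r - C t)"
proof (cases "y = z")
  case False
  then consider "y < z" | "z < y" by linarith
  then show ?thesis
  proof cases
    case 1
    from MVT2[OF 1, of "potential C r y" "\<lambda>v. C r - C v"] potential_has_derivative
    obtain t where "y < t" "t < z" "potential C r y z - potential C r y y = (z - y) * (C r - C t)"
      by blast
    then show ?thesis by (intro exI[of _ t]) auto
  next
    case 2
    from MVT2[OF 2, of "potential C r y" "\<lambda>v. C r - C v"] potential_has_derivative
    obtain t where "z < t" "t < y" "potential C r y y - potential C r y z = (y - z) * (C r - C t)"
      by blast
    then show ?thesis by (intro exI[of _ t]) (auto simp: algebra_simps)
  qed
qed auto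

lemma abs_potential_le:
  assumes "\<And>v. 0 \<le> C v" "\<And>v. C v \<le> L"
  shows "\<bar>potential C r y z\<bar> \<le> L * \<bar>z - y\<bar>"
proof -
  obtain t where "potential C r y z = (z - y) * (C r - C t)"
    using potential_mvt by blast
  moreover have "\<bar>C r - C t\<bar> \<le> L"
    using assms[of r] assms[of t] by linarith
  ultimately show ?thesis
    by (simp add: abs_mult mult.commute[of L] mult_left_mono)
qed

lemma potential_upper_right:
  assumes "y \<le> z" "\<And>v. y \<le> v \<Longrightarrow> 0 \<le> C v"
  shows "potential C r y z \<le> C r * (z - y)"
proof -
  have "C r * z - potential C r y z \<ge> C r * y - potential C r y y"
    by (rule DERIV_nonneg_imp_nondecreasing[OF assms(1)])
       (use assms(2) in \<open>auto intro!: exI derivative_eq_intros potential_has_derivative\<close>)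
  then show ?thesis by (simp add: algebra_simps)
qed

context
  fixes A l K :: real
  assumes C_nonneg: "\<And>v. - K \<le> v \<Longrightarrow> 0 \<le> C v"
    and C_growth: "\<And>v. - K \<le> v \<Longrightarrow> C v \<le> A * exp (l * (v + K))"
    and l_pos: "0 < l" and K: "0 \<le> A"
begin

text \<open>Below its initial state a path gains at most the integral of the exponential bound on \<open>C\<close>
  over the descent.\<close>

lemma potential_upper_left:
  assumes "- K \<le> r" "- K \<le> z" "z \<le> y"
  shows "potential C r y z \<le> A / l * (exp (l * (y + K)) - exp (l * (z + K)))"
proof -
  have "potential C r y z + A / l * exp (l * (z + K)) \<le> potential C r y y + A / l * exp (l * (y + K))"
  proof (rule DERIV_nonneg_imp_nondecreasing[OF assms(3)])
    fix v assume v: "z \<le> v" "v \<le> y"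
    have "((\<lambda>v. potential C r y v + A / l * exp (l * (v + K))) has_real_derivative
        (C r - C v) + A * exp (l * (v + K))) (at v)"
      using l_pos by (auto intro!: derivative_eq_intros potential_has_derivative)
    moreover have "0 \<le> (C r - C v) + A * exp (l * (v + K))"
      using C_nonneg[of r] C_growth[of v] v assms by auto
    ultimately show "\<exists>D. ((\<lambda>v. potential C r y v + A / l * exp (l * (v + K))) has_real_derivative D) (at v) \<and> 0 \<le> D"
      by blast
  qed
  then show ?thesis by (simp add: algebra_simps)
qed

lemma potential_lower_right:
  assumes "- K \<le> r" "- K \<le> y" "y \<le> z"
  shows "- potential C r y z \<le> A / l * (exp (l * (z + K)) - exp (l * (y + K)))"
proof -
  have "potential C r z y = - potential C r y z"
    using potential_add[of r y z y] by simp
  then show ?thesis using potential_upper_left[OF assms(1-3)] by simp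
qed

text \<open>The cost \<open>C r\<close> at the level is charged only for the ascent above \<open>y\<close>, so that the term
  \<open>exp (l * (y + K))\<close>, which comes from a descent, is counted once.\<close>

lemma potential_upper:
  assumes "- K \<le> r" "- K \<le> y" "- K \<le> z"
  shows "potential C r y z \<le>
    A / l * (exp (l * (r + K)) * (l * max 0 (z - y)) + exp (l * (y + K)))"
proof (cases "y \<le> z")
  case True
  then have "potential C r y z \<le> C r * (z - y)"
    using assms C_nonneg by (intro potential_upper_right) auto
  also have "\<dots> \<le> A * exp (l * (r + K)) * (z - y)"
    using True C_growth assms by (intro mult_right_mono) auto
  also have "\<dots> = A / l * (exp (l * (r + K)) * (l * max 0 (z - y)) + 0)"
    using True l_pos by (simp add: max_def)
  also have "\<dots> \<le> A / l * (exp (l * (r + K)) * (l * max 0 (z - y)) + exp (l * (y + K)))"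
    using l_pos K by (intro mult_left_mono add_left_mono) auto
  finally show ?thesis .
next
  case False
  then have "potential C r y z \<le> A / l * (exp (l * (y + K)) - exp (l * (z + K)))"
    using assms by (intro potential_upper_left) auto
  also have "\<dots> \<le> A / l * (exp (l * (r + K)) * (l * max 0 (z - y)) + exp (l * (y + K)))"
    using l_pos K False by (intro mult_left_mono) auto
  finally show ?thesis .
qed

text \<open>A cruder bound that is symmetric in both states and serves as a dominating function.\<close>

lemma abs_potential_le_exp:
  assumes "- K \<le> r" "r \<le> y" "r \<le> z"
  shows "\<bar>potential C r y z\<bar> \<le> A / l * (exp (l * (y + K)) + exp (l * (z + K)))"
proof -
  have *: "potential C r y z \<le> A / l * (exp (l * (y + K)) + exp (l * (z + K)))"
    if yz: "- K \<le> r" "r \<le> y" "r \<le> z" for y z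
  proof -
    have "l * max 0 (z - y) \<le> exp (l * max 0 (z - y))"
      using exp_ge_add_one_self[of "l * max 0 (z - y)"] by linarith
    then have "exp (l * (r + K)) * (l * max 0 (z - y)) \<le> exp (l * (r + K)) * exp (l * max 0 (z - y))"
      by (intro mult_left_mono) auto
    also have "\<dots> = exp (l * (r + K) + l * max 0 (z - y))" by (simp add: exp_add)
    also have "\<dots> \<le> exp (l * (z + K))"
      using l_pos yz mult_left_mono[of r y l] mult_left_mono[of r z l] by (auto simp: max_def algebra_simps)
    finally have le: "exp (l * (r + K)) * (l * max 0 (z - y)) \<le> exp (l * (z + K))" .
    have "potential C r y z \<le> A / l * (exp (l * (r + K)) * (l * max 0 (z - y)) + exp (l * (y + K)))"
      using yz by (intro potential_upper) auto
    also have "\<dots> \<le> A / l * (exp (l * (y + K)) + exp (l * (z + K)))"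
      using le l_pos K by (intro mult_left_mono) auto
    finally show ?thesis .
  qed
  have "potential C r z y = - potential C r y z"
    using potential_add[of r y z y] by simp
  then show ?thesis using *[OF assms] *[OF assms(1,3,2)] by (auto simp: abs_le_iff algebra_simps)
qed

end
end

context discounted_cost
begin

text \<open>The second derivative of \<open>potential C r y\<close>, the same for all \<open>r\<close> and \<open>y\<close>.\<close>

definition curv :: "real \<Rightarrow> real" where
  "curv v = u * (h v - C v)"

lemma potential_taylor:
  "\<exists>t. \<bar>t - z\<bar> \<le> \<bar>d\<bar> \<and> potential C r z (z + d) = (C r - C z) * d + curv t / 2 * d\<^sup>2"
proof (cases "d = 0")
  case False
  define diff where "diff = (\<lambda>m::nat. if m = 0 then potential C r z else if m = 1 then (\<lambda>v. C r - C v) else curv)"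
  have "\<exists>t. (if z + d < z then z + d < t \<and> t < z else z < t \<and> t < z + d) \<and>
    potential C r z (z + d) = (\<Sum>m<2. (diff m z / fact m) * (z + d - z)^m) + (diff 2 t / fact 2) * (z + d - z)^2"
  proof (rule Taylor[where a="min z (z + d)" and b="max z (z + d)"])
    show "\<forall>m t. m < 2 \<and> min z (z + d) \<le> t \<and> t \<le> max z (z + d) \<longrightarrow> DERIV (diff m) t :> diff (Suc m) t"
      by (auto simp: diff_def less_2_cases_iff curv_def intro!: potential_has_derivative[OF cost_cont]
          derivative_eq_intros cost_has_derivative) (simp add: algebra_simps)
  qed (use False in \<open>auto simp: diff_def\<close>)
  then obtain t where t: "if z + d < z then z + d < t \<and> t < z else z < t \<and> t < z + d"
    "potential C r z (z + d) = (\<Sum>m<2. (diff m z / fact m) * (z + d - z)^m) + (diff 2 t / fact 2) * (z + d - z)^2"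
    by blast
  have "\<bar>t - z\<bar> \<le> \<bar>d\<bar>"
    using t(1) by (auto split: if_splits)
  then show ?thesis
    using t(2) by (intro exI[of _ t]) (auto simp: diff_def numeral_2_eq_2)
qed (auto intro!: exI[of _ z])

text \<open>After a reflected step the second order expansion has two errors. The usual remainder is
  small when the step is short. Below the level \<open>r\<close>, reflection returns the state to \<open>r\<close>, where
  the slope vanishes, so that this costs only the square of the push; that square is compared with
  the push itself, whose total is bounded.\<close>

lemma reflected_step_expansion:
  assumes L: "\<And>v. \<bar>curv v\<bar> \<le> L" and "0 < \<eta>" "0 \<le> \<epsilon>"
    and modulus: "\<And>v w. \<bar>v - w\<bar> \<le> \<eta> \<Longrightarrow> \<bar>curv v - curv w\<bar> \<le> \<epsilon>"
    and "r \<le> z"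
  shows "\<bar>potential C r z (max (z + d) r) - ((C r - C z) * d + curv z / 2 * d\<^sup>2)\<bar>
    \<le> \<epsilon> / 2 * d\<^sup>2 + L * \<eta> / 2 * max 0 (r - z - d) + 3 * L / (2 * \<eta>\<^sup>2) * d ^ 4"
proof -
  have L0: "0 \<le> L" using L[of 0] by linarith
  have quartic: "e\<^sup>2 \<le> d ^ 4 / \<eta>\<^sup>2" if "\<eta> < \<bar>e\<bar>" "\<bar>e\<bar> \<le> \<bar>d\<bar>" for e
  proof -
    have "\<eta>\<^sup>2 \<le> d\<^sup>2" "e\<^sup>2 \<le> d\<^sup>2"
      using that \<open>0 < \<eta>\<close> by (auto simp: abs_le_square_iff[symmetric])
    then have "e\<^sup>2 * \<eta>\<^sup>2 \<le> d\<^sup>2 * d\<^sup>2" by (intro mult_mono) auto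
    then show ?thesis using \<open>0 < \<eta>\<close> by (simp add: field_simps power4_eq_xxxx power2_eq_square)
  qed
  obtain t where t: "\<bar>t - z\<bar> \<le> \<bar>d\<bar>" "potential C r z (z + d) = (C r - C z) * d + curv t / 2 * d\<^sup>2"
    using potential_taylor by blast
  have "\<bar>curv t - curv z\<bar> * d\<^sup>2 \<le> \<epsilon> * d\<^sup>2 + 2 * L * (d ^ 4 / \<eta>\<^sup>2)"
  proof (cases "\<bar>d\<bar> \<le> \<eta>")
    case True
    then have "\<bar>curv t - curv z\<bar> * d\<^sup>2 \<le> \<epsilon> * d\<^sup>2"
      using t by (intro mult_right_mono modulus) auto
    then show ?thesis using L0 by (smt (verit) mult_nonneg_nonneg zero_le_divide_iff zero_le_even_power zero_le_power2 even_numeral)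
  next
    case False
    have "\<bar>curv t - curv z\<bar> * d\<^sup>2 \<le> 2 * L * (d ^ 4 / \<eta>\<^sup>2)"
      using L[of t] L[of z] quartic[of d] False L0 by (intro mult_mono) auto
    then show ?thesis using \<open>0 \<le> \<epsilon>\<close> by (smt (verit) mult_nonneg_nonneg zero_le_power2)
  qed
  then have 1: "\<bar>potential C r z (z + d) - ((C r - C z) * d + curv z / 2 * d\<^sup>2)\<bar>
      \<le> \<epsilon> / 2 * d\<^sup>2 + L * (d ^ 4 / \<eta>\<^sup>2)"
    unfolding t(2)
    by (simp add: abs_mult left_diff_distrib[symmetric] diff_divide_distrib[symmetric] mult.commute mult.left_commute)
  have 2: "\<bar>potential C r (z + d) (max (z + d) r)\<bar>
      \<le> L / 2 * (\<eta> * max 0 (r - z - d) + d ^ 4 / \<eta>\<^sup>2)"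
  proof (cases "r \<le> z + d")
    case True
    then have "max (z + d) r = z + d" by simp
    then show ?thesis using L0 \<open>0 < \<eta>\<close> by (simp only: potential_refl) simp
  next
    case False
    define e where "e = z + d - r"
    obtain t where t: "potential C r r (r + e) = (C r - C r) * e + curv t / 2 * e\<^sup>2"
      using potential_taylor[of r e r] by blast
    have "potential C r (z + d) (max (z + d) r) = - potential C r r (r + e)"
      using potential_add[OF cost_cont, of r "z + d" r "z + d"] False by (simp add: max_def e_def)
    then have "\<bar>potential C r (z + d) (max (z + d) r)\<bar> = \<bar>curv t\<bar> / 2 * e\<^sup>2"
      using t by (simp add: abs_mult)
    also have "\<dots> \<le> L / 2 * e\<^sup>2" using L[of t] by (intro mult_right_mono) auto
    also have "e\<^sup>2 \<le> \<eta> * max 0 (r - z - d) + d ^ 4 / \<eta>\<^sup>2"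
    proof (cases "\<bar>e\<bar> \<le> \<eta>")
      case True
      then have "e\<^sup>2 \<le> \<eta> * \<bar>e\<bar>"
        by (metis abs_ge_zero mult_right_mono power2_abs power2_eq_square)
      also have "\<bar>e\<bar> = max 0 (r - z - d)" using False by (auto simp: e_def)
      finally have "e\<^sup>2 \<le> \<eta> * max 0 (r - z - d)" .
      moreover have "0 \<le> d ^ 4 / \<eta>\<^sup>2" by simp
      ultimately show ?thesis by linarith
    next
      case False': False
      then have "e\<^sup>2 \<le> d ^ 4 / \<eta>\<^sup>2"
        using \<open>r \<le> z\<close> False by (intro quartic) (auto simp: e_def)
      moreover have "0 \<le> \<eta> * max 0 (r - z - d)" using \<open>0 < \<eta>\<close> by simp
      ultimately show ?thesis by linarith
    qed
    finally show ?thesis using L0 by (simp add: mult_left_mono)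
  qed
  have "potential C r z (max (z + d) r) = potential C r z (z + d) + potential C r (z + d) (max (z + d) r)"
    by (rule potential_add[OF cost_cont, symmetric])
  then have "\<bar>potential C r z (max (z + d) r) - ((C r - C z) * d + curv z / 2 * d\<^sup>2)\<bar>
    \<le> \<epsilon> / 2 * d\<^sup>2 + L * (d ^ 4 / \<eta>\<^sup>2) + L / 2 * (\<eta> * max 0 (r - z - d) + d ^ 4 / \<eta>\<^sup>2)"
    using 1 2 by linarith
  also have "\<dots> = \<epsilon> / 2 * d\<^sup>2 + L * \<eta> / 2 * max 0 (r - z - d) + 3 * L / (2 * \<eta>\<^sup>2) * d ^ 4"
    by (simp add: field_simps)
  finally show ?thesis .
qed

lemma curv_borel [measurable]: "curv \<in> borel_measurable borel"
  unfolding curv_def[abs_def] by measurable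

lemma
  assumes "\<And>v. 0 \<le> h v" "\<And>v. h v \<le> S"
  shows cost_bounded: "0 \<le> C v" "C v \<le> S"
    and curv_bounded: "\<bar>curv v\<bar> \<le> u * S"
proof -
  interpret c: discounted_cost "\<lambda>_. S" u
    by unfold_locales (use u_pos set_integrable_exp_Ici[of u] in auto)
  show C: "0 \<le> C v" "C v \<le> S"
    using cost_nonneg[of v] cost_mono[OF c.discounted_cost_axioms, of v] assms cost_const[OF u_pos, of S v]
    by auto
  then have "\<bar>h v - C v\<bar> \<le> S" using assms[of v] by auto
  then show "\<bar>curv v\<bar> \<le> u * S" using u_pos by (simp add: curv_def abs_mult)
qed

text \<open>The cost is Lipschitz because its derivative is \<open>- curv\<close>, so that \<open>curv\<close> inherits uniform
  continuity from \<open>h\<close>. The bound \<open>\<eta> \<le> \<epsilon>\<close> lets one parameter control both errors of a step.\<close>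

lemma curv_modulus:
  assumes "\<And>v. 0 \<le> h v" "\<And>v. h v \<le> S" "uniformly_continuous_on UNIV h" "0 < \<epsilon>"
  obtains \<eta> where "0 < \<eta>" "\<eta> \<le> \<epsilon>" "\<And>v w. \<bar>v - w\<bar> \<le> \<eta> \<Longrightarrow> \<bar>curv v - curv w\<bar> \<le> \<epsilon>"
proof -
  have "(u * S)-lipschitz_on UNIV C"
  proof (rule bounded_derivative_imp_lipschitz[where f'="\<lambda>v x. u * (C v - h v) * x"])
    show "(C has_derivative (\<lambda>x. u * (C v - h v) * x)) (at v within UNIV)" for v
      using cost_has_derivative[of v] by (simp add: has_field_derivative_def)
    show "onorm (\<lambda>x. u * (C v - h v) * x) \<le> u * S" for v
    proof (rule onorm_le)
      show "norm (u * (C v - h v) * x) \<le> u * S * norm x" for x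
        using curv_bounded[OF assms(1,2), of v]
        by (simp add: curv_def abs_mult abs_minus_commute mult_right_mono)
    qed
  qed (use assms(1)[of 0] assms(2)[of 0] u_pos in auto)
  then have "uniformly_continuous_on UNIV C"
    by (rule lipschitz_on_uniformly_continuous)
  then have "uniformly_continuous_on UNIV curv"
    unfolding curv_def using assms(3)
    by (intro bounded_linear.uniformly_continuous_on[OF bounded_linear_mult_right] uniformly_continuous_on_diff)
  then obtain d where d: "0 < d" "\<And>v w. dist v w < d \<Longrightarrow> dist (curv v) (curv w) < \<epsilon>"
    unfolding uniformly_continuous_on_def using \<open>0 < \<epsilon>\<close> by (metis UNIV_I)
  show thesis
    by (rule that[of "min (d/2) \<epsilon>"]) (use d \<open>0 < \<epsilon>\<close> in \<open>auto simp: dist_real_def intro!: less_imp_le\<close>)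
qed

end

section \<open>The optimal level\<close>

text \<open>Left of \<open>0\<close> the derivative of \<open>exp (- u * r) * (C r - h r)\<close> is
  \<open>- exp (- u * r) * deriv h r\<close>, so the cost gap has at most one zero there. Right of \<open>0\<close> it is
  positive, and far to the left it is negative.\<close>

locale bowl_cost = discounted_cost +
  assumes h_nonneg: "\<And>x. 0 \<le> h x"
    and h_increasing: "strict_mono_on {0..} h"
    and h_decreasing: "\<And>x. x < 0 \<Longrightarrow> h differentiable (at x)" "\<And>x. x < 0 \<Longrightarrow> deriv h x < 0"
    and h_at_bot: "filterlim h at_top at_bot"
begin

definition scaled_gap :: "real \<Rightarrow> real" where
  "scaled_gap r = exp (- u * r) * (C r - h r)"

lemma scaled_gap_sign: "cost_gap h u r = exp (u * r) * scaled_gap r"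
  by (simp add: scaled_gap_def cost_gap_def exp_minus)

lemma scaled_gap_cont: "continuous_on S scaled_gap"
  unfolding scaled_gap_def
  by (intro continuous_intros cost_cont continuous_on_subset[OF h_cont]) auto

lemma h_deriv: "x < 0 \<Longrightarrow> (h has_real_derivative deriv h x) (at x)"
  using h_decreasing(1) by (simp add: DERIV_deriv_iff_real_differentiable)

lemma scaled_gap_deriv:
  "x < 0 \<Longrightarrow> (scaled_gap has_real_derivative - (exp (- u * x) * deriv h x)) (at x)"
  unfolding scaled_gap_def
  by (auto intro!: derivative_eq_intros cost_has_derivative h_deriv) (simp add: algebra_simps)

lemma scaled_gap_strict_mono:
  assumes "x < y" "y \<le> 0"
  shows "scaled_gap x < scaled_gap y"
proof (rule DERIV_pos_imp_increasing_open[OF assms(1)])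
  fix z assume "x < z" "z < y"
  then show "\<exists>D. (scaled_gap has_real_derivative D) (at z) \<and> 0 < D"
    using scaled_gap_deriv[of z] h_decreasing(2)[of z] assms
    by (intro exI[of _ "- (exp (- u * z) * deriv h z)"]) (auto intro: mult_pos_neg)
qed (rule scaled_gap_cont)

text \<open>Past \<open>r \<ge> 0\<close> the cost is an average of larger values of \<open>h\<close>; strictness comes from
  the values beyond \<open>r + 1\<close>.\<close>

lemma cost_gap_pos:
  assumes "0 \<le> r"
  shows "h r < C r"
proof -
  have mono: "h x \<le> h y" if "0 \<le> x" "x \<le> y" for x y
    using strict_mono_onD[OF h_increasing, of x y] that by (cases "x = y") auto
  have "h r < h (r + 1)"
    using strict_mono_onD[OF h_increasing, of r "r + 1"] assms by auto
  also have "h (r + 1) \<le> C (r + 1)"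
    using mono assms by (intro cost_ge) auto
  finally have "0 < exp (- u * (r + 1)) * (C (r + 1) - h r)" by simp
  also have "\<dots> \<le> exp (- u * r) * (C r - h r)"
  proof (rule DERIV_nonpos_imp_nonincreasing[of r "r + 1" "\<lambda>z. exp (- u * z) * (C z - h r)"])
    fix z assume z: "r \<le> z" "z \<le> r + 1"
    have "((\<lambda>z. exp (- u * z) * (C z - h r)) has_real_derivative - u * exp (- u * z) * (h z - h r)) (at z)"
      by (auto intro!: derivative_eq_intros cost_has_derivative) (simp add: algebra_simps)
    moreover have "- u * exp (- u * z) * (h z - h r) \<le> 0"
      using mono[of r z] assms z u_pos by (auto simp: mult_nonneg_nonneg)
    ultimately show "\<exists>D. ((\<lambda>z. exp (- u * z) * (C z - h r)) has_real_derivative D) (at z) \<and> D \<le> 0"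
      by blast
  qed simp
  finally show ?thesis by (simp add: zero_less_mult_iff)
qed

text \<open>Left of \<open>- 1\<close> the scaled gap increases at least as fast as \<open>- exp u * h\<close>. If it stayed nonnegative,
  \<open>h\<close> would be bounded near \<open>- \<infinity>\<close>.\<close>

lemma scaled_gap_neg_ex: "\<exists>r<0. scaled_gap r < 0"
proof (rule ccontr)
  assume "\<not> (\<exists>r<0. scaled_gap r < 0)"
  then have nonneg: "0 \<le> scaled_gap r" if "r < 0" for r
    using that by force
  have bound: "h r \<le> scaled_gap (-1) * exp (- u) + h (-1)" if r: "r \<le> -1" for r
  proof -
    have "scaled_gap r + exp u * h r \<le> scaled_gap (-1) + exp u * h (-1)"
    proof (rule DERIV_nonneg_imp_nondecreasing[OF r])
      fix x :: real assume x: "r \<le> x" "x \<le> -1"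
      have "((\<lambda>x. scaled_gap x + exp u * h x) has_real_derivative
          (exp u - exp (- u * x)) * deriv h x) (at x)"
        using x by (auto intro!: derivative_eq_intros scaled_gap_deriv h_deriv) (simp add: algebra_simps)
      moreover have "exp u \<le> exp (- u * x)"
        using x u_pos mult_left_mono[of x "-1" u] by simp
      then have "0 \<le> (exp u - exp (- u * x)) * deriv h x"
        using h_decreasing(2)[of x] x by (intro mult_nonpos_nonpos) auto
      ultimately show "\<exists>D. ((\<lambda>x. scaled_gap x + exp u * h x) has_real_derivative D) (at x) \<and> 0 \<le> D"
        by blast
    qed
    then have "exp u * h r \<le> scaled_gap (-1) + exp u * h (-1)"
      using nonneg[of r] r by simp
    then show ?thesis by (simp add: exp_minus field_simps)
  qed
  have "\<forall>\<^sub>F r in at_bot. scaled_gap (-1) * exp (- u) + h (-1) < h r"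
    using h_at_bot by (simp add: filterlim_at_top_dense)
  moreover have "\<forall>\<^sub>F r :: real in at_bot. r \<le> -1"
    by (rule eventually_le_at_bot)
  ultimately have "\<forall>\<^sub>F r :: real in at_bot. False"
    by eventually_elim (use bound in force)
  then show False by simp
qed

lemma opt_level_unique: "\<exists>!r. cost_gap h u r = 0"
proof -
  have zero_iff: "cost_gap h u r = 0 \<longleftrightarrow> scaled_gap r = 0" for r
    by (simp add: scaled_gap_sign)
  have pos: "0 < scaled_gap r" if "0 \<le> r" for r
    using cost_gap_pos[OF that] by (simp add: scaled_gap_def)
  obtain r where r: "r < 0" "scaled_gap r < 0" using scaled_gap_neg_ex by blast
  then obtain z where "scaled_gap z = 0"
    using IVT'[of scaled_gap r 0 0] pos[of 0] scaled_gap_cont by force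
  moreover have "x = y" if "scaled_gap x = 0" "scaled_gap y = 0" for x y
    using that pos[of x] pos[of y] scaled_gap_strict_mono[of x y] scaled_gap_strict_mono[of y x]
    by (cases x y rule: linorder_cases) force+
  ultimately show ?thesis unfolding zero_iff by blast
qed

lemma cost_gap_opt_level: "cost_gap h u (opt_level h u) = 0"
  unfolding opt_level_def by (rule theI'[OF opt_level_unique])

lemma opt_level_le_iff:
  assumes "c < 0"
  shows "opt_level h u \<le> c \<longleftrightarrow> 0 \<le> cost_gap h u c"
proof -
  have z: "scaled_gap (opt_level h u) = 0"
    using cost_gap_opt_level by (simp add: scaled_gap_sign)
  have "opt_level h u < 0"
    using z cost_gap_pos[of "opt_level h u"] by (force simp: scaled_gap_def)
  then have "opt_level h u \<le> c \<longleftrightarrow> 0 \<le> scaled_gap c"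
    using z scaled_gap_strict_mono[of c "opt_level h u"] scaled_gap_strict_mono[of "opt_level h u" c] assms
    by (cases "opt_level h u" c rule: linorder_cases) auto
  then show ?thesis by (simp add: scaled_gap_sign zero_le_mult_iff)
qed

lemma cost_ge_opt_cost:
  assumes "opt_level h u \<le> y"
  shows "C (opt_level h u) \<le> C y"
proof (rule DERIV_nonneg_imp_nondecreasing[OF assms])
  fix x assume x: "opt_level h u \<le> x" "x \<le> y"
  have "h x \<le> C x"
  proof (cases "0 \<le> x")
    case True then show ?thesis using cost_gap_pos[of x] by simp
  next
    case False
    then show ?thesis using opt_level_le_iff[of x] x by (simp add: cost_gap_def)
  qed
  then show "\<exists>D. (C has_real_derivative D) (at x) \<and> 0 \<le> D"
    using cost_has_derivative[of x] u_pos by (intro exI[of _ "u * (C x - h x)"]) auto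
qed

end

text \<open>The events \<open>opt_level h u \<le> c\<close> are events about the sign of the cost gap at the fixed level
  \<open>c\<close>, and that gap is an integral which depends measurably on \<open>u\<close>.\<close>

lemma opt_level_measurable:
  assumes bowl: "\<And>u. \<gamma>\<^sub>0 \<le> u \<Longrightarrow> bowl_cost h u"
    and neg: "\<And>u. \<gamma>\<^sub>0 \<le> u \<Longrightarrow> opt_level h u < 0"
    and [measurable]: "X \<in> borel_measurable N" and ge: "\<And>\<omega>. \<gamma>\<^sub>0 \<le> X \<omega>"
  shows "(\<lambda>\<omega>. opt_level h (X \<omega>)) \<in> borel_measurable N"
proof (rule borel_measurableI_le)
  fix c
  interpret discounted_cost h \<gamma>\<^sub>0
    using bowl[of \<gamma>\<^sub>0] by (simp add: bowl_cost_def)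
  have [measurable]: "(\<lambda>u. cost_gap h u c) \<in> borel_measurable borel"
    unfolding cost_gap_def cost_def set_lebesgue_integral_def by measurable
  show "{\<omega> \<in> space N. opt_level h (X \<omega>) \<le> c} \<in> sets N"
  proof (cases "c < 0")
    case True
    then have "{\<omega> \<in> space N. opt_level h (X \<omega>) \<le> c} = {\<omega> \<in> space N. 0 \<le> cost_gap h (X \<omega>) c}"
      using bowl_cost.opt_level_le_iff[OF bowl[OF ge]] by auto
    then show ?thesis by simp
  next
    case False
    then have "{\<omega> \<in> space N. opt_level h (X \<omega>) \<le> c} = space N"
      using neg[OF ge] by (force simp: not_less intro: less_imp_le less_le_trans)
    then show ?thesis by simp
  qed
qed

section \<open>Increments of Brownian motion with drift\<close>

locale drifted_bm = brownian_motion M F B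
  for M :: "'a measure" and F :: "real \<Rightarrow> 'a measure" and B :: "real \<Rightarrow> 'a \<Rightarrow> real" +
  fixes \<theta> \<sigma> \<gamma> :: real
  assumes \<theta>_neg: "\<theta> < 0" and \<sigma>_pos: "0 < \<sigma>" and \<gamma>_eq: "\<gamma> = - 2 * \<theta> / \<sigma>\<^sup>2"
begin

definition incr :: "real \<Rightarrow> real \<Rightarrow> 'a \<Rightarrow> real" where
  "incr s t \<omega> = \<theta> * (t - s) + \<sigma> * (B t \<omega> - B s \<omega>)"

lemma \<gamma>_pos: "0 < \<gamma>"
  using \<theta>_neg \<sigma>_pos by (simp add: \<gamma>_eq divide_neg_pos)

lemma \<theta>_eq: "\<theta> = - \<gamma> * \<sigma>\<^sup>2 / 2"
  using \<sigma>_pos by (simp add: \<gamma>_eq)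

lemma F_measurable_mono: "X \<in> borel_measurable (F s) \<Longrightarrow> s \<le> t \<Longrightarrow> X \<in> borel_measurable (F t)"
  using sets_F_mono[of s t] space_F by (auto simp: measurable_def)

lemma F_measurable: "X \<in> borel_measurable (F s) \<Longrightarrow> X \<in> borel_measurable M"
  using sets_F_subset[of s] space_F by (auto simp: measurable_def)

lemma incr_F_measurable: "0 \<le> s \<Longrightarrow> s \<le> t \<Longrightarrow> incr s t \<in> borel_measurable (F t)"
  unfolding incr_def using adapted_B[of t] F_measurable_mono[OF adapted_B[of s], of t] by measurable

lemma incr_add: "incr s t \<omega> + incr t v \<omega> = incr s v \<omega>"
  by (simp add: incr_def algebra_simps)

lemma incr_same [simp]: "incr s s \<omega> = 0"
  by (simp add: incr_def)

context
  fixes s t :: real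
  assumes s: "0 \<le> s" and st: "s < t"
begin

lemma incr_measurable [measurable]: "incr s t \<in> borel_measurable M"
  using incr_F_measurable F_measurable s st by (meson less_imp_le)

lemma B_diff_integral:
  assumes "g \<in> borel_measurable borel"
  shows "integrable M (\<lambda>\<omega>. g (B t \<omega> - B s \<omega>))
      \<longleftrightarrow> integrable lborel (\<lambda>x. normal_density 0 (sqrt (t - s)) x * g x)"
    and "(LINT \<omega>|M. g (B t \<omega> - B s \<omega>)) = (\<integral>x. normal_density 0 (sqrt (t - s)) x * g x \<partial>lborel)"
  using distributed_integrable[OF normal_increments[OF s st], of g]
    distributed_integral[OF normal_increments[OF s st], of g] assms by auto

lemma B_diff_power_integrable: "integrable M (\<lambda>\<omega>. (B t \<omega> - B s \<omega>) ^ k)"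
  using B_diff_integral(1)[of "\<lambda>x. x ^ k"] integrable_normal_moment[of "sqrt (t - s)" 0 k] st by simp

lemma B_diff_moments:
  "(LINT \<omega>|M. B t \<omega> - B s \<omega>) = 0"
  "(LINT \<omega>|M. (B t \<omega> - B s \<omega>)\<^sup>2) = t - s"
  "(LINT \<omega>|M. (B t \<omega> - B s \<omega>) ^ 4) = 3 * (t - s)\<^sup>2"
  using B_diff_integral(2)[of "\<lambda>x. x"] integral_normal_moment_odd[of "sqrt (t - s)" 0 0]
    B_diff_integral(2)[of "\<lambda>x. x ^ 2"] integral_normal_moment_even[of "sqrt (t - s)" 0 1]
    B_diff_integral(2)[of "\<lambda>x. x ^ 4"] integral_normal_moment_even[of "sqrt (t - s)" 0 2] st
  by (auto simp: fact_numeral power2_eq_square)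

lemma incr_square: "has_bochner_integral M (\<lambda>\<omega>. (incr s t \<omega>)\<^sup>2) (\<sigma>\<^sup>2 * (t - s) + \<theta>\<^sup>2 * (t - s)\<^sup>2)"
proof -
  have "(\<lambda>\<omega>. (incr s t \<omega>)\<^sup>2) = (\<lambda>\<omega>. \<theta>\<^sup>2 * (t - s)\<^sup>2
      + (2 * \<theta> * (t - s) * \<sigma>) * (B t \<omega> - B s \<omega>) + \<sigma>\<^sup>2 * (B t \<omega> - B s \<omega>)\<^sup>2)"
    by (auto simp: incr_def power2_eq_square algebra_simps)
  then show ?thesis
    using B_diff_power_integrable[of 1] B_diff_power_integrable[of 2] B_diff_moments
    by (simp add: has_bochner_integral_iff prob_space)
qed

lemma incr_mean: "has_bochner_integral M (incr s t) (\<theta> * (t - s))"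
proof -
  have "incr s t = (\<lambda>\<omega>. \<theta> * (t - s) + \<sigma> * (B t \<omega> - B s \<omega>))"
    by (auto simp: incr_def)
  then show ?thesis
    using B_diff_power_integrable[of 1] B_diff_moments
    by (simp add: has_bochner_integral_iff prob_space)
qed

lemma incr_fourth:
  "integrable M (\<lambda>\<omega>. incr s t \<omega> ^ 4)"
  "(LINT \<omega>|M. incr s t \<omega> ^ 4) \<le> 8 * \<theta> ^ 4 * (t - s) ^ 4 + 24 * \<sigma> ^ 4 * (t - s)\<^sup>2"
proof -
  have le: "incr s t \<omega> ^ 4 \<le> 8 * \<theta> ^ 4 * (t - s) ^ 4 + 8 * \<sigma> ^ 4 * (B t \<omega> - B s \<omega>) ^ 4" for \<omega>
  proof -
    have sq: "(a + b)\<^sup>2 \<le> 2 * a\<^sup>2 + 2 * b\<^sup>2" for a b :: real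
      using zero_le_power2[of "a - b"] by (simp add: power2_eq_square algebra_simps)
    have "((a + b)\<^sup>2)\<^sup>2 \<le> (2 * a\<^sup>2 + 2 * b\<^sup>2)\<^sup>2" for a b :: real
      by (intro power_mono sq) auto
    also have "(2 * a\<^sup>2 + 2 * b\<^sup>2)\<^sup>2 \<le> 2 * (2 * a\<^sup>2)\<^sup>2 + 2 * (2 * b\<^sup>2)\<^sup>2" for a b :: real
      by (rule sq)
    finally have "(a + b) ^ 4 \<le> 8 * a ^ 4 + 8 * b ^ 4" for a b :: real
      by (simp add: power_mult_distrib flip: power_mult)
    from this[of "\<theta> * (t - s)" "\<sigma> * (B t \<omega> - B s \<omega>)"] show ?thesis
      by (simp add: incr_def power_mult_distrib mult.assoc)
  qed
  have int: "integrable M (\<lambda>\<omega>. 8 * \<theta> ^ 4 * (t - s) ^ 4 + 8 * \<sigma> ^ 4 * (B t \<omega> - B s \<omega>) ^ 4)"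
    using B_diff_power_integrable[of 4] by simp
  show *: "integrable M (\<lambda>\<omega>. incr s t \<omega> ^ 4)"
    by (rule Bochner_Integration.integrable_bound[OF int]) (use le in \<open>auto intro!: order_trans[OF le abs_ge_self]\<close>)
  have "(LINT \<omega>|M. incr s t \<omega> ^ 4) \<le> (LINT \<omega>|M. 8 * \<theta> ^ 4 * (t - s) ^ 4 + 8 * \<sigma> ^ 4 * (B t \<omega> - B s \<omega>) ^ 4)"
    by (intro integral_mono * int le)
  also have "\<dots> = 8 * \<theta> ^ 4 * (t - s) ^ 4 + 24 * \<sigma> ^ 4 * (t - s)\<^sup>2"
    using B_diff_power_integrable[of 4] B_diff_moments(3) by (simp add: prob_space)
  finally show "(LINT \<omega>|M. incr s t \<omega> ^ 4) \<le> 8 * \<theta> ^ 4 * (t - s) ^ 4 + 24 * \<sigma> ^ 4 * (t - s)\<^sup>2" .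
qed

text \<open>Tilting a centred normal density by an exponential moves its mean. The exponent vanishes for
  \<open>l = \<gamma>\<close>, which makes \<open>exp (\<gamma> * incr s t)\<close> a multiplicative martingale step.\<close>

lemma incr_exp:
  "has_bochner_integral M (\<lambda>\<omega>. exp (l * incr s t \<omega>)) (exp (l * (l - \<gamma>) * \<sigma>\<^sup>2 * (t - s) / 2))"
proof -
  define v c where "v = t - s" and "c = l * \<sigma>"
  have v: "0 < v" using st by (simp add: v_def)
  have tilt: "normal_density 0 (sqrt v) x * exp (c * x)
      = exp (c\<^sup>2 * v / 2) * normal_density (c * v) (sqrt v) x" for x
  proof -
    have "exp (- (x\<^sup>2 / (2 * v))) * exp (c * x) = exp (c\<^sup>2 * v / 2) * exp (- ((x - c * v)\<^sup>2 / (2 * v)))"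
      using v by (simp add: exp_add[symmetric] power2_eq_square) (simp add: field_simps)
    then show ?thesis using v by (simp add: normal_density_def)
  qed
  have "integrable M (\<lambda>\<omega>. exp (c * (B t \<omega> - B s \<omega>)))"
    "(LINT \<omega>|M. exp (c * (B t \<omega> - B s \<omega>))) = exp (c\<^sup>2 * v / 2)"
    using B_diff_integral[of "\<lambda>x. exp (c * x)"] v by (auto simp: tilt v_def[symmetric])
  then have "has_bochner_integral M (\<lambda>\<omega>. exp (l * \<theta> * v) * exp (c * (B t \<omega> - B s \<omega>)))
      (exp (l * \<theta> * v) * exp (c\<^sup>2 * v / 2))"
    by (intro has_bochner_integral_mult_right) (simp add: has_bochner_integral_iff)
  moreover have "(\<lambda>\<omega>. exp (l * \<theta> * v) * exp (c * (B t \<omega> - B s \<omega>))) = (\<lambda>\<omega>. exp (l * incr s t \<omega>))"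
    by (auto simp: exp_add[symmetric] incr_def v_def c_def algebra_simps)
  moreover have "exp (l * \<theta> * v) * exp (c\<^sup>2 * v / 2) = exp (l * (l - \<gamma>) * \<sigma>\<^sup>2 * (t - s) / 2)"
    by (simp add: exp_add[symmetric] v_def c_def \<theta>_eq power2_eq_square) (simp add: algebra_simps)
  ultimately show ?thesis by simp
qed

lemma incr_indep:
  assumes X: "X \<in> borel_measurable (F s)"
  shows "indep_var borel X borel (incr s t)"
proof -
  define D where "D = (\<lambda>\<omega>. B t \<omega> - B s \<omega>)"
  have D[measurable]: "D \<in> borel_measurable M"
    unfolding D_def by (intro borel_measurable_diff F_measurable[OF adapted_B]) (use s st in auto)
  have [measurable]: "X \<in> borel_measurable M" using X by (rule F_measurable)
  have stable: "Int_stable {Y -` A \<inter> space M |A. A \<in> sets borel}" for Y :: "'a \<Rightarrow> real"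
  proof (unfold Int_stable_def, safe)
    fix A1 A2 :: "real set"
    assume "A1 \<in> sets borel" "A2 \<in> sets borel"
    then show "\<exists>A. Y -` A1 \<inter> space M \<inter> (Y -` A2 \<inter> space M) = Y -` A \<inter> space M \<and> A \<in> sets borel"
      by (intro exI[of _ "A1 \<inter> A2"]) auto
  qed
  have "indep_var borel X borel D"
    unfolding indep_var_eq
  proof (intro conjI indep_set_sigma_sets)
    show "indep_set {X -` A \<inter> space M |A. A \<in> sets borel} {D -` A \<inter> space M |A. A \<in> sets borel}"
      unfolding indep_sets2_eq
    proof (intro conjI ballI)
      have ind: "indep_set (sets (F s)) (sets (vimage_algebra (space M) D borel))"
        using indep_increments[OF s st] by (simp add: D_def)
      fix a b assume "a \<in> {X -` A \<inter> space M |A. A \<in> sets borel}" "b \<in> {D -` A \<inter> space M |A. A \<in> sets borel}"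
      moreover from this have "a \<in> sets (F s)" "b \<in> sets (vimage_algebra (space M) D borel)"
        using X space_F by (auto simp: sets_vimage_algebra2 dest: measurable_sets)
      ultimately show "prob (a \<inter> b) = prob a * prob b"
        using ind by (auto simp: indep_sets2_eq)
    qed (auto)
    show "Int_stable {X -` A \<inter> space M |A. A \<in> sets borel}" "Int_stable {D -` A \<inter> space M |A. A \<in> sets borel}"
      by (rule stable)+
  qed measurable
  from indep_var_compose[OF this, of "\<lambda>x. x" borel "\<lambda>x. \<theta> * (t - s) + \<sigma> * x" borel]
  show ?thesis by (simp add: comp_def D_def incr_def[abs_def])
qed

end
end

section \<open>Reflected random walks\<close>

text \<open>The Lindley recursion: reflected motion that is pushed back to \<open>r\<close> only at the times of a grid.\<close>

primrec refl_walk :: "(nat \<Rightarrow> real) \<Rightarrow> real \<Rightarrow> real \<Rightarrow> nat \<Rightarrow> real" where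
  "refl_walk d r y 0 = y"
| "refl_walk d r y (Suc k) = max (refl_walk d r y k + d k) r"

text \<open>The two terms are the free walk from \<open>y\<close> and the reflected walk from \<open>r\<close>. The second one does
  not feel the initial state, which allows bounds that are uniform in time.\<close>

lemma refl_walk_eq:
  assumes "r \<le> y"
  shows "refl_walk d r y k = max (y + (\<Sum>j<k. d j)) (r + refl_walk d 0 0 k)"
  by (induction k) (use assms in auto)

lemma refl_walk_ge: "r \<le> y \<Longrightarrow> r \<le> refl_walk d r y k"
  by (cases k) auto

lemma sum_le_refl_walk: "(\<Sum>j<k. d j) \<le> refl_walk d 0 0 k"
  using refl_walk_eq[of 0 0 d k] by simp

lemma refl_walk_push:
  "(\<Sum>j<k. max 0 (r - refl_walk d r y j - d j)) = refl_walk d r y k - y - (\<Sum>j<k. d j)"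
  by (induction k) auto

lemma refl_walk_le_path:
  fixes z x :: "real \<Rightarrow> real"
  assumes "mono g" and "z (g 0) = y"
    and "\<And>t. g 0 \<le> t \<Longrightarrow> r \<le> z t"
    and "\<And>u v. g 0 \<le> u \<Longrightarrow> u \<le> v \<Longrightarrow> x v - x u \<le> z v - z u"
  shows "refl_walk (\<lambda>k. x (g (Suc k)) - x (g k)) r y k \<le> z (g k)"
proof (induction k)
  case (Suc k)
  have "g 0 \<le> g k" "g k \<le> g (Suc k)" "g 0 \<le> g (Suc k)"
    using assms(1) by (auto simp: mono_def)
  then show ?case using assms(3)[of "g (Suc k)"] assms(4)[of "g k" "g (Suc k)"] Suc by simp
qed (simp add: assms)

text \<open>The gap between path and walk cannot grow over a cell on which the path is not pushed.
  On a cell on which it is pushed, the path visits \<open>r\<close>, so that the gap after that cell is at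
  most the oscillation on the cell.\<close>

lemma path_le_refl_walk:
  fixes z x :: "real \<Rightarrow> real"
  assumes "mono g" and "z (g 0) = y"
    and push: "\<And>u v. g 0 \<le> u \<Longrightarrow> u \<le> v \<Longrightarrow> x v - x u < z v - z u \<Longrightarrow> \<exists>w\<in>{u..v}. z w = r"
    and osc: "\<And>k w. k < n \<Longrightarrow> g k \<le> w \<Longrightarrow> w \<le> g (Suc k) \<Longrightarrow> z (g (Suc k)) - z w \<le> \<epsilon>"
    and "0 \<le> \<epsilon>" "k \<le> n"
  shows "z (g k) \<le> refl_walk (\<lambda>k. x (g (Suc k)) - x (g k)) r y k + \<epsilon>"
  using \<open>k \<le> n\<close>
proof (induction k)
  case (Suc k)
  have g: "g 0 \<le> g k" "g k \<le> g (Suc k)"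
    using assms(1) by (auto simp: mono_def)
  show ?case
  proof (cases "x (g (Suc k)) - x (g k) < z (g (Suc k)) - z (g k)")
    case True
    then obtain w where "w \<in> {g k..g (Suc k)}" "z w = r" using push[OF g] by blast
    then show ?thesis using osc[of k w] Suc by simp
  next
    case False
    then show ?thesis using Suc by simp
  qed
qed (use \<open>0 \<le> \<epsilon>\<close> assms(2) in simp)

text \<open>The right-hand side is the moment generating function of the exponential law of rate \<open>c\<close>; the
  comparison integrates the tail by layers.\<close>

lemma (in prob_space) nn_integral_exp_le_tail:
  assumes [measurable]: "X \<in> borel_measurable M" and nonneg: "\<And>\<omega>. 0 \<le> X \<omega>"
    and tail: "\<And>v. 0 \<le> v \<Longrightarrow> emeasure M {\<omega>\<in>space M. v \<le> X \<omega>} \<le> ennreal (exp (- c * v))"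
    and l: "0 < l" "l < c"
  shows "(\<integral>\<^sup>+\<omega>. ennreal (exp (l * X \<omega>)) \<partial>M) \<le> ennreal (c / (c - l))"
proof -
  interpret pair_sigma_finite M lborel ..
  let ?f = "\<lambda>v. ennreal (l * exp (l * v))"
  have layer: "ennreal (exp (l * x)) = 1 + (\<integral>\<^sup>+v. ?f v * indicator {0..x} v \<partial>lborel)" if "0 \<le> x" for x
  proof -
    have "(\<integral>\<^sup>+v. ?f v * indicator {0..x} v \<partial>lborel) = ennreal (exp (l * x) - exp (l * 0))"
      using that l by (intro nn_integral_FTC_Icc) (auto intro!: derivative_eq_intros)
    also have "1 + \<dots> = ennreal (1 + (exp (l * x) - 1))"
      using that l by (simp add: ennreal_1[symmetric] flip: ennreal_plus del: ennreal_1)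
    finally show ?thesis by simp
  qed
  have "(\<lambda>\<omega>. \<integral>\<^sup>+v. ?f v * indicator {0..X \<omega>} v \<partial>lborel) \<in> borel_measurable M"
    unfolding indicator_def atLeastAtMost_iff by measurable
  then have "(\<integral>\<^sup>+\<omega>. ennreal (exp (l * X \<omega>)) \<partial>M)
      = 1 + (\<integral>\<^sup>+\<omega>. (\<integral>\<^sup>+v. ?f v * indicator {0..X \<omega>} v \<partial>lborel) \<partial>M)"
    by (simp add: layer[OF nonneg] nn_integral_add emeasure_space_1)
  also have "(\<integral>\<^sup>+\<omega>. (\<integral>\<^sup>+v. ?f v * indicator {0..X \<omega>} v \<partial>lborel) \<partial>M)
      = (\<integral>\<^sup>+v. (\<integral>\<^sup>+\<omega>. ?f v * indicator {0..X \<omega>} v \<partial>M) \<partial>lborel)"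
    by (rule Fubini'[where f="\<lambda>\<omega> v. ?f v * indicator {0..X \<omega>} v", symmetric])
       (unfold indicator_def atLeastAtMost_iff, measurable)
  also have "\<dots> \<le> (\<integral>\<^sup>+v. ennreal (l * exp (- (c - l) * v)) * indicator {0..} v \<partial>lborel)"
  proof (intro nn_integral_mono)
    fix v :: real
    show "(\<integral>\<^sup>+\<omega>. ?f v * indicator {0..X \<omega>} v \<partial>M) \<le> ennreal (l * exp (- (c - l) * v)) * indicator {0..} v"
    proof (cases "0 \<le> v")
      case True
      have "(\<integral>\<^sup>+\<omega>. ?f v * indicator {0..X \<omega>} v \<partial>M) = (\<integral>\<^sup>+\<omega>. ?f v * indicator {\<omega>\<in>space M. v \<le> X \<omega>} \<omega> \<partial>M)"
        using True by (intro nn_integral_cong) (auto split: split_indicator)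
      also have "\<dots> = ?f v * emeasure M {\<omega>\<in>space M. v \<le> X \<omega>}"
        by (rule nn_integral_cmult_indicator) simp
      also have "\<dots> \<le> ?f v * ennreal (exp (- c * v))"
        using tail[OF True] by (rule mult_left_mono) simp
      also have "\<dots> = ennreal (l * exp (- (c - l) * v))"
        using l by (simp add: ennreal_mult[symmetric] exp_add[symmetric] algebra_simps)
      finally show ?thesis using True by simp
    qed (simp add: indicator_def)
  qed
  also have "\<dots> = ennreal (l / (c - l))"
  proof -
    have "(\<integral>\<^sup>+v. ennreal (l * exp (- (c - l) * v)) * indicator {0..} v \<partial>lborel)
        = (\<integral>\<^sup>+v. ennreal l * ennreal (indicator {0..} v *\<^sub>R exp (- (c - l) * v)) \<partial>lborel)"
      using l by (intro nn_integral_cong) (auto simp: ennreal_mult[symmetric] split: split_indicator)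
    also have "\<dots> = ennreal l * ennreal (1 / (c - l))"
      using has_bochner_integral_exp_Ici[of "c - l" 0] l
      by (subst nn_integral_cmult) (auto simp: has_bochner_integral_iff nn_integral_eq_integral)
    finally show ?thesis using l by (simp add: ennreal_mult[symmetric])
  qed
  also have "1 + ennreal (l / (c - l)) = ennreal (c / (c - l))"
    using l by (simp add: ennreal_1[symmetric] field_simps flip: ennreal_plus del: ennreal_1)
  finally show ?thesis by (simp add: add_left_mono)
qed

context drifted_bm
begin

text \<open>The exponential law of rate \<open>\<gamma>\<close> is invariant for the reflected motion, because
  \<open>exp (\<gamma> * incr s t)\<close> has mean \<open>1\<close>. The same identity shows that its tail dominates
  every walk started at the level.\<close>

lemma reflected_step_tail:
  assumes st: "0 \<le> s" "s < t" and X: "X \<in> borel_measurable (F s)"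
    and tail: "\<And>v. emeasure M {\<omega>\<in>space M. v \<le> X \<omega>} \<le> ennreal (exp (- \<gamma> * v))"
  shows "emeasure M {\<omega>\<in>space M. v \<le> max (X \<omega> + incr s t \<omega>) 0} \<le> ennreal (exp (- \<gamma> * v))"
proof (cases "v \<le> 0")
  case True
  have "emeasure M {\<omega>\<in>space M. v \<le> max (X \<omega> + incr s t \<omega>) 0} \<le> 1"
    by (rule order_trans[OF emeasure_space]) (simp add: emeasure_space_1)
  also have "1 \<le> ennreal (exp (- \<gamma> * v))"
    using True \<gamma>_pos by (simp add: ennreal_ge_1 mult_nonneg_nonpos)
  finally show ?thesis .
next
  case False
  note [measurable] = incr_measurable[OF st] F_measurable[OF X]
  let ?D = "incr s t"
  have joint: "distr M (borel \<Otimes>\<^sub>M borel) (\<lambda>\<omega>. (X \<omega>, ?D \<omega>)) = distr M borel X \<Otimes>\<^sub>M distr M borel ?D"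
    using incr_indep[OF st X] by (simp add: indep_var_distribution_eq)
  interpret D: prob_space "distr M borel ?D" by (rule prob_space_distr) simp
  interpret X: prob_space "distr M borel X" by (rule prob_space_distr) simp
  interpret pair_prob_space "distr M borel X" "distr M borel ?D" ..
  let ?A = "{p \<in> space (borel \<Otimes>\<^sub>M borel). v \<le> fst p + snd p} :: (real \<times> real) set"
  have [measurable]: "?A \<in> sets (borel \<Otimes>\<^sub>M borel)" by measurable
  have "{\<omega>\<in>space M. v \<le> max (X \<omega> + ?D \<omega>) 0} = (\<lambda>\<omega>. (X \<omega>, ?D \<omega>)) -` ?A \<inter> space M"
    using False by (auto simp: space_pair_measure)
  then have "emeasure M {\<omega>\<in>space M. v \<le> max (X \<omega> + ?D \<omega>) 0}
      = emeasure (distr M (borel \<Otimes>\<^sub>M borel) (\<lambda>\<omega>. (X \<omega>, ?D \<omega>))) ?A"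
    by (simp add: emeasure_distr)
  also have "\<dots> = emeasure (distr M borel X \<Otimes>\<^sub>M distr M borel ?D) ?A"
    by (simp only: joint)
  also have "\<dots> = (\<integral>\<^sup>+d. emeasure (distr M borel X) ((\<lambda>a. (a, d)) -` ?A) \<partial>distr M borel ?D)"
    by (rule emeasure_pair_measure_alt2) simp
  also have "\<dots> \<le> (\<integral>\<^sup>+d. ennreal (exp (- \<gamma> * v) * exp (\<gamma> * d)) \<partial>distr M borel ?D)"
  proof (intro nn_integral_mono)
    fix d
    have "emeasure (distr M borel X) ((\<lambda>a. (a, d)) -` ?A) = emeasure M {\<omega>\<in>space M. v - d \<le> X \<omega>}"
      by (subst emeasure_distr) (auto simp: space_pair_measure intro!: arg_cong2[where f=emeasure])
    also have "\<dots> \<le> ennreal (exp (- \<gamma> * v) * exp (\<gamma> * d))"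
      using tail[of "v - d"] by (simp add: exp_add[symmetric] algebra_simps)
    finally show "emeasure (distr M borel X) ((\<lambda>a. (a, d)) -` ?A) \<le> ennreal (exp (- \<gamma> * v) * exp (\<gamma> * d))" .
  qed
  also have "\<dots> = (\<integral>\<^sup>+\<omega>. ennreal (exp (- \<gamma> * v) * exp (\<gamma> * ?D \<omega>)) \<partial>M)"
    by (rule nn_integral_distr) auto
  also have "\<dots> = ennreal (exp (- \<gamma> * v))"
    using incr_exp[OF st, of \<gamma>]
    by (subst nn_integral_eq_integral) (auto simp: has_bochner_integral_iff)
  finally show ?thesis .
qed

end

section \<open>Reflected paths and walks on a grid\<close>

text \<open>The summands need not be values of \<open>f\<close>: walks on a grid only come close to the path.\<close>

lemma riemann_sum_approx:
  fixes f :: "real \<Rightarrow> real" and a :: "nat \<Rightarrow> nat \<Rightarrow> real"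
  assumes "s < T" and cont: "continuous_on {s..T} f"
    and approx: "\<And>\<epsilon>. 0 < \<epsilon> \<Longrightarrow> \<forall>\<^sub>F n in sequentially. \<forall>k<n. \<bar>a n k - f (s + real k * ((T - s) / real n))\<bar> \<le> \<epsilon>"
  shows "(\<lambda>n. (T - s) / real n * (\<Sum>k<n. a n k)) \<longlonglongrightarrow> (LBINT t:{s..T}. f t)"
proof (rule LIMSEQ_I, goal_cases)
  case (1 e)
  define \<epsilon> where "\<epsilon> = e / 4 / (T - s)"
  have \<epsilon>: "0 < \<epsilon>" using 1 \<open>s < T\<close> by (simp add: \<epsilon>_def)
  have "uniformly_continuous_on {s..T} f"
    using cont by (rule compact_uniformly_continuous) simp
  then obtain d where d: "0 < d"
    "\<And>t t'. t \<in> {s..T} \<Longrightarrow> t' \<in> {s..T} \<Longrightarrow> dist t' t < d \<Longrightarrow> dist (f t') (f t) < \<epsilon>"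
    unfolding uniformly_continuous_on_def using \<epsilon> by metis
  have "(\<lambda>n. (T - s) / real n) \<longlonglongrightarrow> 0" by (rule lim_const_over_n)
  then have "\<forall>\<^sub>F n in sequentially. (T - s) / real n < d"
    using d(1) by (rule order_tendstoD(2))
  with approx[OF \<epsilon>] eventually_gt_at_top[of 0]
  have "\<forall>\<^sub>F n in sequentially. norm ((T - s) / real n * (\<Sum>k<n. a n k) - (LBINT t:{s..T}. f t)) < e"
  proof eventually_elim
    case (elim n)
    define \<delta> where "\<delta> = (T - s) / real n"
    define g where "g = (\<lambda>k. s + real k * \<delta>)"
    have \<delta>: "0 < \<delta>" "\<delta> < d" "real n * \<delta> = T - s"
      using elim \<open>s < T\<close> by (auto simp: \<delta>_def)
    have g: "g 0 = s" "g n = T" "g (Suc k) = g k + \<delta>" "s \<le> g k" for k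
      using \<delta> by (auto simp: g_def algebra_simps)
    have gT: "g (Suc k) \<le> T" if "k < n" for k
      using mult_right_mono[of "real (Suc k)" "real n" \<delta>] that \<delta> by (simp add: g_def)
    have int: "f integrable_on {u..v}" if "s \<le> u" "v \<le> T" for u v
      using that by (intro integrable_continuous_real continuous_on_subset[OF cont]) auto
    have split: "k \<le> n \<Longrightarrow> integral {s..g k} f = (\<Sum>j<k. integral {g j..g (Suc j)} f)" for k
    proof (induction k)
      case (Suc k)
      have "integral {s..g k} f + integral {g k..g (Suc k)} f = integral {s..g (Suc k)} f"
        using g \<delta> gT[of k] Suc by (intro Henstock_Kurzweil_Integration.integral_combine int) auto
      then show ?case using Suc by simp
    qed (simp add: g)
    have cell: "\<bar>\<delta> * a n k - integral {g k..g (Suc k)} f\<bar> \<le> 2 * \<epsilon> * \<delta>" if k: "k < n" for k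
    proof -
      have "((\<lambda>t. a n k - f t) has_integral \<delta> * a n k - integral {g k..g (Suc k)} f) {g k..g (Suc k)}"
        using has_integral_const_real[of "a n k" "g k" "g (Suc k)"] \<delta> g gT[OF k]
        by (intro has_integral_diff integrable_integral int) (auto simp: mult.commute)
      moreover have "norm (a n k - f t) \<le> 2 * \<epsilon>" if t: "t \<in> {g k..g (Suc k)}" for t
      proof -
        have "dist (f t) (f (g k)) < \<epsilon>"
          using t g(3,4)[of k] gT[OF k] \<delta> by (intro d(2)) (auto simp: dist_real_def)
        moreover have "\<bar>a n k - f (g k)\<bar> \<le> \<epsilon>"
          using elim(1) k by (simp add: g_def \<delta>_def)
        ultimately show ?thesis by (simp add: dist_real_def)
      qed
      ultimately have "norm (\<delta> * a n k - integral {g k..g (Suc k)} f) \<le> 2 * \<epsilon> * measure lborel {g k..g (Suc k)}"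
        using \<epsilon> by (intro has_integral_bound_real[where S="{}" and f="\<lambda>t. a n k - f t"]) auto
      then show ?thesis using g \<delta> by simp
    qed
    have "(LBINT t:{s..T}. f t) = integral {s..T} f"
      by (intro set_borel_integral_eq_integral(2) borel_integrable_atLeastAtMost' cont)
    then have "\<delta> * (\<Sum>k<n. a n k) - (LBINT t:{s..T}. f t)
        = (\<Sum>k<n. \<delta> * a n k - integral {g k..g (Suc k)} f)"
      using split[of n] g by (simp add: sum_subtractf sum_distrib_left)
    also have "\<bar>\<dots>\<bar> \<le> (\<Sum>k<n. 2 * \<epsilon> * \<delta>)"
      by (intro order_trans[OF sum_abs] sum_mono cell) simp
    also have "\<dots> = 2 * (\<epsilon> * (T - s))"
      by (simp add: \<delta>(3)[symmetric])
    also have "\<epsilon> * (T - s) = e / 4"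
      using \<open>s < T\<close> \<epsilon>_def nonzero_divide_eq_eq[of "T - s" "e / 4" \<epsilon>] by simp
    finally show ?case using 1 by (simp add: \<delta>_def)
  qed
  then show ?case by (simp add: eventually_sequentially)
qed

lemma path_integral_measurable:
  fixes X :: "real \<Rightarrow> 'a \<Rightarrow> real"
  assumes "s < T"
    and meas: "\<And>t. s \<le> t \<Longrightarrow> t \<le> T \<Longrightarrow> X t \<in> borel_measurable N"
    and cont: "\<And>\<omega>. \<omega> \<in> space N \<Longrightarrow> continuous_on {s..T} (\<lambda>t. X t \<omega>)"
  shows "(\<lambda>\<omega>. LBINT t:{s..T}. X t \<omega>) \<in> borel_measurable N"
proof (rule borel_measurable_LIMSEQ_real)
  fix \<omega> assume "\<omega> \<in> space N"
  then show "(\<lambda>n. (T - s) / real n * (\<Sum>k<n. X (s + real k * ((T - s) / real n)) \<omega>)) \<longlonglongrightarrow> (LBINT t:{s..T}. X t \<omega>)"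
    using \<open>s < T\<close> cont by (intro riemann_sum_approx) auto
next
  fix n
  have "X (s + real k * ((T - s) / real n)) \<in> borel_measurable N" if "k < n" for k
  proof (rule meas)
    have "real k * ((T - s) / real n) \<le> real n * ((T - s) / real n)"
      using that \<open>s < T\<close> by (intro mult_right_mono) auto
    also have "\<dots> = T - s" using that by simp
    finally show "s + real k * ((T - s) / real n) \<le> T" by simp
  qed (use \<open>s < T\<close> in simp)
  then show "(\<lambda>\<omega>. (T - s) / real n * (\<Sum>k<n. X (s + real k * ((T - s) / real n)) \<omega>)) \<in> borel_measurable N"
    by (intro borel_measurable_times borel_measurable_const borel_measurable_sum) auto
qed

locale reflected_path = drifted_bm M F B \<theta> \<sigma> \<gamma>
  for M :: "'a measure" and F :: "real \<Rightarrow> 'a measure" and B :: "real \<Rightarrow> 'a \<Rightarrow> real" and \<theta> \<sigma> \<gamma> :: real +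
  fixes s :: real and r y :: "'a \<Rightarrow> real" and Z Y :: "real \<Rightarrow> 'a \<Rightarrow> real"
  assumes s_nonneg: "0 \<le> s" and r_meas: "r \<in> borel_measurable (F s)"
    and reflected: "reflected_bm F B \<theta> \<sigma> s r y Z Y"
begin

lemma Z_meas: "s \<le> t \<Longrightarrow> Z t \<in> borel_measurable (F t)"
  using reflected by (auto simp: reflected_bm_def)

lemma
  assumes "\<omega> \<in> space M"
  shows Z_cont: "continuous_on {s..} (\<lambda>t. Z t \<omega>)"
    and Y_start: "Y s \<omega> = 0"
    and Y_mono: "s \<le> u \<Longrightarrow> u \<le> v \<Longrightarrow> Y u \<omega> \<le> Y v \<omega>"
    and Z_eq: "s \<le> t \<Longrightarrow> Z t \<omega> = y \<omega> + incr s t \<omega> + Y t \<omega>"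
  using reflected assms space_F[of s] unfolding reflected_bm_def
  by (auto simp: incr_def mono_on_def)

lemma Z_ge: "\<omega> \<in> space M \<Longrightarrow> s \<le> t \<Longrightarrow> r \<omega> \<le> Z t \<omega>"
  using reflected space_F[of s] unfolding reflected_bm_def by blast

lemma Z_diff:
  assumes "\<omega> \<in> space M" "s \<le> u" "u \<le> v"
  shows "Z v \<omega> - Z u \<omega> = incr u v \<omega> + (Y v \<omega> - Y u \<omega>)"
  using Z_eq[of \<omega> u] Z_eq[of \<omega> v] assms incr_add[of s u \<omega> v] by simp

lemma Z_start: "\<omega> \<in> space M \<Longrightarrow> Z s \<omega> = y \<omega>"
  using Z_eq[of \<omega> s] Y_start by simp

lemma r_le_y: "\<omega> \<in> space M \<Longrightarrow> r \<omega> \<le> y \<omega>"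
  using Z_start Z_ge[of \<omega> s] by simp

lemma y_meas: "y \<in> borel_measurable (F s)"
  using Z_meas[of s] measurable_cong[of "F s" "Z s" y borel] Z_start space_F by auto

text \<open>A push beyond the free motion is mass of the regulator, and the regulator has no mass at times
  at which the path is above \<open>r\<close>.\<close>

lemma pushed_only_at_level:
  assumes \<omega>: "\<omega> \<in> space M" and uv: "s \<le> u" "u \<le> v" and pushed: "incr u v \<omega> < Z v \<omega> - Z u \<omega>"
  shows "\<exists>w\<in>{u..v}. Z w \<omega> = r \<omega>"
proof (rule ccontr)
  assume "\<not> ?thesis"
  then have above: "r \<omega> < Z w \<omega>" if "w \<in> {u..v}" for w
    using that Z_ge[OF \<omega>, of w] uv by force
  let ?Y = "\<lambda>u. Y (max s u) \<omega>"
  have Y: "continuous_on {s..} (\<lambda>t. Y t \<omega>)"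
    "(\<integral>\<^sup>+u\<in>{s..v}. indicator {u. Z u \<omega> > r \<omega>} u \<partial>interval_measure ?Y) = 0"
    using reflected \<omega> space_F[of s] uv unfolding reflected_bm_def by auto
  have "continuous_on UNIV ?Y"
    by (rule continuous_on_compose2[OF Y(1)]) (auto intro!: continuous_intros)
  then have "continuous (at_right a) ?Y" for a
    by (simp add: continuous_on_eq_continuous_at continuous_at_imp_continuous_within)
  then have "ennreal (?Y v - ?Y u) = emeasure (interval_measure ?Y) {u<..v}"
    using uv \<omega> by (intro emeasure_interval_measure_Ioc[symmetric]) (auto intro!: Y_mono)
  also have "\<dots> = (\<integral>\<^sup>+w. indicator {u<..v} w \<partial>interval_measure ?Y)"
    by simp
  also have "\<dots> \<le> (\<integral>\<^sup>+u\<in>{s..v}. indicator {u. Z u \<omega> > r \<omega>} u \<partial>interval_measure ?Y)"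
    using above uv by (intro nn_integral_mono) (auto split: split_indicator)
  finally have "?Y v \<le> ?Y u"
    using Y(2) by (simp add: ennreal_eq_0_iff)
  then show False
    using pushed Z_diff[OF \<omega> uv] uv by (simp add: max_def)
qed

end

locale reflected_path_until = reflected_path M F B \<theta> \<sigma> \<gamma> s r y Z Y
  for M :: "'a measure" and F :: "real \<Rightarrow> 'a measure" and B :: "real \<Rightarrow> 'a \<Rightarrow> real" and \<theta> \<sigma> \<gamma> s :: real
    and r y :: "'a \<Rightarrow> real" and Z Y :: "real \<Rightarrow> 'a \<Rightarrow> real" +
  fixes T :: real
  assumes sT: "s < T"
begin

definition mesh :: "nat \<Rightarrow> real" where
  "mesh n = (T - s) / real n"

definition grid :: "nat \<Rightarrow> nat \<Rightarrow> real" where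
  "grid n k = s + real k * mesh n"

abbreviation step :: "nat \<Rightarrow> nat \<Rightarrow> 'a \<Rightarrow> real" where
  "step n k \<equiv> incr (grid n k) (grid n (Suc k))"

text \<open>The walk driven by the increments of the free motion over a grid, and the same walk started at the
  level, whose height above the level is the excess.\<close>

definition walk :: "nat \<Rightarrow> nat \<Rightarrow> 'a \<Rightarrow> real" where
  "walk n k \<omega> = refl_walk (\<lambda>k. step n k \<omega>) (r \<omega>) (y \<omega>) k"

definition excess :: "nat \<Rightarrow> nat \<Rightarrow> 'a \<Rightarrow> real" where
  "excess n k \<omega> = refl_walk (\<lambda>k. step n k \<omega>) 0 0 k"

lemma mesh_pos: "0 < n \<Longrightarrow> 0 < mesh n"
  using sT by (simp add: mesh_def)

lemma mesh_tendsto: "mesh \<longlonglongrightarrow> 0"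
  unfolding mesh_def[abs_def] by (rule lim_const_over_n)

lemma mesh_nonneg: "0 \<le> mesh n"
  using sT by (simp add: mesh_def)

lemma grid_0: "grid n 0 = s"
  by (simp add: grid_def)

lemma grid_n: "0 < n \<Longrightarrow> grid n n = T"
  by (simp add: grid_def mesh_def)

lemma grid_Suc: "grid n (Suc k) = grid n k + mesh n"
  by (simp add: grid_def distrib_right)

lemma grid_ge: "s \<le> grid n k"
  using mesh_nonneg by (simp add: grid_def)

lemma grid_mono: "j \<le> k \<Longrightarrow> grid n j \<le> grid n k"
  using mesh_nonneg by (auto simp: grid_def intro!: mult_right_mono)

lemma grid_le: "k \<le> n \<Longrightarrow> 0 < n \<Longrightarrow> grid n k \<le> T"
  using grid_mono[of k n n] grid_n[of n] by simp

lemma step_bounds: "0 < n \<Longrightarrow> 0 \<le> grid n k" "0 < n \<Longrightarrow> grid n k < grid n (Suc k)"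
  using grid_ge[of n k] s_nonneg mesh_pos[of n] by (auto simp: grid_Suc)

lemma step_diff: "grid n (Suc k) - grid n k = mesh n"
  by (simp add: grid_Suc)

lemma walk_meas: "0 < n \<Longrightarrow> walk n k \<in> borel_measurable (F (grid n k))"
proof (induction k)
  case 0
  then show ?case using y_meas by (simp add: walk_def[abs_def] grid_0)
next
  case (Suc k)
  note b = step_bounds[OF Suc.prems, of k]
  have [measurable]: "walk n k \<in> borel_measurable (F (grid n (Suc k)))"
    "r \<in> borel_measurable (F (grid n (Suc k)))" "step n k \<in> borel_measurable (F (grid n (Suc k)))"
    using Suc b grid_ge[of n "Suc k"]
    by (auto intro: F_measurable_mono[OF _ less_imp_le] F_measurable_mono[OF r_meas] incr_F_measurable)
  have "walk n (Suc k) = (\<lambda>\<omega>. max (walk n k \<omega> + step n k \<omega>) (r \<omega>))"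
    by (auto simp: walk_def)
  then show ?case by simp
qed

lemma excess_tail:
  assumes n: "0 < n"
  shows "excess n k \<in> borel_measurable (F (grid n k)) \<and>
    (\<forall>v. emeasure M {\<omega>\<in>space M. v \<le> excess n k \<omega>} \<le> ennreal (exp (- \<gamma> * v)))"
proof (induction k)
  case 0
  have "emeasure M {\<omega> \<in> space M. v \<le> 0} \<le> ennreal (exp (- (\<gamma> * v)))" for v
    using \<gamma>_pos by (cases "v \<le> 0") (auto simp: emeasure_space_1 ennreal_ge_1 mult_nonneg_nonpos)
  then show ?case by (simp add: excess_def[abs_def])
next
  case (Suc k)
  note b = step_bounds[OF n, of k]
  have [measurable]: "excess n k \<in> borel_measurable (F (grid n (Suc k)))"
    "step n k \<in> borel_measurable (F (grid n (Suc k)))"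
    using Suc b by (auto intro: F_measurable_mono[OF _ less_imp_le] incr_F_measurable)
  have eq: "excess n (Suc k) = (\<lambda>\<omega>. max (excess n k \<omega> + step n k \<omega>) 0)"
    by (auto simp: excess_def)
  show ?case
    using Suc reflected_step_tail[OF b] by (simp add: eq)
qed

lemma excess_nonneg: "0 \<le> excess n k \<omega>"
  unfolding excess_def by (rule refl_walk_ge) simp

lemma excess_exp:
  assumes "0 < n" "0 < l" "l < \<gamma>"
  shows "(\<integral>\<^sup>+\<omega>. ennreal (exp (l * excess n k \<omega>)) \<partial>M) \<le> ennreal (\<gamma> / (\<gamma> - l))"
  using excess_tail[OF assms(1), of k] F_measurable assms excess_nonneg
  by (intro nn_integral_exp_le_tail) auto

text \<open>The exponential moment at \<open>\<gamma> / 2\<close> gives a bound that depends neither on the grid nor on time.\<close>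

lemma excess_mean:
  assumes "0 < n"
  shows "integrable M (excess n k)" "(LINT \<omega>|M. excess n k \<omega>) \<le> 4 / \<gamma>"
proof -
  have [measurable]: "excess n k \<in> borel_measurable M"
    using excess_tail[OF assms] F_measurable by blast
  have le: "excess n k \<omega> \<le> 2 / \<gamma> * exp (\<gamma> / 2 * excess n k \<omega>)" for \<omega>
    using exp_ge_add_one_self[of "\<gamma> / 2 * excess n k \<omega>"] \<gamma>_pos by (simp add: field_simps)
  have "(\<integral>\<^sup>+\<omega>. ennreal (excess n k \<omega>) \<partial>M) \<le> (\<integral>\<^sup>+\<omega>. ennreal (2 / \<gamma>) * ennreal (exp (\<gamma> / 2 * excess n k \<omega>)) \<partial>M)"
    using \<gamma>_pos le by (intro nn_integral_mono) (simp add: ennreal_mult[symmetric])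
  also have "\<dots> = ennreal (2 / \<gamma>) * (\<integral>\<^sup>+\<omega>. ennreal (exp (\<gamma> / 2 * excess n k \<omega>)) \<partial>M)"
    by (rule nn_integral_cmult) simp
  also have "\<dots> \<le> ennreal (2 / \<gamma>) * ennreal 2"
    using excess_exp[OF assms, of "\<gamma> / 2" k] \<gamma>_pos by (intro mult_left_mono) (auto simp: field_simps)
  also have "\<dots> = ennreal (4 / \<gamma>)"
    using \<gamma>_pos by (subst ennreal_mult[symmetric]) auto
  finally have nn: "(\<integral>\<^sup>+\<omega>. ennreal (excess n k \<omega>) \<partial>M) \<le> ennreal (4 / \<gamma>)" .
  then show int: "integrable M (excess n k)"
    using excess_nonneg by (intro integrableI_nonneg) (auto simp: le_less_trans[OF _ ennreal_less_top])
  show "(LINT \<omega>|M. excess n k \<omega>) \<le> 4 / \<gamma>"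
    using nn \<gamma>_pos excess_nonneg by (simp add: nn_integral_eq_integral[OF int])
qed

lemma sum_step: "(\<Sum>j<k. step n j \<omega>) = incr s (grid n k) \<omega>"
  by (induction k) (auto simp: grid_0 incr_add)

lemma walk_eq: "\<omega> \<in> space M \<Longrightarrow> walk n k \<omega> = max (y \<omega> + incr s (grid n k) \<omega>) (r \<omega> + excess n k \<omega>)"
  unfolding walk_def excess_def by (subst refl_walk_eq[OF r_le_y]) (auto simp: sum_step)

lemma incr_le_excess: "incr s (grid n k) \<omega> \<le> excess n k \<omega>"
  using sum_le_refl_walk[of "\<lambda>k. step n k \<omega>" k] by (simp add: excess_def sum_step)

lemma walk_le_Z:
  assumes "\<omega> \<in> space M"
  shows "walk n k \<omega> \<le> Z (grid n k) \<omega>"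
proof -
  have *: "incr u v \<omega> = (\<theta> * v + \<sigma> * B v \<omega>) - (\<theta> * u + \<sigma> * B u \<omega>)" for u v
    by (simp add: incr_def algebra_simps)
  have "incr u v \<omega> \<le> Z v \<omega> - Z u \<omega>" if "s \<le> u" "u \<le> v" for u v
    using Z_diff[OF assms that] Y_mono[OF assms that] by simp
  then show ?thesis
    unfolding walk_def *
    by (intro refl_walk_le_path[where z="\<lambda>t. Z t \<omega>"] monoI grid_mono)
       (auto simp: grid_0 Z_start[OF assms] Z_ge[OF assms])
qed

lemma Z_le_walk:
  assumes \<omega>: "\<omega> \<in> space M" and "0 < \<epsilon>"
  shows "\<forall>\<^sub>F n in sequentially. \<forall>k\<le>n. Z (grid n k) \<omega> \<le> walk n k \<omega> + \<epsilon>"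
proof -
  have "continuous_on {s..T} (\<lambda>t. Z t \<omega>)"
    by (rule continuous_on_subset[OF Z_cont[OF \<omega>]]) auto
  then have "uniformly_continuous_on {s..T} (\<lambda>t. Z t \<omega>)"
    by (rule compact_uniformly_continuous) simp
  then obtain d where d: "0 < d"
    "\<And>t t'. t \<in> {s..T} \<Longrightarrow> t' \<in> {s..T} \<Longrightarrow> dist t' t < d \<Longrightarrow> dist (Z t' \<omega>) (Z t \<omega>) < \<epsilon>"
    unfolding uniformly_continuous_on_def using \<open>0 < \<epsilon>\<close> by metis
  have "\<forall>\<^sub>F n in sequentially. mesh n < d"
    using order_tendstoD(2)[OF mesh_tendsto d(1)] .
  with eventually_gt_at_top[of 0] show ?thesis
  proof eventually_elim
    case (elim n)
    have *: "incr u v \<omega> = (\<theta> * v + \<sigma> * B v \<omega>) - (\<theta> * u + \<sigma> * B u \<omega>)" for u v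
      by (simp add: incr_def algebra_simps)
    have osc: "Z (grid n (Suc k)) \<omega> - Z w \<omega> \<le> \<epsilon>"
      if "k < n" "grid n k \<le> w" "w \<le> grid n (Suc k)" for k w
    proof -
      have "dist (Z (grid n (Suc k)) \<omega>) (Z w \<omega>) < \<epsilon>"
        using that elim grid_ge[of n k] grid_le[of "Suc k" n] step_diff[of n k]
        by (intro d(2)) (auto simp: dist_real_def)
      then show ?thesis by (simp add: dist_real_def)
    qed
    have push: "\<exists>w\<in>{u..v}. Z w \<omega> = r \<omega>"
      if "s \<le> u" "u \<le> v" "(\<theta> * v + \<sigma> * B v \<omega>) - (\<theta> * u + \<sigma> * B u \<omega>) < Z v \<omega> - Z u \<omega>" for u v
      using pushed_only_at_level[OF \<omega> that(1,2)] that(3) unfolding * by blast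
    show ?case
    proof (intro allI impI)
      fix k assume k: "k \<le> n"
      have "mono (grid n)" by (intro monoI grid_mono)
      then show "Z (grid n k) \<omega> \<le> walk n k \<omega> + \<epsilon>"
        unfolding walk_def * using osc push k \<open>0 < \<epsilon>\<close>
        by (intro path_le_refl_walk[where z="\<lambda>t. Z t \<omega>" and n=n]) (auto simp: grid_0 Z_start[OF \<omega>])
    qed
  qed
qed

lemma walk_tendsto:
  assumes \<omega>: "\<omega> \<in> space M"
  shows "(\<lambda>n. walk n n \<omega>) \<longlonglongrightarrow> Z T \<omega>"
proof (rule LIMSEQ_I, goal_cases)
  case (1 e)
  have "\<forall>\<^sub>F n in sequentially. norm (walk n n \<omega> - Z T \<omega>) < e"
    using Z_le_walk[OF \<omega> half_gt_zero[OF 1]] eventually_gt_at_top[of 0]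
  proof (eventually_elim)
    case (elim n)
    then have "walk n n \<omega> \<le> Z (grid n n) \<omega>" "Z (grid n n) \<omega> \<le> walk n n \<omega> + e / 2"
      using walk_le_Z[OF \<omega>] by auto
    then show ?case using elim 1 by (simp add: grid_n)
  qed
  then show ?case by (simp add: eventually_sequentially)
qed

end

section \<open>The expected cost of the walk\<close>

context reflected_path_until
begin

lemma incr_integrable: "integrable M (incr s T)"
  using incr_mean[OF s_nonneg sT] by (simp add: has_bochner_integral_iff)

lemma Z_T_meas: "Z T \<in> borel_measurable M"
  using Z_meas[of T] F_measurable sT by simp

lemma r_M: "r \<in> borel_measurable M" and y_M: "y \<in> borel_measurable M"
  using r_meas y_meas F_measurable by blast+

lemma walk_M: "0 < n \<Longrightarrow> walk n k \<in> borel_measurable M"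
  using walk_meas F_measurable by blast

lemma excess_M: "0 < n \<Longrightarrow> excess n k \<in> borel_measurable M"
  using excess_tail F_measurable by blast

text \<open>Fatou's lemma carries a bound that is uniform over the walks to the limit.\<close>

lemma nn_integral_Z_le:
  assumes cont: "continuous_on UNIV f"
    and le: "\<And>n. 0 < n \<Longrightarrow> (\<integral>\<^sup>+\<omega>. ennreal (f (walk n n \<omega> - y \<omega>) * c \<omega>) \<partial>M) \<le> L"
    and [measurable]: "c \<in> borel_measurable M"
  shows "(\<integral>\<^sup>+\<omega>. ennreal (f (Z T \<omega> - y \<omega>) * c \<omega>) \<partial>M) \<le> L"
proof -
  have [measurable]: "f \<in> borel_measurable borel" using cont by (rule borel_measurable_continuous_onI)
  note [measurable] = y_M Z_T_meas walk_M[OF zero_less_Suc]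
  have "(\<lambda>n. ennreal (f (walk (Suc n) (Suc n) \<omega> - y \<omega>) * c \<omega>)) \<longlonglongrightarrow> ennreal (f (Z T \<omega> - y \<omega>) * c \<omega>)"
    if "\<omega> \<in> space M" for \<omega>
  proof -
    have "isCont f x" for x using cont by (simp add: continuous_on_eq_continuous_at)
    then have "(\<lambda>n. f (walk (Suc n) (Suc n) \<omega> - y \<omega>)) \<longlonglongrightarrow> f (Z T \<omega> - y \<omega>)"
      by (rule isCont_tendsto_compose)
        (intro tendsto_intros filterlim_compose[OF walk_tendsto[OF that] filterlim_Suc])
    then show ?thesis by (intro tendsto_ennrealI tendsto_mult tendsto_const)
  qed
  then have "(\<integral>\<^sup>+\<omega>. ennreal (f (Z T \<omega> - y \<omega>) * c \<omega>) \<partial>M)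
      = (\<integral>\<^sup>+\<omega>. liminf (\<lambda>n. ennreal (f (walk (Suc n) (Suc n) \<omega> - y \<omega>) * c \<omega>)) \<partial>M)"
    by (intro nn_integral_cong lim_imp_Liminf[symmetric] trivial_limit_sequentially)
  also have "\<dots> \<le> liminf (\<lambda>n. \<integral>\<^sup>+\<omega>. ennreal (f (walk (Suc n) (Suc n) \<omega> - y \<omega>) * c \<omega>) \<partial>M)"
    by (rule nn_integral_liminf) measurable
  also have "\<dots> \<le> liminf (\<lambda>n::nat. L)"
    by (intro Liminf_mono eventuallyI le) simp
  also have "\<dots> = L" by (simp add: Liminf_const)
  finally show ?thesis .
qed

text \<open>The ascent of the walk is at most its excess.\<close>

lemma excess_Z_exp:
  assumes l: "0 < l" "l < \<gamma>"
  shows "integrable M (\<lambda>\<omega>. exp (l * max 0 (Z T \<omega> - y \<omega>)))"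
    and "(LINT \<omega>|M. exp (l * max 0 (Z T \<omega> - y \<omega>))) \<le> \<gamma> / (\<gamma> - l)"
proof -
  note [measurable] = y_M Z_T_meas
  have walk_le: "walk n n \<omega> - y \<omega> \<le> excess n n \<omega>" if "\<omega> \<in> space M" for n \<omega>
    using walk_eq[OF that, of n n] incr_le_excess[of n n \<omega>] r_le_y[OF that] by auto
  have nn: "(\<integral>\<^sup>+\<omega>. ennreal (exp (l * max 0 (Z T \<omega> - y \<omega>)) * 1) \<partial>M) \<le> ennreal (\<gamma> / (\<gamma> - l))"
  proof (rule nn_integral_Z_le[where f="\<lambda>x. exp (l * max 0 x)"])
    fix n :: nat assume "0 < n"
    have "(\<integral>\<^sup>+\<omega>. ennreal (exp (l * max 0 (walk n n \<omega> - y \<omega>)) * 1) \<partial>M)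
        \<le> (\<integral>\<^sup>+\<omega>. ennreal (exp (l * excess n n \<omega>)) \<partial>M)"
      using l walk_le excess_nonneg[of n n] by (intro nn_integral_mono) auto
    also have "\<dots> \<le> ennreal (\<gamma> / (\<gamma> - l))" by (rule excess_exp[OF \<open>0 < n\<close> l])
    finally show "(\<integral>\<^sup>+\<omega>. ennreal (exp (l * max 0 (walk n n \<omega> - y \<omega>)) * 1) \<partial>M) \<le> ennreal (\<gamma> / (\<gamma> - l))" .
  qed (auto intro!: continuous_intros)
  then show int: "integrable M (\<lambda>\<omega>. exp (l * max 0 (Z T \<omega> - y \<omega>)))"
    by (intro integrableI_nonneg) (auto simp: le_less_trans[OF _ ennreal_less_top])
  show "(LINT \<omega>|M. exp (l * max 0 (Z T \<omega> - y \<omega>))) \<le> \<gamma> / (\<gamma> - l)"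
    using nn l by (simp add: nn_integral_eq_integral[OF int])
qed

lemma excess_Z_mean:
  assumes l: "0 < l" "l < \<gamma>"
  shows "integrable M (\<lambda>\<omega>. max 0 (Z T \<omega> - y \<omega>))"
    and "l * (LINT \<omega>|M. max 0 (Z T \<omega> - y \<omega>)) \<le> l / (\<gamma> - l)"
proof -
  note [measurable] = y_M Z_T_meas
  have le: "l * max 0 (Z T \<omega> - y \<omega>) \<le> exp (l * max 0 (Z T \<omega> - y \<omega>)) - 1" for \<omega>
    using exp_ge_add_one_self[of "l * max 0 (Z T \<omega> - y \<omega>)"] by linarith
  have "integrable M (\<lambda>\<omega>. l * max 0 (Z T \<omega> - y \<omega>))"
  proof (rule Bochner_Integration.integrable_bound)
    show "integrable M (\<lambda>\<omega>. exp (l * max 0 (Z T \<omega> - y \<omega>)))" by (rule excess_Z_exp[OF l])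
    show "AE \<omega> in M. norm (l * max 0 (Z T \<omega> - y \<omega>)) \<le> norm (exp (l * max 0 (Z T \<omega> - y \<omega>)))"
    proof (rule AE_I2)
      fix \<omega>
      have "0 \<le> l * max 0 (Z T \<omega> - y \<omega>)" using l by simp
      then show "norm (l * max 0 (Z T \<omega> - y \<omega>)) \<le> norm (exp (l * max 0 (Z T \<omega> - y \<omega>)))"
        using le[of \<omega>] by simp
    qed
  qed measurable
  then show int: "integrable M (\<lambda>\<omega>. max 0 (Z T \<omega> - y \<omega>))" using l by simp
  have "l * (LINT \<omega>|M. max 0 (Z T \<omega> - y \<omega>)) = (LINT \<omega>|M. l * max 0 (Z T \<omega> - y \<omega>))" by simp
  also have "\<dots> \<le> (LINT \<omega>|M. exp (l * max 0 (Z T \<omega> - y \<omega>)) - 1)"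
    using le int excess_Z_exp(1)[OF l] by (intro integral_mono) auto
  also have "\<dots> \<le> \<gamma> / (\<gamma> - l) - 1"
    using excess_Z_exp[OF l] by (simp add: prob_space)
  also have "\<dots> = l / (\<gamma> - l)" using l by (simp add: field_simps)
  finally show "l * (LINT \<omega>|M. max 0 (Z T \<omega> - y \<omega>)) \<le> l / (\<gamma> - l)" .
qed

text \<open>The step is independent of the state before it, so that the means factor. Since
  \<open>\<theta> = - \<gamma> * \<sigma>\<^sup>2 / 2\<close>, slope and curvature combine to \<open>h - C r\<close>: the Poisson equation for one
  step, up to the square of the drift.\<close>

lemma step_expansion_mean:
  assumes n: "0 < n" and h: "discounted_cost h \<gamma>" and S: "\<And>v. 0 \<le> h v" "\<And>v. h v \<le> S"
  defines "C \<equiv> cost h \<gamma>" and "c \<equiv> discounted_cost.curv h \<gamma>"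
  shows "has_bochner_integral M
      (\<lambda>\<omega>. (C (r \<omega>) - C (walk n k \<omega>)) * step n k \<omega> + c (walk n k \<omega>) / 2 * (step n k \<omega>)\<^sup>2)
      (\<sigma>\<^sup>2 * \<gamma> / 2 * mesh n * (LINT \<omega>|M. h (walk n k \<omega>) - C (r \<omega>))
        + \<theta>\<^sup>2 * (mesh n)\<^sup>2 / 2 * (LINT \<omega>|M. c (walk n k \<omega>)))"
proof -
  interpret discounted_cost h \<gamma> by fact
  note b = step_bounds[OF n, of k]
  note [measurable] = walk_M[OF n] r_M
  have [measurable]: "walk n k \<in> borel_measurable (F (grid n k))" by (rule walk_meas[OF n])
  have [measurable]: "r \<in> borel_measurable (F (grid n k))" by (rule F_measurable_mono[OF r_meas grid_ge])
  have c_def': "c = (\<lambda>v. \<gamma> * (h v - C v))" by (auto simp: c_def curv_def C_def)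
  have [measurable]: "C \<in> borel_measurable borel" "c \<in> borel_measurable borel"
    unfolding c_def' C_def by measurable
  have C_bounds: "0 \<le> C v" "C v \<le> S" for v
    using cost_bounded[OF S] by (auto simp: C_def)
  have int: "integrable M (\<lambda>\<omega>. C (r \<omega>) - C (walk n k \<omega>))" "integrable M (\<lambda>\<omega>. c (walk n k \<omega>))"
    "integrable M (\<lambda>\<omega>. h (walk n k \<omega>))" "integrable M (\<lambda>\<omega>. C (r \<omega>))" "integrable M (\<lambda>\<omega>. C (walk n k \<omega>))"
  proof -
    show "integrable M (\<lambda>\<omega>. c (walk n k \<omega>))"
    proof (rule integrable_const_bound[where B="\<gamma> * S"])
      show "AE \<omega> in M. norm (c (walk n k \<omega>)) \<le> \<gamma> * S"
        using curv_bounded[OF S] by (simp add: c_def)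
    qed measurable
    show "integrable M (\<lambda>\<omega>. h (walk n k \<omega>))" 
      by (rule integrable_const_bound[where B=S]) (use S in auto)
    show 1: "integrable M (\<lambda>\<omega>. C (r \<omega>))" 
      by (rule integrable_const_bound[where B=S]) (use C_bounds in auto)
    show 2: "integrable M (\<lambda>\<omega>. C (walk n k \<omega>))"
      by (rule integrable_const_bound[where B=S]) (use C_bounds in auto)
    show "integrable M (\<lambda>\<omega>. C (r \<omega>) - C (walk n k \<omega>))" using 1 2 by simp
  qed
  have ind1: "indep_var borel (\<lambda>\<omega>. C (r \<omega>) - C (walk n k \<omega>)) borel (step n k)"
    by (rule incr_indep[OF b]) measurable
  have ind2: "indep_var borel (\<lambda>\<omega>. c (walk n k \<omega>)) borel (\<lambda>\<omega>. (step n k \<omega>)\<^sup>2)"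
  proof -
    have "indep_var borel (\<lambda>\<omega>. c (walk n k \<omega>)) borel (step n k)"
      by (rule incr_indep[OF b]) measurable
    from indep_var_compose[OF this, of "\<lambda>x. x" borel "\<lambda>x. x\<^sup>2" borel] show ?thesis
      by (simp add: comp_def)
  qed
  note mean = incr_mean[OF b, unfolded has_bochner_integral_iff step_diff]
  note sq = incr_square[OF b, unfolded has_bochner_integral_iff step_diff]
  have 1: "has_bochner_integral M (\<lambda>\<omega>. (C (r \<omega>) - C (walk n k \<omega>)) * step n k \<omega>)
      ((LINT \<omega>|M. C (r \<omega>) - C (walk n k \<omega>)) * (\<theta> * mesh n))"
    using indep_var_integrable[OF ind1 int(1)] indep_var_lebesgue_integral[OF ind1 int(1)] mean
    by (auto simp: has_bochner_integral_iff)
  have 2: "has_bochner_integral M (\<lambda>\<omega>. c (walk n k \<omega>) * (step n k \<omega>)\<^sup>2)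
      ((LINT \<omega>|M. c (walk n k \<omega>)) * (\<sigma>\<^sup>2 * mesh n + \<theta>\<^sup>2 * (mesh n)\<^sup>2))"
    using indep_var_integrable[OF ind2 int(2)] indep_var_lebesgue_integral[OF ind2 int(2)] sq
    by (auto simp: has_bochner_integral_iff)
  have "has_bochner_integral M (\<lambda>\<omega>. (C (r \<omega>) - C (walk n k \<omega>)) * step n k \<omega> + 1 / 2 * (c (walk n k \<omega>) * (step n k \<omega>)\<^sup>2))
      ((LINT \<omega>|M. C (r \<omega>) - C (walk n k \<omega>)) * (\<theta> * mesh n) + 1 / 2 * ((LINT \<omega>|M. c (walk n k \<omega>)) * (\<sigma>\<^sup>2 * mesh n + \<theta>\<^sup>2 * (mesh n)\<^sup>2)))"
    by (intro has_bochner_integral_add has_bochner_integral_mult_right 1 2)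
  moreover have "(\<lambda>\<omega>. (C (r \<omega>) - C (walk n k \<omega>)) * step n k \<omega> + 1 / 2 * (c (walk n k \<omega>) * (step n k \<omega>)\<^sup>2))
      = (\<lambda>\<omega>. (C (r \<omega>) - C (walk n k \<omega>)) * step n k \<omega> + c (walk n k \<omega>) / 2 * (step n k \<omega>)\<^sup>2)"
    by auto
  moreover have "(LINT \<omega>|M. C (r \<omega>) - C (walk n k \<omega>)) * (\<theta> * mesh n) + 1 / 2 * ((LINT \<omega>|M. c (walk n k \<omega>)) * (\<sigma>\<^sup>2 * mesh n + \<theta>\<^sup>2 * (mesh n)\<^sup>2))
      = \<sigma>\<^sup>2 * \<gamma> / 2 * mesh n * (LINT \<omega>|M. h (walk n k \<omega>) - C (r \<omega>))
        + \<theta>\<^sup>2 * (mesh n)\<^sup>2 / 2 * (LINT \<omega>|M. c (walk n k \<omega>))"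
  proof -
    define p q e where "p = (LINT \<omega>|M. C (r \<omega>))" and "q = (LINT \<omega>|M. C (walk n k \<omega>))"
      and "e = (LINT \<omega>|M. h (walk n k \<omega>))"
    have "(LINT \<omega>|M. c (walk n k \<omega>)) = \<gamma> * (e - q)"
      unfolding c_def' q_def e_def using int by simp
    moreover have "(LINT \<omega>|M. C (r \<omega>) - C (walk n k \<omega>)) = p - q" "(LINT \<omega>|M. h (walk n k \<omega>) - C (r \<omega>)) = e - p"
      using int by (auto simp: p_def q_def e_def)
    ultimately show ?thesis by (simp only: \<theta>_eq) (simp add: field_simps power2_eq_square)
  qed
  ultimately show ?thesis by simp
qed


text \<open>The total push is the height gained by the walk minus that of the free motion.\<close>

lemma push_mean:
  assumes n: "0 < n"
  shows "integrable M (\<lambda>\<omega>. max 0 (r \<omega> - walk n k \<omega> - step n k \<omega>))"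
    and "(\<Sum>k<n. LINT \<omega>|M. max 0 (r \<omega> - walk n k \<omega> - step n k \<omega>)) \<le> 4 / \<gamma> - \<theta> * (T - s)"
proof -
  note [measurable] = walk_M[OF n] r_M y_M incr_measurable[OF step_bounds[OF n]] excess_M[OF n]
  show int: "integrable M (\<lambda>\<omega>. max 0 (r \<omega> - walk n k \<omega> - step n k \<omega>))" for k
  proof (rule Bochner_Integration.integrable_bound)
    show "integrable M (step n k)"
      using incr_mean[OF step_bounds[OF n, of k]] by (simp add: has_bochner_integral_iff)
    have "r \<omega> \<le> walk n k \<omega>" if "\<omega> \<in> space M" for \<omega>
      unfolding walk_def by (rule refl_walk_ge[OF r_le_y[OF that]])
    then show "AE \<omega> in M. norm (max 0 (r \<omega> - walk n k \<omega> - step n k \<omega>)) \<le> norm (step n k \<omega>)"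
      by (intro AE_I2) fastforce
  qed measurable
  have le: "(\<Sum>k<n. max 0 (r \<omega> - walk n k \<omega> - step n k \<omega>)) \<le> excess n n \<omega> - incr s T \<omega>" if "\<omega> \<in> space M" for \<omega>
  proof -
    have "(\<Sum>k<n. max 0 (r \<omega> - walk n k \<omega> - step n k \<omega>)) = walk n n \<omega> - y \<omega> - incr s T \<omega>"
      unfolding walk_def by (simp add: refl_walk_push sum_step grid_n[OF n])
    then show ?thesis
      using walk_eq[OF that, of n n] incr_le_excess[of n n \<omega>] r_le_y[OF that] by auto
  qed
  have "(\<Sum>k<n. LINT \<omega>|M. max 0 (r \<omega> - walk n k \<omega> - step n k \<omega>))
      = (LINT \<omega>|M. (\<Sum>k<n. max 0 (r \<omega> - walk n k \<omega> - step n k \<omega>)))"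
    using int by simp
  also have "\<dots> \<le> (LINT \<omega>|M. excess n n \<omega> - incr s T \<omega>)"
    using le int excess_mean(1)[OF n] incr_integrable
    by (intro integral_mono Bochner_Integration.integrable_diff Bochner_Integration.integrable_sum) auto
  also have "\<dots> \<le> 4 / \<gamma> - \<theta> * (T - s)"
    using excess_mean[OF n, of n] incr_integrable incr_mean[OF s_nonneg sT]
    by (simp add: has_bochner_integral_iff)
  finally show "(\<Sum>k<n. LINT \<omega>|M. max 0 (r \<omega> - walk n k \<omega> - step n k \<omega>)) \<le> 4 / \<gamma> - \<theta> * (T - s)" .
qed

text \<open>The potential telescopes over the steps of the walk, and each step is expanded. As the mesh
  vanishes, only the terms with \<open>\<epsilon>\<close> and \<open>\<eta>\<close> survive: the fourth moment of a step is of the order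
  of the squared mesh, and the pushes have bounded total mean.\<close>

lemma walk_identity_error:
  assumes n: "0 < n" and h: "discounted_cost h \<gamma>" and S: "\<And>v. 0 \<le> h v" "\<And>v. h v \<le> S"
    and \<eta>: "0 < \<eta>" and \<epsilon>: "0 \<le> \<epsilon>"
    and modulus: "\<And>v w. \<bar>v - w\<bar> \<le> \<eta> \<Longrightarrow>
      \<bar>discounted_cost.curv h \<gamma> v - discounted_cost.curv h \<gamma> w\<bar> \<le> \<epsilon>"
  defines "C \<equiv> cost h \<gamma>"
  shows "\<bar>(LINT \<omega>|M. potential C (r \<omega>) (y \<omega>) (walk n n \<omega>))
      - \<sigma>\<^sup>2 * \<gamma> / 2 * (LINT \<omega>|M. mesh n * (\<Sum>k<n. h (walk n k \<omega>) - C (r \<omega>)))\<bar>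
    \<le> \<theta>\<^sup>2 * mesh n * (T - s) * (\<gamma> * S) / 2 + \<epsilon> / 2 * (\<sigma>\<^sup>2 + \<theta>\<^sup>2 * mesh n) * (T - s)
      + \<gamma> * S * \<eta> / 2 * (4 / \<gamma> - \<theta> * (T - s))
      + 3 * (\<gamma> * S) / (2 * \<eta>\<^sup>2) * (8 * \<theta> ^ 4 * mesh n ^ 3 + 24 * \<sigma> ^ 4 * mesh n) * (T - s)"
proof -
  interpret discounted_cost h \<gamma> by fact
  note b = step_bounds[OF n]
  note [measurable] = walk_M[OF n] r_M y_M incr_measurable[OF b]
  define L where "L = \<gamma> * S"
  have L0: "0 \<le> L" using S(1)[of 0] S(2)[of 0] \<gamma>_pos by (simp add: L_def)
  define P where "P = (\<lambda>k \<omega>. potential C (r \<omega>) (walk n k \<omega>) (walk n (Suc k) \<omega>))"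
  define Q where "Q = (\<lambda>k \<omega>. (C (r \<omega>) - C (walk n k \<omega>)) * step n k \<omega> + curv (walk n k \<omega>) / 2 * (step n k \<omega>)\<^sup>2)"
  define R where "R = (\<lambda>k \<omega>. \<epsilon> / 2 * (step n k \<omega>)\<^sup>2 + L * \<eta> / 2 * max 0 (r \<omega> - walk n k \<omega> - step n k \<omega>)
      + 3 * L / (2 * \<eta>\<^sup>2) * step n k \<omega> ^ 4)"
  have C_cont: "continuous_on UNIV C" unfolding C_def by (rule cost_cont)
  have PQR: "\<bar>P k \<omega> - Q k \<omega>\<bar> \<le> R k \<omega>" if "\<omega> \<in> space M" for k \<omega>
  proof -
    have "r \<omega> \<le> walk n k \<omega>" unfolding walk_def by (rule refl_walk_ge[OF r_le_y[OF that]])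
    moreover have "walk n (Suc k) \<omega> = max (walk n k \<omega> + step n k \<omega>) (r \<omega>)" by (simp add: walk_def)
    ultimately show ?thesis
      using reflected_step_expansion[OF curv_bounded[OF S] \<eta> \<epsilon> modulus]
      by (simp add: P_def Q_def R_def C_def L_def)
  qed
  have Q: "has_bochner_integral M (Q k) (\<sigma>\<^sup>2 * \<gamma> / 2 * mesh n * (LINT \<omega>|M. h (walk n k \<omega>) - C (r \<omega>))
        + \<theta>\<^sup>2 * (mesh n)\<^sup>2 / 2 * (LINT \<omega>|M. curv (walk n k \<omega>)))" for k
    unfolding Q_def C_def by (rule step_expansion_mean[OF n h S])
  have R_int: "integrable M (R k)" for k
    unfolding R_def using incr_square[OF b] incr_fourth(1)[OF b] push_mean(1)[OF n]
    by (intro Bochner_Integration.integrable_add integrable_mult_right) (auto simp: has_bochner_integral_iff)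
  have P_meas: "P k \<in> borel_measurable M" for k
    unfolding P_def by (intro potential_measurable[OF C_cont]) measurable
  have PQ_int: "integrable M (\<lambda>\<omega>. P k \<omega> - Q k \<omega>)" for k
  proof (rule Bochner_Integration.integrable_bound[OF R_int[of k]])
    show "(\<lambda>\<omega>. P k \<omega> - Q k \<omega>) \<in> borel_measurable M"
      using P_meas Q[of k] by (auto simp: has_bochner_integral_iff)
    show "AE \<omega> in M. norm (P k \<omega> - Q k \<omega>) \<le> norm (R k \<omega>)"
      by (intro AE_I2) (use PQR in \<open>auto intro: order_trans[OF _ abs_ge_self]\<close>)
  qed
  have P_int: "integrable M (P k)" for k
    using Bochner_Integration.integrable_add[OF PQ_int[of k], of "Q k"] Q[of k] by (simp add: has_bochner_integral_iff)
  have tele: "potential C (r \<omega>) (y \<omega>) (walk n k \<omega>) = (\<Sum>j<k. P j \<omega>)" for k \<omega>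
  proof (induction k)
    case 0 show ?case by (simp add: walk_def)
  next
    case (Suc k) then show ?case
      using potential_add[OF C_cont, of "r \<omega>" "y \<omega>" "walk n k \<omega>" "walk n (Suc k) \<omega>"] by (simp add: P_def)
  qed
  define A where "A = (\<Sum>k<n. LINT \<omega>|M. curv (walk n k \<omega>))"
  define D where "D = (\<Sum>k<n. LINT \<omega>|M. P k \<omega> - Q k \<omega>)"
  have hC_int: "integrable M (\<lambda>\<omega>. h (walk n k \<omega>) - C (r \<omega>))" for k
  proof (rule integrable_const_bound[where B="2 * S"])
    have "0 \<le> C v" "C v \<le> S" for v
      using cost_bounded[OF S] by (auto simp: C_def)
    then show "AE \<omega> in M. norm (h (walk n k \<omega>) - C (r \<omega>)) \<le> 2 * S"
      by (intro AE_I2) (smt (verit) S real_norm_def)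
    have [measurable]: "C \<in> borel_measurable borel" unfolding C_def by measurable
    show "(\<lambda>\<omega>. h (walk n k \<omega>) - C (r \<omega>)) \<in> borel_measurable M" by measurable
  qed
  define E where "E = (\<lambda>k. LINT \<omega>|M. h (walk n k \<omega>) - C (r \<omega>))"
  have E: "(LINT \<omega>|M. mesh n * (\<Sum>k<n. h (walk n k \<omega>) - C (r \<omega>))) = mesh n * (\<Sum>k<n. E k)"
    unfolding E_def by (subst integral_mult_right_zero, subst Bochner_Integration.integral_sum) (auto intro!: hC_int)
  have "(LINT \<omega>|M. potential C (r \<omega>) (y \<omega>) (walk n n \<omega>)) = (\<Sum>k<n. LINT \<omega>|M. P k \<omega>)"
    unfolding tele using P_int by simp
  also have "\<dots> = (\<Sum>k<n. (LINT \<omega>|M. P k \<omega> - Q k \<omega>) + (LINT \<omega>|M. Q k \<omega>))"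
    using P_int Q by (intro sum.cong) (auto simp: has_bochner_integral_iff)
  also have "\<dots> = D + (\<Sum>k<n. \<sigma>\<^sup>2 * \<gamma> / 2 * mesh n * E k + \<theta>\<^sup>2 * (mesh n)\<^sup>2 / 2 * (LINT \<omega>|M. curv (walk n k \<omega>)))"
    unfolding sum.distrib[of "\<lambda>k. LINT \<omega>|M. P k \<omega> - Q k \<omega>"] D_def[symmetric]
    using Q by (simp only: has_bochner_integral_iff E_def)
  also have "\<dots> = D + (\<sigma>\<^sup>2 * \<gamma> / 2 * mesh n * (\<Sum>k<n. E k) + \<theta>\<^sup>2 * (mesh n)\<^sup>2 / 2 * A)"
    by (simp only: sum.distrib sum_distrib_left[symmetric] A_def)
  finally have split: "(LINT \<omega>|M. potential C (r \<omega>) (y \<omega>) (walk n n \<omega>))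
      - \<sigma>\<^sup>2 * \<gamma> / 2 * (LINT \<omega>|M. mesh n * (\<Sum>k<n. h (walk n k \<omega>) - C (r \<omega>))) = D + \<theta>\<^sup>2 * (mesh n)\<^sup>2 / 2 * A"
    unfolding E by simp
  have nm: "real n * mesh n = T - s" using n by (simp add: mesh_def)
  have "\<bar>A\<bar> \<le> (\<Sum>k<n. L)"
    unfolding A_def
  proof (intro order_trans[OF sum_abs] sum_mono)
    fix k
    have "\<bar>LINT \<omega>|M. curv (walk n k \<omega>)\<bar> \<le> (LINT \<omega>|M. \<bar>curv (walk n k \<omega>)\<bar>)" by (rule integral_abs_bound)
    also have "\<dots> \<le> L"
    proof (rule integral_le_const)
      show "integrable M (\<lambda>\<omega>. \<bar>curv (walk n k \<omega>)\<bar>)"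
        using curv_bounded[OF S] by (intro integrable_const_bound[where B=L]) (auto simp: L_def)
    qed (use curv_bounded[OF S] in \<open>simp add: L_def\<close>)
    finally show "\<bar>LINT \<omega>|M. curv (walk n k \<omega>)\<bar> \<le> L" .
  qed
  then have A: "\<bar>\<theta>\<^sup>2 * (mesh n)\<^sup>2 / 2 * A\<bar> \<le> \<theta>\<^sup>2 * mesh n * (T - s) * L / 2"
  proof -
    assume "\<bar>A\<bar> \<le> (\<Sum>k<n. L)"
    then have "\<theta>\<^sup>2 * (mesh n)\<^sup>2 / 2 * \<bar>A\<bar> \<le> \<theta>\<^sup>2 * (mesh n)\<^sup>2 / 2 * (real n * L)"
      by (intro mult_left_mono) auto
    also have "\<dots> = \<theta>\<^sup>2 * mesh n * (real n * mesh n) * L / 2" by (simp add: power2_eq_square)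
    finally show ?thesis by (simp add: nm abs_mult)
  qed
  have "\<bar>D\<bar> \<le> (\<Sum>k<n. LINT \<omega>|M. R k \<omega>)"
    unfolding D_def
  proof (intro order_trans[OF sum_abs] sum_mono)
    fix k
    have "\<bar>LINT \<omega>|M. P k \<omega> - Q k \<omega>\<bar> \<le> (LINT \<omega>|M. \<bar>P k \<omega> - Q k \<omega>\<bar>)" by (rule integral_abs_bound)
    also have "\<dots> \<le> (LINT \<omega>|M. R k \<omega>)"
      by (intro integral_mono PQR R_int integrable_abs PQ_int)
    finally show "\<bar>LINT \<omega>|M. P k \<omega> - Q k \<omega>\<bar> \<le> (LINT \<omega>|M. R k \<omega>)" .
  qed
  also have "\<dots> = (\<Sum>k<n. \<epsilon> / 2 * (\<sigma>\<^sup>2 * mesh n + \<theta>\<^sup>2 * (mesh n)\<^sup>2)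
      + L * \<eta> / 2 * (LINT \<omega>|M. max 0 (r \<omega> - walk n k \<omega> - step n k \<omega>))
      + 3 * L / (2 * \<eta>\<^sup>2) * (LINT \<omega>|M. step n k \<omega> ^ 4))"
  proof (rule sum.cong[OF refl])
    fix k
    note sq = incr_square[OF b, of k, unfolded has_bochner_integral_iff step_diff]
    show "(LINT \<omega>|M. R k \<omega>) = \<epsilon> / 2 * (\<sigma>\<^sup>2 * mesh n + \<theta>\<^sup>2 * (mesh n)\<^sup>2)
      + L * \<eta> / 2 * (LINT \<omega>|M. max 0 (r \<omega> - walk n k \<omega> - step n k \<omega>))
      + 3 * L / (2 * \<eta>\<^sup>2) * (LINT \<omega>|M. step n k \<omega> ^ 4)"
      unfolding R_def using sq incr_fourth(1)[OF b, of k] push_mean(1)[OF n, of k]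
      by (subst Bochner_Integration.integral_add, simp, simp,
          subst Bochner_Integration.integral_add, simp, simp) (simp only: integral_mult_right_zero)
  qed
  also have "\<dots> = \<epsilon> / 2 * (\<sigma>\<^sup>2 + \<theta>\<^sup>2 * mesh n) * (real n * mesh n)
      + L * \<eta> / 2 * (\<Sum>k<n. LINT \<omega>|M. max 0 (r \<omega> - walk n k \<omega> - step n k \<omega>))
      + 3 * L / (2 * \<eta>\<^sup>2) * (\<Sum>k<n. LINT \<omega>|M. step n k \<omega> ^ 4)"
    by (simp only: sum.distrib sum_distrib_left[symmetric] sum_constant card_lessThan)
       (simp add: power2_eq_square algebra_simps)
  also have "\<dots> \<le> \<epsilon> / 2 * (\<sigma>\<^sup>2 + \<theta>\<^sup>2 * mesh n) * (T - s)
      + L * \<eta> / 2 * (4 / \<gamma> - \<theta> * (T - s))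
      + 3 * L / (2 * \<eta>\<^sup>2) * ((8 * \<theta> ^ 4 * mesh n ^ 3 + 24 * \<sigma> ^ 4 * mesh n) * (T - s))"
  proof (intro add_mono mult_left_mono)
    show "(\<Sum>k<n. LINT \<omega>|M. max 0 (r \<omega> - walk n k \<omega> - step n k \<omega>)) \<le> 4 / \<gamma> - \<theta> * (T - s)"
      by (rule push_mean(2)[OF n])
    have "(\<Sum>k<n. LINT \<omega>|M. step n k \<omega> ^ 4) \<le> (\<Sum>k<n. 8 * \<theta> ^ 4 * mesh n ^ 4 + 24 * \<sigma> ^ 4 * (mesh n)\<^sup>2)"
      by (intro sum_mono incr_fourth(2)[OF b, unfolded step_diff])
    also have "\<dots> = (8 * \<theta> ^ 4 * mesh n ^ 3 + 24 * \<sigma> ^ 4 * mesh n) * (real n * mesh n)"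
      by (simp add: power2_eq_square power3_eq_cube power4_eq_xxxx algebra_simps)
    finally show "(\<Sum>k<n. LINT \<omega>|M. step n k \<omega> ^ 4) \<le> (8 * \<theta> ^ 4 * mesh n ^ 3 + 24 * \<sigma> ^ 4 * mesh n) * (T - s)"
      by (simp add: nm)
  qed (use nm L0 \<eta> \<epsilon> mesh_nonneg[of n] sT in \<open>auto intro!: mult_nonneg_nonneg add_nonneg_nonneg\<close>)
  finally have "\<bar>D\<bar> \<le> \<dots>" .
  then show ?thesis
    unfolding split using A by (simp only: L_def mult.assoc)
qed

end

section \<open>The expected cost of the path for bounded costs\<close>

context reflected_path_until
begin

context
  fixes h :: "real \<Rightarrow> real" and S :: real
  assumes h: "discounted_cost h \<gamma>" and S: "\<And>v. 0 \<le> h v" "\<And>v. h v \<le> S"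
    and unif: "uniformly_continuous_on UNIV h"
begin

interpretation discounted_cost h \<gamma> by (fact h)

lemma walk_identity_limit:
  "(\<lambda>n. (LINT \<omega>|M. potential C (r \<omega>) (y \<omega>) (walk n n \<omega>))
      - \<sigma>\<^sup>2 * \<gamma> / 2 * (LINT \<omega>|M. mesh n * (\<Sum>k<n. h (walk n k \<omega>) - C (r \<omega>)))) \<longlonglongrightarrow> 0"
  (is "?X \<longlonglongrightarrow> 0")
proof (rule LIMSEQ_I, goal_cases)
  case (1 e)
  define c where "c = \<sigma>\<^sup>2 * (T - s) / 2 + \<gamma> * S / 2 * (4 / \<gamma> - \<theta> * (T - s)) + 1"
  have S0: "0 \<le> S" using S[of 0] by linarith
  have c0: "0 \<le> 4 / \<gamma> - \<theta> * (T - s)"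
  proof -
    have "\<theta> * (T - s) \<le> 0" using \<theta>_neg sT by (intro mult_nonpos_nonneg) auto
    moreover have "0 \<le> 4 / \<gamma>" using \<gamma>_pos by simp
    ultimately show ?thesis by linarith
  qed
  have c: "0 < c"
    unfolding c_def using c0 S0 \<gamma>_pos sT by (intro add_nonneg_pos add_nonneg_nonneg mult_nonneg_nonneg) auto
  define \<epsilon> where "\<epsilon> = e / (2 * c)"
  have \<epsilon>: "0 < \<epsilon>" "\<epsilon> * c = e / 2" using 1 c by (auto simp: \<epsilon>_def)
  obtain \<eta> where \<eta>: "0 < \<eta>" "\<eta> \<le> \<epsilon>" "\<And>v w. \<bar>v - w\<bar> \<le> \<eta> \<Longrightarrow> \<bar>curv v - curv w\<bar> \<le> \<epsilon>"
  proof (rule curv_modulus[OF S unif \<epsilon>(1)])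
    fix \<eta> assume *: "0 < \<eta>" "\<eta> \<le> \<epsilon>" "\<And>v w. \<bar>v - w\<bar> \<le> \<eta> \<Longrightarrow> \<bar>curv v - curv w\<bar> \<le> \<epsilon>"
    show thesis by (rule that[OF *])
  qed
  define b where "b = (\<lambda>\<delta>. \<theta>\<^sup>2 * \<delta> * (T - s) * (\<gamma> * S) / 2 + \<epsilon> / 2 * (\<sigma>\<^sup>2 + \<theta>\<^sup>2 * \<delta>) * (T - s)
      + \<gamma> * S * \<eta> / 2 * (4 / \<gamma> - \<theta> * (T - s))
      + 3 * (\<gamma> * S) / (2 * \<eta>\<^sup>2) * (8 * \<theta> ^ 4 * \<delta> ^ 3 + 24 * \<sigma> ^ 4 * \<delta>) * (T - s))"
  have "(\<lambda>n. b (mesh n)) \<longlonglongrightarrow> b 0"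
  proof -
    have "(\<lambda>n. k1 * mesh n * k2 * k3 / 2 + k4 * (k5 + k6 * mesh n) * k2 + k7
        + k8 * (k9 * mesh n ^ 3 + k10 * mesh n) * k2) \<longlonglongrightarrow>
        k1 * 0 * k2 * k3 / 2 + k4 * (k5 + k6 * 0) * k2 + k7 + k8 * (k9 * 0 ^ 3 + k10 * 0) * k2"
      for k1 k2 k3 k4 k5 k6 k7 k8 k9 k10 :: real
      by (intro tendsto_add tendsto_mult tendsto_divide tendsto_power tendsto_const mesh_tendsto) simp
    then show ?thesis unfolding b_def .
  qed
  moreover have "b 0 < e"
  proof -
    have "b 0 = \<epsilon> * (\<sigma>\<^sup>2 * (T - s) / 2) + \<eta> * (\<gamma> * S / 2 * (4 / \<gamma> - \<theta> * (T - s)))"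
      by (simp add: b_def mult_ac)
    also have "\<dots> \<le> \<epsilon> * (\<sigma>\<^sup>2 * (T - s) / 2) + \<epsilon> * (\<gamma> * S / 2 * (4 / \<gamma> - \<theta> * (T - s)))"
      using \<eta>(2) c0 S0 \<gamma>_pos by (intro add_left_mono mult_right_mono) auto
    also have "\<dots> \<le> \<epsilon> * c"
      using \<epsilon>(1) by (simp add: c_def distrib_left)
    also have "\<dots> < e" using \<epsilon>(2) 1 by simp
    finally show ?thesis .
  qed
  ultimately have "\<forall>\<^sub>F n in sequentially. b (mesh n) < e"
    by (rule order_tendstoD(2))
  with eventually_gt_at_top[of 0] have "\<forall>\<^sub>F n in sequentially. norm (?X n - 0) < e"
  proof eventually_elim
    case (elim n)
    have "\<bar>?X n\<bar> \<le> b (mesh n)"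
      unfolding b_def by (rule walk_identity_error[OF elim(1) h S \<eta>(1) less_imp_le[OF \<epsilon>(1)] \<eta>(3)])
    then show ?case using elim(2) by simp
  qed
  then show ?case by (simp add: eventually_sequentially)
qed

lemma path_cost_limit:
  assumes \<omega>: "\<omega> \<in> space M"
  shows "(\<lambda>n. mesh n * (\<Sum>k<n. h (walk n k \<omega>) - C (r \<omega>))) \<longlonglongrightarrow> (LBINT t:{s..T}. (h (Z t \<omega>) - C (r \<omega>)))"
  unfolding mesh_def
proof (rule riemann_sum_approx[OF sT])
  show "continuous_on {s..T} (\<lambda>t. h (Z t \<omega>) - C (r \<omega>))"
    using continuous_on_subset[OF Z_cont[OF \<omega>], of "{s..T}"]
    by (intro continuous_intros continuous_on_compose2[OF h_cont]) auto
  fix \<epsilon> :: real assume "0 < \<epsilon>"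
  then obtain d where d: "0 < d" "\<And>v w. dist v w < d \<Longrightarrow> dist (h v) (h w) < \<epsilon>"
    using unif unfolding uniformly_continuous_on_def by (metis UNIV_I)
  have "\<forall>\<^sub>F n in sequentially. \<forall>k\<le>n. Z (grid n k) \<omega> \<le> walk n k \<omega> + d / 2"
    by (rule Z_le_walk[OF \<omega>]) (use d in simp)
  then show "\<forall>\<^sub>F n in sequentially. \<forall>k<n. \<bar>h (walk n k \<omega>) - C (r \<omega>)
      - (h (Z (s + real k * ((T - s) / real n)) \<omega>) - C (r \<omega>))\<bar> \<le> \<epsilon>"
  proof eventually_elim
    case (elim n)
    show ?case
    proof (intro allI impI)
      fix k assume "k < n"
      then have "dist (walk n k \<omega>) (Z (grid n k) \<omega>) < d"
        using elim[rule_format, of k] walk_le_Z[OF \<omega>, of n k] d(1) by (auto simp: dist_real_def)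
      from d(2)[OF this] show "\<bar>h (walk n k \<omega>) - C (r \<omega>)
          - (h (Z (s + real k * ((T - s) / real n)) \<omega>) - C (r \<omega>))\<bar> \<le> \<epsilon>"
        by (simp add: dist_real_def grid_def mesh_def)
    qed
  qed
qed

text \<open>Both sides of the identity for walks converge by dominated convergence: the path cost is bounded,
  and the potential grows at most linearly in the ascent and in the free motion.\<close>

lemma bounded_identity:
  "has_bochner_integral M (\<lambda>\<omega>. potential C (r \<omega>) (y \<omega>) (Z T \<omega>))
      (\<sigma>\<^sup>2 * \<gamma> / 2 * (LINT \<omega>|M. (LBINT t:{s..T}. (h (Z t \<omega>) - C (r \<omega>)))))"
  "integrable M (\<lambda>\<omega>. LBINT t:{s..T}. (h (Z t \<omega>) - C (r \<omega>)))"
proof -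
  note [measurable] = r_M y_M Z_T_meas
  have walk_M': "walk (Suc n) k \<in> borel_measurable M" for n k by (rule walk_M) simp
  note [measurable] = walk_M'
  have S0: "0 \<le> S" using S[of 0] by linarith
  have C_cont: "continuous_on UNIV C" by (rule cost_cont)
  note C_bounds = cost_bounded[OF S]
  let ?X = "\<lambda>n \<omega>. potential C (r \<omega>) (y \<omega>) (walk (Suc n) (Suc n) \<omega>)"
  let ?X' = "\<lambda>\<omega>. potential C (r \<omega>) (y \<omega>) (Z T \<omega>)"
  let ?I = "\<lambda>n \<omega>. mesh (Suc n) * (\<Sum>k<Suc n. h (walk (Suc n) k \<omega>) - C (r \<omega>))"
  let ?I' = "\<lambda>\<omega>. LBINT t:{s..T}. (h (Z t \<omega>) - C (r \<omega>))"
  have X'_meas: "?X' \<in> borel_measurable M" and X_meas: "?X n \<in> borel_measurable M" for n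
    by (intro potential_measurable[OF C_cont]; measurable)+
  have X_lim: "AE \<omega> in M. (\<lambda>n. ?X n \<omega>) \<longlonglongrightarrow> ?X' \<omega>"
  proof (rule AE_I2)
    fix \<omega> assume \<omega>: "\<omega> \<in> space M"
    have "isCont (potential C (r \<omega>) (y \<omega>)) (Z T \<omega>)"
      by (rule DERIV_isCont[OF potential_has_derivative[OF C_cont]])
    moreover have "(\<lambda>n. walk (Suc n) (Suc n) \<omega>) \<longlonglongrightarrow> Z T \<omega>"
      by (rule filterlim_compose[OF walk_tendsto[OF \<omega>] filterlim_Suc])
    ultimately show "(\<lambda>n. ?X n \<omega>) \<longlonglongrightarrow> ?X' \<omega>" by (rule isCont_tendsto_compose)
  qed
  have dom_int: "integrable M (\<lambda>\<omega>. S * (\<bar>incr s T \<omega>\<bar> + max 0 (Z T \<omega> - y \<omega>)))"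
    using incr_integrable excess_Z_mean(1)[of "\<gamma> / 2"] \<gamma>_pos by auto
  have X_bound: "AE \<omega> in M. norm (?X n \<omega>) \<le> S * (\<bar>incr s T \<omega>\<bar> + max 0 (Z T \<omega> - y \<omega>))" for n
  proof (rule AE_I2)
    fix \<omega> assume \<omega>: "\<omega> \<in> space M"
    have "walk (Suc n) (Suc n) \<omega> \<le> Z T \<omega>"
      using walk_le_Z[OF \<omega>, of "Suc n" "Suc n"] by (simp add: grid_n)
    moreover have "y \<omega> + incr s T \<omega> \<le> walk (Suc n) (Suc n) \<omega>"
      using walk_eq[OF \<omega>, of "Suc n" "Suc n"] by (simp add: grid_n)
    ultimately have "\<bar>walk (Suc n) (Suc n) \<omega> - y \<omega>\<bar> \<le> \<bar>incr s T \<omega>\<bar> + max 0 (Z T \<omega> - y \<omega>)" by linarith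
    then show "norm (?X n \<omega>) \<le> S * (\<bar>incr s T \<omega>\<bar> + max 0 (Z T \<omega> - y \<omega>))"
      using abs_potential_le[OF C_cont C_bounds] mult_left_mono[OF _ S0] order_trans by (metis real_norm_def)
  qed
  have X': "integrable M ?X'" "(\<lambda>n. LINT \<omega>|M. ?X n \<omega>) \<longlonglongrightarrow> (LINT \<omega>|M. ?X' \<omega>)"
    using integrable_dominated_convergence[OF X'_meas X_meas dom_int X_lim X_bound]
      integral_dominated_convergence[OF X'_meas X_meas dom_int X_lim X_bound] by auto
  have [measurable]: "C \<in> borel_measurable borel" by measurable
  have I_meas: "?I n \<in> borel_measurable M" for n by measurable
  have I_lim: "AE \<omega> in M. (\<lambda>n. ?I n \<omega>) \<longlonglongrightarrow> ?I' \<omega>"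
    by (intro AE_I2 filterlim_compose[OF path_cost_limit filterlim_Suc])
  have I'_meas: "?I' \<in> borel_measurable M"
    by (rule borel_measurable_LIMSEQ_real[of _ ?I])
       (rule filterlim_compose[OF path_cost_limit filterlim_Suc], assumption, rule I_meas)
  have I_bound: "AE \<omega> in M. norm (?I n \<omega>) \<le> (T - s) * (2 * S)" for n
  proof (rule AE_I2)
    fix \<omega>
    have "\<bar>\<Sum>k<Suc n. h (walk (Suc n) k \<omega>) - C (r \<omega>)\<bar> \<le> (\<Sum>k<Suc n. 2 * S)"
    proof (intro order_trans[OF sum_abs] sum_mono)
      fix k show "\<bar>h (walk (Suc n) k \<omega>) - C (r \<omega>)\<bar> \<le> 2 * S"
        using S[of "walk (Suc n) k \<omega>"] C_bounds[of "r \<omega>"] by linarith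
    qed
    then have "mesh (Suc n) * \<bar>\<Sum>k<Suc n. h (walk (Suc n) k \<omega>) - C (r \<omega>)\<bar> \<le> mesh (Suc n) * (real (Suc n) * (2 * S))"
      using mesh_nonneg by (intro mult_left_mono) auto
    also have "\<dots> = (T - s) * (2 * S)" by (simp add: mesh_def del: of_nat_Suc)
    finally show "norm (?I n \<omega>) \<le> (T - s) * (2 * S)" using mesh_nonneg[of "Suc n"] by (simp add: abs_mult)
  qed
  have I': "integrable M ?I'" "(\<lambda>n. LINT \<omega>|M. ?I n \<omega>) \<longlonglongrightarrow> (LINT \<omega>|M. ?I' \<omega>)"
    using integrable_dominated_convergence[OF I'_meas I_meas _ I_lim I_bound]
      integral_dominated_convergence[OF I'_meas I_meas _ I_lim I_bound] by auto
  have "(\<lambda>n. (LINT \<omega>|M. ?X n \<omega>) - \<sigma>\<^sup>2 * \<gamma> / 2 * (LINT \<omega>|M. ?I n \<omega>)) \<longlonglongrightarrow> 0"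
    by (rule filterlim_compose[OF walk_identity_limit filterlim_Suc])
  moreover have "(\<lambda>n. (LINT \<omega>|M. ?X n \<omega>) - \<sigma>\<^sup>2 * \<gamma> / 2 * (LINT \<omega>|M. ?I n \<omega>))
      \<longlonglongrightarrow> (LINT \<omega>|M. ?X' \<omega>) - \<sigma>\<^sup>2 * \<gamma> / 2 * (LINT \<omega>|M. ?I' \<omega>)"
    by (intro tendsto_diff tendsto_mult tendsto_const X' I')
  ultimately have "(LINT \<omega>|M. ?X' \<omega>) - \<sigma>\<^sup>2 * \<gamma> / 2 * (LINT \<omega>|M. ?I' \<omega>) = 0"
    using LIMSEQ_unique by blast
  then show "has_bochner_integral M ?X' (\<sigma>\<^sup>2 * \<gamma> / 2 * (LINT \<omega>|M. ?I' \<omega>))" "integrable M ?I'"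
    using X' I' by (auto simp: has_bochner_integral_iff)
qed

end
end

section \<open>Cutting off a growing cost\<close>

lemma discounted_cost_of_growth:
  assumes cont: "continuous_on UNIV h" and nonneg: "\<And>v. 0 \<le> h v"
    and growth: "\<And>v. - K \<le> v \<Longrightarrow> h v \<le> A * exp (l * (v + K))" and u: "0 < u" "l < u"
  shows "discounted_cost h u"
proof (unfold_locales, fact u, fact cont)
  fix z
  have [measurable]: "h \<in> borel_measurable borel" using cont by (rule borel_measurable_continuous_onI)
  have bound: "\<bar>h v * exp (- u * v)\<bar> \<le> \<bar>A * exp (l * (v + K)) * exp (- u * v)\<bar>" if "- K \<le> v" for v
  proof -
    have "0 \<le> h v * exp (- u * v)" using nonneg by simp
    moreover have "h v * exp (- u * v) \<le> A * exp (l * (v + K)) * exp (- u * v)"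
      using growth[OF that] by (intro mult_right_mono) auto
    ultimately show ?thesis by linarith
  qed
  have "set_integrable lborel {- K..} (\<lambda>v. h v * exp (- u * v))"
    by (rule set_integrable_bound[OF set_integrable_exp_growth[OF u(2), of "- K" A K]])
       (use bound in \<open>auto simp: set_borel_measurable_def\<close>)
  moreover have "set_integrable lborel {z..- K} (\<lambda>v. h v * exp (- u * v))"
    by (intro borel_integrable_atLeastAtMost' continuous_intros continuous_on_subset[OF cont]) auto
  ultimately have "set_integrable lborel ({- K..} \<union> {z..- K}) (\<lambda>v. h v * exp (- u * v))"
    by (intro set_integrable_Un) auto
  then show "set_integrable lborel {z..} (\<lambda>v. h v * exp (- u * v))"
    by (rule set_integrable_subset) auto
qed

text \<open>The cost is frozen to the left of \<open>- K\<close>, which no path visits, and brought down linearly to \<open>0\<close>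
  between \<open>m\<close> and \<open>m + 1\<close>. The result is bounded and uniformly continuous, and on \<open>{- K..}\<close>
  it increases to \<open>h\<close> with \<open>m\<close>.\<close>

definition cutoff :: "(real \<Rightarrow> real) \<Rightarrow> real \<Rightarrow> nat \<Rightarrow> real \<Rightarrow> real" where
  "cutoff h K m v = h (max (- K) v) * max 0 (min 1 (real m + 1 - v))"

lemma cutoff_cont:
  assumes "continuous_on UNIV h"
  shows "continuous_on UNIV (cutoff h K m)"
proof -
  have "continuous_on UNIV (\<lambda>v. h (max (- K) v))"
    by (rule continuous_on_compose2[OF assms]) (auto intro!: continuous_intros)
  then show ?thesis
    unfolding cutoff_def by (intro continuous_intros)
qed

lemma cutoff_clamp:
  assumes "0 \<le> K"
  shows "cutoff h K m v = cutoff h K m (max (- K) (min (real m + 1) v))"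
  using assms by (auto simp: cutoff_def max_def min_def)

lemma cutoff_eq: "- K \<le> v \<Longrightarrow> v \<le> real m \<Longrightarrow> cutoff h K m v = h v"
  by (simp add: cutoff_def)

context
  fixes h :: "real \<Rightarrow> real"
  assumes nonneg: "\<And>v. 0 \<le> h v"
begin

lemma cutoff_nonneg: "0 \<le> cutoff h K m v"
  using nonneg by (simp add: cutoff_def)

lemma cutoff_le: "- K \<le> v \<Longrightarrow> cutoff h K m v \<le> h v"
  using nonneg[of v] mult_left_mono[of "max 0 (min 1 (real m + 1 - v))" 1 "h v"] by (simp add: cutoff_def)

lemma cutoff_mono: "m \<le> n \<Longrightarrow> cutoff h K m v \<le> cutoff h K n v"
  unfolding cutoff_def using nonneg by (intro mult_left_mono) auto

end

lemma cutoff_uniformly_continuous: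
  assumes "continuous_on UNIV h" "0 \<le> K"
  shows "uniformly_continuous_on UNIV (cutoff h K m)"
proof -
  define c where "c = (\<lambda>v. max (- K) (min (real m + 1) v))"
  have "uniformly_continuous_on {- K..real m + 1} (cutoff h K m)"
    by (intro compact_uniformly_continuous continuous_on_subset[OF cutoff_cont[OF assms(1)]]) auto
  then have "uniformly_continuous_on (range c) (cutoff h K m)"
  proof (unfold uniformly_continuous_on_def, intro allI impI, goal_cases)
    case (1 e)
    then obtain d where d: "0 < d" "\<And>x x'. x \<in> {- K..real m + 1} \<Longrightarrow> x' \<in> {- K..real m + 1} \<Longrightarrow>
        dist x' x < d \<Longrightarrow> dist (cutoff h K m x') (cutoff h K m x) < e"
      by meson
    have "range c \<subseteq> {- K..real m + 1}" using assms(2) by (auto simp: c_def)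
    then show ?case using d by (intro exI[of _ d]) blast
  qed
  moreover have "uniformly_continuous_on UNIV c"
    unfolding uniformly_continuous_on_def
  proof (intro allI impI)
    fix e :: real assume "0 < e"
    then show "\<exists>d>0. \<forall>x\<in>UNIV. \<forall>x'\<in>UNIV. dist x' x < d \<longrightarrow> dist (c x') (c x) < e"
      by (intro exI[of _ e]) (auto simp: c_def dist_real_def max_def min_def)
  qed
  ultimately have "uniformly_continuous_on UNIV (\<lambda>v. cutoff h K m (c v))"
    by (rule uniformly_continuous_on_compose[of UNIV c, rotated])
  moreover have "(\<lambda>v. cutoff h K m (c v)) = cutoff h K m"
    unfolding c_def by (rule ext, rule cutoff_clamp[OF assms(2), symmetric])
  ultimately show ?thesis by simp
qed

lemma cutoff_bounded:
  assumes "continuous_on UNIV h" "0 \<le> K"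
  shows "\<exists>S. \<forall>v. cutoff h K m v \<le> S"
proof -
  have "compact (cutoff h K m ` {- K..real m + 1})"
    by (rule compact_continuous_image[OF continuous_on_subset[OF cutoff_cont[OF assms(1)]] compact_Icc]) simp
  then obtain S where S: "\<And>v. v \<in> {- K..real m + 1} \<Longrightarrow> cutoff h K m v \<le> S"
  proof -
    assume *: "compact (cutoff h K m ` {- K..real m + 1})" 
      "\<And>S. (\<And>v. v \<in> {- K..real m + 1} \<Longrightarrow> cutoff h K m v \<le> S) \<Longrightarrow> thesis"
    from bounded_imp_bdd_above[OF compact_imp_bounded[OF *(1)]]
    obtain S where "\<forall>x\<in>cutoff h K m ` {- K..real m + 1}. x \<le> S" unfolding bdd_above_def ..
    then show thesis by (intro *(2)) auto
  qed
  have "cutoff h K m v \<le> S" for v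
    by (subst cutoff_clamp[OF assms(2)], rule S) (use assms(2) in auto)
  then show ?thesis by blast
qed

context
  fixes h :: "real \<Rightarrow> real" and u K A l :: real
  assumes cont: "continuous_on UNIV h" and nonneg: "\<And>v. 0 \<le> h v"
    and growth: "\<And>v. - K \<le> v \<Longrightarrow> h v \<le> A * exp (l * (v + K))" and u: "0 < l" "l < u"
    and K: "0 \<le> K"
begin

interpretation discounted_cost h u
  using u by (intro discounted_cost_of_growth[OF cont nonneg growth]) auto

lemma cutoff_discounted: "discounted_cost (cutoff h K m) u"
proof -
  have "cutoff h K m v \<le> A * exp (l * (v + K))" if "- K \<le> v" for v
    using cutoff_le[of h K v m, OF nonneg that] growth[OF that] by simp
  then show ?thesis
    using u by (intro discounted_cost_of_growth[OF cutoff_cont[OF cont] cutoff_nonneg[of h, OF nonneg]]) auto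
qed

lemma cutoff_cost_le:
  "- K \<le> v \<Longrightarrow> cost (cutoff h K m) u v \<le> cost h u v"
  by (intro discounted_cost.cost_mono[OF cutoff_discounted discounted_cost_axioms] cutoff_le[of h, OF nonneg]) auto

lemma cutoff_cost_nonneg: "0 \<le> cost (cutoff h K m) u v"
  by (intro discounted_cost.cost_nonneg[OF cutoff_discounted] cutoff_nonneg[of h, OF nonneg])

lemma cutoff_cost_tendsto:
  assumes "- K \<le> z"
  shows "(\<lambda>m. cost (cutoff h K m) u z) \<longlonglongrightarrow> cost h u z"
proof -
  have "(\<lambda>m. LINT v|lborel. indicator {z..} v *\<^sub>R (cutoff h K m v * exp (- u * v)))
      \<longlonglongrightarrow> (LINT v|lborel. indicator {z..} v *\<^sub>R (h v * exp (- u * v)))"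
  proof (rule integral_dominated_convergence)
    show "integrable lborel (\<lambda>v. indicator {z..} v *\<^sub>R (h v * exp (- u * v)))"
      using h_integrable[of z] by (simp add: set_integrable_def)
    show "AE v in lborel. (\<lambda>m. indicator {z..} v *\<^sub>R (cutoff h K m v * exp (- u * v)))
        \<longlonglongrightarrow> indicator {z..} v *\<^sub>R (h v * exp (- u * v))"
    proof (rule AE_I2)
      fix v
      have "\<forall>\<^sub>F m in sequentially. indicator {z..} v *\<^sub>R (cutoff h K m v * exp (- u * v))
          = indicator {z..} v *\<^sub>R (h v * exp (- u * v))"
        using eventually_ge_at_top[of "nat \<lceil>v\<rceil>"]
      proof eventually_elim
        case (elim m)
        then show ?case using cutoff_eq[of K v m h] assms by (auto split: split_indicator)
      qed
      then show "(\<lambda>m. indicator {z..} v *\<^sub>R (cutoff h K m v * exp (- u * v)))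
        \<longlonglongrightarrow> indicator {z..} v *\<^sub>R (h v * exp (- u * v))" by (rule tendsto_eventually)
    qed
    show "AE v in lborel. norm (indicator {z..} v *\<^sub>R (cutoff h K m v * exp (- u * v)))
        \<le> indicator {z..} v *\<^sub>R (h v * exp (- u * v))" for m
      using cutoff_nonneg[of h, OF nonneg] cutoff_le[of h, OF nonneg] assms
      by (intro AE_I2) (auto simp: abs_mult split: split_indicator intro!: mult_right_mono)
    have [measurable]: "cutoff h K m \<in> borel_measurable borel" for m
      by (intro borel_measurable_continuous_onI cutoff_cont cont)
    show "(\<lambda>v. indicator {z..} v *\<^sub>R (cutoff h K m v * exp (- u * v))) \<in> borel_measurable lborel" for m
      by measurable
  qed measurable
  then show ?thesis
    unfolding cost_eq_tail set_lebesgue_integral_def by (intro tendsto_mult tendsto_const)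
qed

lemma cutoff_potential_tendsto:
  assumes "- K \<le> r" "- K \<le> y" "- K \<le> z"
  shows "(\<lambda>m. potential (cost (cutoff h K m) u) r y z) \<longlonglongrightarrow> potential C r y z"
proof -
  have le: "(\<lambda>m. LBINT v=y..z. cost (cutoff h K m) u v) \<longlonglongrightarrow> (LBINT v=y..z. C v)"
    if "- K \<le> y" "y \<le> z" for y z :: real
  proof -
    have "(\<lambda>m. LINT v|lborel. indicator {y..z} v *\<^sub>R cost (cutoff h K m) u v)
        \<longlonglongrightarrow> (LINT v|lborel. indicator {y..z} v *\<^sub>R C v)"
    proof (rule integral_dominated_convergence)
      show "integrable lborel (\<lambda>v. indicator {y..z} v *\<^sub>R C v)"
        using borel_integrable_atLeastAtMost'[OF cost_cont] by (simp add: set_integrable_def)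
      show "AE v in lborel. (\<lambda>m. indicator {y..z} v *\<^sub>R cost (cutoff h K m) u v) \<longlonglongrightarrow> indicator {y..z} v *\<^sub>R C v"
        using that by (intro AE_I2) (auto split: split_indicator intro!: cutoff_cost_tendsto)
      show "AE v in lborel. norm (indicator {y..z} v *\<^sub>R cost (cutoff h K m) u v) \<le> indicator {y..z} v *\<^sub>R C v" for m
        using that cutoff_cost_nonneg cutoff_cost_le
        by (intro AE_I2) (auto split: split_indicator)
      have [measurable]: "cost (cutoff h K m) u \<in> borel_measurable borel" for m
        by (rule discounted_cost.cost_borel[OF cutoff_discounted])
      show "(\<lambda>v. indicator {y..z} v *\<^sub>R cost (cutoff h K m) u v) \<in> borel_measurable lborel" for m
        by measurable
    qed measurable
    then show ?thesis
      using that by (simp add: interval_integral_Icc set_lebesgue_integral_def)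
  qed
  have "(\<lambda>m. LBINT v=y..z. cost (cutoff h K m) u v) \<longlonglongrightarrow> (LBINT v=y..z. C v)"
  proof (cases "y \<le> z")
    case False
    then have "(\<lambda>m. - (LBINT v=z..y. cost (cutoff h K m) u v)) \<longlonglongrightarrow> - (LBINT v=z..y. C v)"
      using assms by (intro tendsto_minus le) auto
    then show ?thesis by (simp add: interval_integral_endpoints_reverse[of y z])
  qed (use le assms in auto)
  then show ?thesis
    unfolding potential_def by (intro tendsto_intros cutoff_cost_tendsto assms)
qed

end

section \<open>The expected cost of the path and its bounds\<close>

context reflected_path_until
begin

text \<open>By \<open>walk_eq\<close> the walk is the larger of the free motion and the walk started at the level.
  The free motion has a decreasing exponential moment, the other is dominated by the
  exponential law of rate \<open>\<gamma>\<close>.\<close>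

lemma Z_exp:
  assumes l: "0 < l" "l < \<gamma>" and r: "\<And>\<omega>. \<omega> \<in> space M \<Longrightarrow> r \<omega> \<le> 0"
    and y: "integrable M (\<lambda>\<omega>. exp (l * y \<omega>))"
  shows "integrable M (\<lambda>\<omega>. exp (l * Z T \<omega>))"
    and "(LINT \<omega>|M. exp (l * Z T \<omega>)) \<le> (LINT \<omega>|M. exp (l * y \<omega>)) + \<gamma> / (\<gamma> - l)"
proof -
  note [measurable] = y_M Z_T_meas incr_measurable[OF s_nonneg sT]
  let ?L = "(LINT \<omega>|M. exp (l * y \<omega>)) + \<gamma> / (\<gamma> - l)"
  have incr: "integrable M (\<lambda>\<omega>. exp (l * incr s T \<omega>))" "(LINT \<omega>|M. exp (l * incr s T \<omega>)) \<le> 1"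
  proof -
    have "l * (l - \<gamma>) * \<sigma>\<^sup>2 * (T - s) / 2 \<le> 0"
      using l sT by (auto simp: mult_nonneg_nonpos mult_nonpos_nonneg divide_nonpos_pos)
    then show "integrable M (\<lambda>\<omega>. exp (l * incr s T \<omega>))" "(LINT \<omega>|M. exp (l * incr s T \<omega>)) \<le> 1"
      using incr_exp[OF s_nonneg sT, of l] by (auto simp: has_bochner_integral_iff)
  qed
  have "indep_var borel (\<lambda>\<omega>. exp (l * y \<omega>)) borel (\<lambda>\<omega>. exp (l * incr s T \<omega>))"
    using indep_var_compose[OF incr_indep[OF s_nonneg sT y_meas], of "\<lambda>x. exp (l * x)" borel "\<lambda>x. exp (l * x)" borel]
    by (simp add: comp_def)
  note ind = indep_var_integrable[OF this y incr(1)] indep_var_lebesgue_integral[OF this y incr(1)]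
  have L0: "0 \<le> ?L" using l by (intro add_nonneg_nonneg integral_nonneg_AE) auto
  have nn: "(\<integral>\<^sup>+\<omega>. ennreal (exp (l * (Z T \<omega> - y \<omega>)) * exp (l * y \<omega>)) \<partial>M) \<le> ennreal ?L"
  proof (rule nn_integral_Z_le[where f="\<lambda>x. exp (l * x)"])
    fix n :: nat assume n: "0 < n"
    note [measurable] = excess_M[OF n]
    have "(\<integral>\<^sup>+\<omega>. ennreal (exp (l * (walk n n \<omega> - y \<omega>)) * exp (l * y \<omega>)) \<partial>M)
        \<le> (\<integral>\<^sup>+\<omega>. ennreal (exp (l * y \<omega>) * exp (l * incr s T \<omega>)) + ennreal (exp (l * excess n n \<omega>)) \<partial>M)"
    proof (intro nn_integral_mono)
      fix \<omega> assume \<omega>: "\<omega> \<in> space M"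
      have "exp (l * (walk n n \<omega> - y \<omega>)) * exp (l * y \<omega>) = exp (l * walk n n \<omega>)"
        by (simp add: exp_add[symmetric] algebra_simps)
      also have "\<dots> \<le> exp (l * (y \<omega> + incr s T \<omega>)) + exp (l * excess n n \<omega>)"
      proof (cases "walk n n \<omega> = y \<omega> + incr s T \<omega>")
        case False
        then have "walk n n \<omega> \<le> excess n n \<omega>"
          using walk_eq[OF \<omega>, of n n] r[OF \<omega>] by (auto simp: grid_n[OF n] max_def split: if_splits)
        then show ?thesis using l by (intro add_increasing) auto
      qed (auto intro: add_increasing2)
      finally show "ennreal (exp (l * (walk n n \<omega> - y \<omega>)) * exp (l * y \<omega>))
          \<le> ennreal (exp (l * y \<omega>) * exp (l * incr s T \<omega>)) + ennreal (exp (l * excess n n \<omega>))"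
        by (simp add: distrib_left exp_add flip: ennreal_plus)
    qed
    also have "\<dots> = (\<integral>\<^sup>+\<omega>. ennreal (exp (l * y \<omega>) * exp (l * incr s T \<omega>)) \<partial>M)
        + (\<integral>\<^sup>+\<omega>. ennreal (exp (l * excess n n \<omega>)) \<partial>M)"
      by (rule nn_integral_add) measurable
    also have "\<dots> \<le> ennreal (LINT \<omega>|M. exp (l * y \<omega>)) + ennreal (\<gamma> / (\<gamma> - l))"
    proof (rule add_mono)
      have "(\<integral>\<^sup>+\<omega>. ennreal (exp (l * y \<omega>) * exp (l * incr s T \<omega>)) \<partial>M)
          = ennreal ((LINT \<omega>|M. exp (l * y \<omega>)) * (LINT \<omega>|M. exp (l * incr s T \<omega>)))"
        using ind by (subst nn_integral_eq_integral) auto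
      also have "\<dots> \<le> ennreal (LINT \<omega>|M. exp (l * y \<omega>))"
        using incr(2) mult_left_mono[OF incr(2), of "LINT \<omega>|M. exp (l * y \<omega>)"] by (intro ennreal_leI) simp
      finally show "(\<integral>\<^sup>+\<omega>. ennreal (exp (l * y \<omega>) * exp (l * incr s T \<omega>)) \<partial>M)
          \<le> ennreal (LINT \<omega>|M. exp (l * y \<omega>))" .
    qed (rule excess_exp[OF n l])
    also have "\<dots> = ennreal ?L" using l by (intro ennreal_plus[symmetric]) auto
    finally show "(\<integral>\<^sup>+\<omega>. ennreal (exp (l * (walk n n \<omega> - y \<omega>)) * exp (l * y \<omega>)) \<partial>M) \<le> ennreal ?L" .
  qed (auto intro!: continuous_intros)
  have "exp (l * (Z T \<omega> - y \<omega>)) * exp (l * y \<omega>) = exp (l * Z T \<omega>)" for \<omega>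
    by (simp add: exp_add[symmetric] algebra_simps)
  then have nn: "(\<integral>\<^sup>+\<omega>. ennreal (exp (l * Z T \<omega>)) \<partial>M) \<le> ennreal ?L" using nn by (simp only:)
  then show int: "integrable M (\<lambda>\<omega>. exp (l * Z T \<omega>))"
    by (intro integrableI_nonneg) (auto simp: le_less_trans[OF _ ennreal_less_top])
  show "(LINT \<omega>|M. exp (l * Z T \<omega>)) \<le> ?L"
    using nn L0 by (simp only: nn_integral_eq_integral[OF int] ennreal_le_iff AE_I2 exp_ge_zero)
qed

context
  fixes h :: "real \<Rightarrow> real" and K A l :: real
  assumes cont: "continuous_on UNIV h" and nonneg: "\<And>v. 0 \<le> h v"
    and growth: "\<And>v. - K \<le> v \<Longrightarrow> h v \<le> A * exp (l * (v + K))" and l: "0 < l" "l < \<gamma>"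
    and K: "0 \<le> K"
    and r_bounds: "\<And>\<omega>. \<omega> \<in> space M \<Longrightarrow> - K \<le> r \<omega>" "\<And>\<omega>. \<omega> \<in> space M \<Longrightarrow> r \<omega> \<le> 0"
    and y_exp: "integrable M (\<lambda>\<omega>. exp (l * y \<omega>))"
begin

interpretation discounted_cost h \<gamma>
  using l \<gamma>_pos by (intro discounted_cost_of_growth[OF cont nonneg growth]) auto

text \<open>The factor that bounds the discounted cost when \<open>A\<close> bounds the running cost.\<close>

abbreviation "A' \<equiv> A * \<gamma> / (\<gamma> - l)"

lemma A'_nonneg: "0 \<le> A'"
proof -
  have "0 \<le> A" using growth[of "- K"] nonneg[of "- K"] by simp
  then show ?thesis using l \<gamma>_pos by simp
qed

lemma A'_l_nonneg: "0 \<le> A' / l"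
  using A'_nonneg l(1) by (rule divide_nonneg_pos)

lemma cost_growth: "- K \<le> v \<Longrightarrow> C v \<le> A' * exp (l * (v + K))"
  by (rule cost_le_exp) (use growth l in auto)

lemma C_nonneg: "0 \<le> C v"
  by (intro cost_nonneg nonneg)

lemma cutoff_cost_growth: "- K \<le> v \<Longrightarrow> cost (cutoff h K m) \<gamma> v \<le> A' * exp (l * (v + K))"
  using cutoff_cost_le[OF cont nonneg growth l K, of v m] cost_growth by (meson order_trans)

lemma path_ge: "\<omega> \<in> space M \<Longrightarrow> s \<le> t \<Longrightarrow> - K \<le> Z t \<omega>"
  using r_bounds(1) Z_ge by (meson order_trans)

lemma y_ge: "\<omega> \<in> space M \<Longrightarrow> - K \<le> y \<omega>"
  using r_bounds(1) r_le_y by (meson order_trans)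

lemma dominating_integrable:
  "integrable M (\<lambda>\<omega>. A' / l * (exp (l * (y \<omega> + K)) + exp (l * (Z T \<omega> + K))))"
  using y_exp Z_exp(1)[OF l r_bounds(2) y_exp] by (auto simp: distrib_left exp_add)

lemma potential_integrable: "integrable M (\<lambda>\<omega>. potential C (r \<omega>) (y \<omega>) (Z T \<omega>))"
proof (rule Bochner_Integration.integrable_bound[OF dominating_integrable])
  note [measurable] = r_M y_M Z_T_meas
  show "(\<lambda>\<omega>. potential C (r \<omega>) (y \<omega>) (Z T \<omega>)) \<in> borel_measurable M"
    by (intro potential_measurable[OF cost_cont]) measurable
  show "AE \<omega> in M. norm (potential C (r \<omega>) (y \<omega>) (Z T \<omega>))
      \<le> norm (A' / l * (exp (l * (y \<omega> + K)) + exp (l * (Z T \<omega> + K))))"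
  proof (rule AE_I2)
    fix \<omega> assume \<omega>: "\<omega> \<in> space M"
    have "\<bar>potential C (r \<omega>) (y \<omega>) (Z T \<omega>)\<bar> \<le> A' / l * (exp (l * (y \<omega> + K)) + exp (l * (Z T \<omega> + K)))"
      using r_bounds(1)[OF \<omega>] r_le_y[OF \<omega>] Z_ge[OF \<omega>, of T] sT
      by (intro abs_potential_le_exp[OF cost_cont C_nonneg cost_growth l(1) A'_nonneg]) auto
    then show "norm (potential C (r \<omega>) (y \<omega>) (Z T \<omega>))
        \<le> norm (A' / l * (exp (l * (y \<omega> + K)) + exp (l * (Z T \<omega> + K))))"
      unfolding real_norm_def by linarith
  qed
qed

lemma path_integral_split:
  assumes "continuous_on UNIV g" "\<omega> \<in> space M"
  shows "(LBINT t:{s..T}. (g (Z t \<omega>) - c)) = (LBINT t:{s..T}. g (Z t \<omega>)) - (T - s) * c"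
proof -
  have "continuous_on {s..T} (\<lambda>t. Z t \<omega>)"
    by (rule continuous_on_subset[OF Z_cont[OF assms(2)]]) auto
  then have "continuous_on {s..T} (\<lambda>t. g (Z t \<omega>))"
    by (rule continuous_on_compose2[OF assms(1)]) auto
  then have "set_integrable lborel {s..T} (\<lambda>t. g (Z t \<omega>))" by (rule borel_integrable_atLeastAtMost')
  moreover have "set_integrable lborel {s..T} (\<lambda>t. c)"
    by (intro borel_integrable_atLeastAtMost' continuous_intros)
  ultimately have "(LBINT t:{s..T}. (g (Z t \<omega>) - c)) = (LBINT t:{s..T}. g (Z t \<omega>)) - (LBINT t:{s..T}. c)"
    by (rule set_integral_diff(2))
  also have "(LBINT t:{s..T}. c) = (T - s) * c"
    using sT by (simp add: set_lebesgue_integral_def)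
  finally show ?thesis .
qed

lemma path_integral_cutoff_mono:
  assumes \<omega>: "\<omega> \<in> space M" and "m \<le> n"
  shows "(LBINT t:{s..T}. cutoff h K m (Z t \<omega>)) \<le> (LBINT t:{s..T}. cutoff h K n (Z t \<omega>))"
proof (rule set_integral_mono)
  have "continuous_on {s..T} (\<lambda>t. Z t \<omega>)"
    by (rule continuous_on_subset[OF Z_cont[OF \<omega>]]) auto
  then have "continuous_on {s..T} (\<lambda>t. cutoff h K m (Z t \<omega>))" for m
    by (rule continuous_on_compose2[OF cutoff_cont[OF cont]]) auto
  then show "set_integrable lborel {s..T} (\<lambda>t. cutoff h K m (Z t \<omega>))"
    "set_integrable lborel {s..T} (\<lambda>t. cutoff h K n (Z t \<omega>))"
    by (auto intro: borel_integrable_atLeastAtMost')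
  show "cutoff h K m (Z t \<omega>) \<le> cutoff h K n (Z t \<omega>)" for t
    by (rule cutoff_mono[of h, OF nonneg \<open>m \<le> n\<close>])
qed

text \<open>A single path is bounded on \<open>{s..T}\<close>, so that all but finitely many cutoffs do not
  affect it.\<close>

lemma path_integral_cutoff_tendsto:
  assumes \<omega>: "\<omega> \<in> space M"
  shows "(\<lambda>m. LBINT t:{s..T}. cutoff h K m (Z t \<omega>)) \<longlonglongrightarrow> (LBINT t:{s..T}. h (Z t \<omega>))"
proof -
  have "continuous_on {s..T} (\<lambda>t. Z t \<omega>)"
    by (rule continuous_on_subset[OF Z_cont[OF \<omega>]]) auto
  then have "bdd_above ((\<lambda>t. Z t \<omega>) ` {s..T})"
    by (intro bounded_imp_bdd_above compact_imp_bounded compact_continuous_image compact_Icc)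
  then obtain b where b: "\<forall>x\<in>(\<lambda>t. Z t \<omega>) ` {s..T}. x \<le> b"
    unfolding bdd_above_def ..
  have "\<forall>\<^sub>F m in sequentially. (LBINT t:{s..T}. cutoff h K m (Z t \<omega>)) = (LBINT t:{s..T}. h (Z t \<omega>))"
    using eventually_ge_at_top[of "nat \<lceil>b\<rceil>"]
  proof eventually_elim
    case (elim m)
    have "cutoff h K m (Z t \<omega>) = h (Z t \<omega>)" if "t \<in> {s..T}" for t
    proof (rule cutoff_eq)
      have "Z t \<omega> \<le> b" using b that by blast
      then show "Z t \<omega> \<le> real m" using elim by linarith
    qed (use path_ge[OF \<omega>] that in auto)
    then show ?case by (intro set_lebesgue_integral_cong) auto
  qed
  then show ?thesis by (rule tendsto_eventually)
qed

text \<open>This is Dynkin's formula for the solution of the Poisson equation. It passes from the cutoffs to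
  \<open>h\<close> by monotone convergence of the path costs and dominated convergence of the potentials.\<close>

lemma regret_identity:
  "integrable M (\<lambda>\<omega>. LBINT t:{s..T}. (h (Z t \<omega>) - C (r \<omega>)))"
  "(LINT \<omega>|M. (LBINT t:{s..T}. (h (Z t \<omega>) - C (r \<omega>))))
    = 2 / (\<sigma>\<^sup>2 * \<gamma>) * (LINT \<omega>|M. potential C (r \<omega>) (y \<omega>) (Z T \<omega>))"
proof -
  note [measurable] = r_M y_M Z_T_meas
  define c where "c = (\<lambda>m. cost (cutoff h K m) \<gamma>)"
  define k where "k = 2 / (\<sigma>\<^sup>2 * \<gamma>)"
  have k: "k * (\<sigma>\<^sup>2 * \<gamma> / 2 * x) = x" for x
    using \<sigma>_pos \<gamma>_pos by (simp add: k_def)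
  have cd: "discounted_cost (cutoff h K m) \<gamma>" for m
    by (rule cutoff_discounted[OF cont nonneg growth l K])
  have c_cont: "continuous_on S (c m)" for S m
    unfolding c_def by (rule discounted_cost.cost_cont[OF cd])
  have [measurable]: "c m \<in> borel_measurable borel" for m
    by (rule borel_measurable_continuous_onI[OF c_cont])
  have c_nonneg: "0 \<le> c m v" for m v
    unfolding c_def by (rule cutoff_cost_nonneg[OF cont nonneg growth l K])
  have c_growth: "c m v \<le> A' * exp (l * (v + K))" if "- K \<le> v" for m v
    unfolding c_def by (rule cutoff_cost_growth[OF that])
  let ?P = "\<lambda>m \<omega>. potential (c m) (r \<omega>) (y \<omega>) (Z T \<omega>)"
  let ?I = "\<lambda>m \<omega>. LBINT t:{s..T}. cutoff h K m (Z t \<omega>)"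
  let ?G = "\<lambda>\<omega>. A' / l * (exp (l * (y \<omega> + K)) + exp (l * (Z T \<omega> + K)))"
  have r_int: "integrable M (\<lambda>\<omega>. g (r \<omega>))"
    if g: "continuous_on UNIV g" "\<And>v. 0 \<le> g v" "\<And>v. - K \<le> v \<Longrightarrow> g v \<le> A' * exp (l * (v + K))" for g :: "real \<Rightarrow> real"
  proof (rule integrable_const_bound[where B="A' * exp (l * K)"])
    have [measurable]: "g \<in> borel_measurable borel" by (rule borel_measurable_continuous_onI[OF g(1)])
    show "(\<lambda>\<omega>. g (r \<omega>)) \<in> borel_measurable M" by measurable
    have "g (r \<omega>) \<le> A' * exp (l * K)" if \<omega>: "\<omega> \<in> space M" for \<omega>
    proof -
      have "g (r \<omega>) \<le> A' * exp (l * (r \<omega> + K))" by (rule g(3)[OF r_bounds(1)[OF \<omega>]])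
      also have "\<dots> \<le> A' * exp (l * K)"
        using r_bounds(2)[OF \<omega>] l by (intro mult_left_mono A'_nonneg) auto
      finally show ?thesis .
    qed
    then show "AE \<omega> in M. norm (g (r \<omega>)) \<le> A' * exp (l * K)"
      using g(2) by (intro AE_I2) auto
  qed
  have bounded: "has_bochner_integral M (?I m) (k * (LINT \<omega>|M. ?P m \<omega>) + (T - s) * (LINT \<omega>|M. c m (r \<omega>)))" for m
  proof -
    obtain S where S: "\<And>v. cutoff h K m v \<le> S" using cutoff_bounded[OF cont K] by blast
    have c_eq: "cost (cutoff h K m) \<gamma> = c m" by (simp add: c_def)
    note b = bounded_identity[OF cd cutoff_nonneg[of h, OF nonneg] S cutoff_uniformly_continuous[OF cont K], unfolded c_eq]
    let ?J = "\<lambda>\<omega>. LBINT t:{s..T}. (cutoff h K m (Z t \<omega>) - c m (r \<omega>))"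
    have "(LINT \<omega>|M. ?J \<omega>) = k * (LINT \<omega>|M. ?P m \<omega>)"
      by (simp only: has_bochner_integral_integral_eq[OF b(1)] k)
    then have "has_bochner_integral M (\<lambda>\<omega>. ?J \<omega> + (T - s) * c m (r \<omega>))
        (k * (LINT \<omega>|M. ?P m \<omega>) + (T - s) * (LINT \<omega>|M. c m (r \<omega>)))"
      using b(2) r_int[OF c_cont c_nonneg c_growth]
      by (intro has_bochner_integral_add has_bochner_integral_mult_right) (auto simp: has_bochner_integral_iff)
    then show ?thesis
      by (rule has_bochner_integral_cong[THEN iffD1, rotated -1])
         (auto simp: path_integral_split[OF cutoff_cont[OF cont]])
  qed
  have P_lim: "(\<lambda>m. LINT \<omega>|M. ?P m \<omega>) \<longlonglongrightarrow> (LINT \<omega>|M. potential C (r \<omega>) (y \<omega>) (Z T \<omega>))"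
  proof (rule integral_dominated_convergence[OF _ _ dominating_integrable])
    show "(\<lambda>\<omega>. potential C (r \<omega>) (y \<omega>) (Z T \<omega>)) \<in> borel_measurable M"
      by (intro potential_measurable[OF cost_cont]) measurable
    show "?P m \<in> borel_measurable M" for m
      by (intro potential_measurable[OF c_cont]) measurable
    show "AE \<omega> in M. (\<lambda>m. ?P m \<omega>) \<longlonglongrightarrow> potential C (r \<omega>) (y \<omega>) (Z T \<omega>)"
      unfolding c_def using r_bounds y_ge path_ge[of _ T] sT
      by (intro AE_I2 cutoff_potential_tendsto[OF cont nonneg growth l K]) auto
    show "AE \<omega> in M. norm (?P m \<omega>) \<le> ?G \<omega>" for m
    proof (rule AE_I2)
      fix \<omega> assume \<omega>: "\<omega> \<in> space M"
      show "norm (?P m \<omega>) \<le> ?G \<omega>"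
        unfolding real_norm_def
        using r_bounds(1)[OF \<omega>] r_le_y[OF \<omega>] Z_ge[OF \<omega>, of T] sT
        by (intro abs_potential_le_exp[OF c_cont c_nonneg c_growth l(1) A'_nonneg]) auto
    qed
  qed
  have c_lim: "(\<lambda>m. LINT \<omega>|M. c m (r \<omega>)) \<longlonglongrightarrow> (LINT \<omega>|M. C (r \<omega>))"
  proof (rule integral_dominated_convergence)
    show "integrable M (\<lambda>\<omega>. C (r \<omega>))" by (rule r_int[OF cost_cont C_nonneg cost_growth])
    show "AE \<omega> in M. (\<lambda>m. c m (r \<omega>)) \<longlonglongrightarrow> C (r \<omega>)"
      unfolding c_def using r_bounds by (intro AE_I2 cutoff_cost_tendsto[OF cont nonneg growth l K]) auto
    show "AE \<omega> in M. norm (c m (r \<omega>)) \<le> C (r \<omega>)" for m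
      using c_nonneg r_bounds(1) cutoff_cost_le[OF cont nonneg growth l K] by (intro AE_I2) (auto simp: c_def)
  qed measurable
  let ?X = "k * (LINT \<omega>|M. potential C (r \<omega>) (y \<omega>) (Z T \<omega>)) + (T - s) * (LINT \<omega>|M. C (r \<omega>))"
  have I_meas: "?I m \<in> borel_measurable M" for m
    using bounded[of m] by (auto simp: has_bochner_integral_iff)
  have I: "has_bochner_integral M (\<lambda>\<omega>. LBINT t:{s..T}. h (Z t \<omega>)) ?X"
  proof (rule has_bochner_integral_monotone_convergence)
    show "integrable M (?I m)" for m using bounded by (auto simp: has_bochner_integral_iff)
    show "AE \<omega> in M. mono (\<lambda>m. ?I m \<omega>)"
      by (intro AE_I2 monoI path_integral_cutoff_mono)
    show "AE \<omega> in M. (\<lambda>m. ?I m \<omega>) \<longlonglongrightarrow> (LBINT t:{s..T}. h (Z t \<omega>))"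
      by (intro AE_I2 path_integral_cutoff_tendsto)
    have "(LINT \<omega>|M. ?I m \<omega>) = k * (LINT \<omega>|M. ?P m \<omega>) + (T - s) * (LINT \<omega>|M. c m (r \<omega>))" for m
      using bounded[of m] by (simp add: has_bochner_integral_iff)
    then show "(\<lambda>m. LINT \<omega>|M. ?I m \<omega>) \<longlonglongrightarrow> ?X"
      by (simp only:) (intro tendsto_intros P_lim c_lim)
    show "(\<lambda>\<omega>. LBINT t:{s..T}. h (Z t \<omega>)) \<in> borel_measurable M"
      by (rule borel_measurable_LIMSEQ_real[OF path_integral_cutoff_tendsto I_meas])
  qed
  have "has_bochner_integral M (\<lambda>\<omega>. (LBINT t:{s..T}. h (Z t \<omega>)) - (T - s) * C (r \<omega>)) (?X - (T - s) * (LINT \<omega>|M. C (r \<omega>)))"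
    using r_int[OF cost_cont C_nonneg cost_growth]
    by (intro has_bochner_integral_diff I has_bochner_integral_mult_right) (auto simp: has_bochner_integral_iff)
  then have "has_bochner_integral M (\<lambda>\<omega>. LBINT t:{s..T}. (h (Z t \<omega>) - C (r \<omega>))) (?X - (T - s) * (LINT \<omega>|M. C (r \<omega>)))"
    by (rule has_bochner_integral_cong[THEN iffD1, rotated -1])
       (auto simp: path_integral_split[OF cont])
  then show "integrable M (\<lambda>\<omega>. LBINT t:{s..T}. (h (Z t \<omega>) - C (r \<omega>)))"
    "(LINT \<omega>|M. (LBINT t:{s..T}. (h (Z t \<omega>) - C (r \<omega>))))
    = 2 / (\<sigma>\<^sup>2 * \<gamma>) * (LINT \<omega>|M. potential C (r \<omega>) (y \<omega>) (Z T \<omega>))"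
    by (auto simp: has_bochner_integral_iff k_def)
qed

lemma regret_upper:
  "(LINT \<omega>|M. (LBINT t:{s..T}. (h (Z t \<omega>) - C (r \<omega>))))
    \<le> 2 * A / (\<sigma>\<^sup>2 * l * (\<gamma> - l)) * (exp (l * K) * (l / (\<gamma> - l) + (LINT \<omega>|M. exp (l * y \<omega>))))"
proof -
  let ?m = "\<lambda>\<omega>. max 0 (Z T \<omega> - y \<omega>)"
  have "(LINT \<omega>|M. potential C (r \<omega>) (y \<omega>) (Z T \<omega>))
      \<le> (LINT \<omega>|M. A' / l * (exp (l * K) * (l * ?m \<omega>) + exp (l * K) * exp (l * y \<omega>)))"
  proof (rule integral_mono[OF potential_integrable])
    show "integrable M (\<lambda>\<omega>. A' / l * (exp (l * K) * (l * ?m \<omega>) + exp (l * K) * exp (l * y \<omega>)))"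
      using excess_Z_mean(1)[OF l] y_exp by simp
    fix \<omega> assume \<omega>: "\<omega> \<in> space M"
    have "potential C (r \<omega>) (y \<omega>) (Z T \<omega>)
        \<le> A' / l * (exp (l * (r \<omega> + K)) * (l * ?m \<omega>) + exp (l * (y \<omega> + K)))"
      using r_bounds(1)[OF \<omega>] y_ge[OF \<omega>] path_ge[OF \<omega>, of T] sT
      by (intro potential_upper[OF cost_cont C_nonneg cost_growth l(1) A'_nonneg]) auto
    also have "\<dots> \<le> A' / l * (exp (l * K) * (l * ?m \<omega>) + exp (l * K) * exp (l * y \<omega>))"
    proof (rule mult_left_mono)
      have "exp (l * (r \<omega> + K)) * (l * ?m \<omega>) \<le> exp (l * K) * (l * ?m \<omega>)"
        using l r_bounds(2)[OF \<omega>] by (intro mult_right_mono) auto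
      then show "exp (l * (r \<omega> + K)) * (l * ?m \<omega>) + exp (l * (y \<omega> + K))
          \<le> exp (l * K) * (l * ?m \<omega>) + exp (l * K) * exp (l * y \<omega>)"
        by (simp add: distrib_left exp_add mult.commute)
    qed (rule A'_l_nonneg)
    finally show "potential C (r \<omega>) (y \<omega>) (Z T \<omega>)
        \<le> A' / l * (exp (l * K) * (l * ?m \<omega>) + exp (l * K) * exp (l * y \<omega>))" .
  qed
  also have "\<dots> = A' / l * (exp (l * K) * (l * (LINT \<omega>|M. ?m \<omega>) + (LINT \<omega>|M. exp (l * y \<omega>))))"
    using excess_Z_mean(1)[OF l] y_exp by (simp add: distrib_left)
  also have "\<dots> \<le> A' / l * (exp (l * K) * (l / (\<gamma> - l) + (LINT \<omega>|M. exp (l * y \<omega>))))"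
    using excess_Z_mean(2)[OF l] by (intro mult_left_mono add_right_mono A'_l_nonneg) auto
  finally have "2 / (\<sigma>\<^sup>2 * \<gamma>) * (LINT \<omega>|M. potential C (r \<omega>) (y \<omega>) (Z T \<omega>))
      \<le> 2 / (\<sigma>\<^sup>2 * \<gamma>) * (A' / l * (exp (l * K) * (l / (\<gamma> - l) + (LINT \<omega>|M. exp (l * y \<omega>)))))"
    using \<gamma>_pos by (intro mult_left_mono) auto
  also have "2 / (\<sigma>\<^sup>2 * \<gamma>) * (A' / l * x) = 2 * A / (\<sigma>\<^sup>2 * l * (\<gamma> - l)) * x" for x
    using \<gamma>_pos by (simp add: mult_ac)
  finally show ?thesis by (simp only: regret_identity(2))
qed

text \<open>When the cost is minimal at the level \<open>c\<close>, only an ascent of the path above its initial state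
  contributes to the negative part of the potential.\<close>

lemma regret_lower:
  assumes const: "\<And>\<omega>. r \<omega> = c" "\<And>\<omega>. y \<omega> = x" and min: "\<And>v. c \<le> v \<Longrightarrow> C c \<le> C v"
  shows "- (LINT \<omega>|M. (LBINT t:{s..T}. (h (Z t \<omega>) - C c)))
    \<le> 2 * A / (\<sigma>\<^sup>2 * l * (\<gamma> - l)) * (exp (l * (x + K)) * (l / (\<gamma> - l)))"
proof -
  let ?m = "\<lambda>\<omega>. max 0 (Z T \<omega> - x)"
  note exc = excess_Z_exp[OF l, unfolded const]
  have "(LINT \<omega>|M. - potential C c x (Z T \<omega>))
      \<le> (LINT \<omega>|M. A' / l * (exp (l * (x + K)) * (exp (l * ?m \<omega>) - 1)))"
  proof (rule integral_mono)
    show "integrable M (\<lambda>\<omega>. - potential C c x (Z T \<omega>))"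
      using potential_integrable by (simp add: const)
    show "integrable M (\<lambda>\<omega>. A' / l * (exp (l * (x + K)) * (exp (l * ?m \<omega>) - 1)))"
      using exc(1) by simp
    fix \<omega> assume \<omega>: "\<omega> \<in> space M"
    have b: "- K \<le> c" "c \<le> x" "c \<le> Z T \<omega>"
      using r_bounds(1)[OF \<omega>] r_le_y[OF \<omega>] Z_ge[OF \<omega>, of T] sT by (auto simp: const)
    show "- potential C c x (Z T \<omega>) \<le> A' / l * (exp (l * (x + K)) * (exp (l * ?m \<omega>) - 1))"
    proof (cases "x \<le> Z T \<omega>")
      case True
      then have "- potential C c x (Z T \<omega>) \<le> A' / l * (exp (l * (Z T \<omega> + K)) - exp (l * (x + K)))"
        using b by (intro potential_lower_right[OF cost_cont C_nonneg cost_growth l(1) A'_nonneg]) auto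
      also have "exp (l * (Z T \<omega> + K)) - exp (l * (x + K)) = exp (l * (x + K)) * (exp (l * ?m \<omega>) - 1)"
        using True by (simp add: max_def right_diff_distrib exp_add[symmetric] algebra_simps)
      finally show ?thesis .
    next
      case False
      have "potential C c x x \<le> potential C c x (Z T \<omega>)"
      proof (rule DERIV_nonpos_imp_nonincreasing[of "Z T \<omega>" x "potential C c x"])
        show "Z T \<omega> \<le> x" using False by simp
        fix v assume "Z T \<omega> \<le> v" "v \<le> x"
        then show "\<exists>D. (potential C c x has_real_derivative D) (at v) \<and> D \<le> 0"
          using potential_has_derivative[OF cost_cont, of c x v] min[of v] b
          by (intro exI[of _ "C c - C v"]) auto
      qed
      then show ?thesis using False by simp
    qed
  qed
  also have "\<dots> = A' / l * (exp (l * (x + K)) * ((LINT \<omega>|M. exp (l * ?m \<omega>)) - 1))"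
    using exc(1) by (simp add: prob_space)
  also have "\<dots> \<le> A' / l * (exp (l * (x + K)) * (\<gamma> / (\<gamma> - l) - 1))"
    using exc(2) by (intro mult_left_mono diff_right_mono A'_l_nonneg) auto
  also have "\<gamma> / (\<gamma> - l) - 1 = l / (\<gamma> - l)"
    using l by (simp add: field_simps)
  finally have "2 / (\<sigma>\<^sup>2 * \<gamma>) * (LINT \<omega>|M. - potential C c x (Z T \<omega>))
      \<le> 2 / (\<sigma>\<^sup>2 * \<gamma>) * (A' / l * (exp (l * (x + K)) * (l / (\<gamma> - l))))"
    using \<gamma>_pos by (intro mult_left_mono) auto
  also have "2 / (\<sigma>\<^sup>2 * \<gamma>) * (A' / l * x) = 2 * A / (\<sigma>\<^sup>2 * l * (\<gamma> - l)) * x" for x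
    using \<gamma>_pos by (simp add: mult_ac)
  finally show ?thesis using regret_identity(2) by (simp add: const)
qed

end
end

section \<open>The transient regret of the learning algorithm\<close>

theorem proposition2:
  fixes M :: "'a measure" and F :: "real \<Rightarrow> 'a measure"
    and B Z\<^sub>0 Y\<^sub>0 Z\<^sub>\<tau> Y\<^sub>\<tau> Z\<^sub>s Y\<^sub>s :: "real \<Rightarrow> 'a \<Rightarrow> real"
    and h :: "real \<Rightarrow> real"
    and \<theta> \<sigma> \<gamma> \<gamma>\<^sub>0 b K\<^sub>h H\<^sub>K a C\<^sub>h x \<tau> T :: real
  assumes bm: "brownian_motion M F B"
    and params: "\<theta> < 0" "\<sigma> > 0" "\<gamma> = - 2 * \<theta> / \<sigma>\<^sup>2" "0 < \<gamma>\<^sub>0" "\<gamma>\<^sub>0 \<le> \<gamma>"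
    and cost: "admissible_cost \<gamma>\<^sub>0 b h"
    and K: "K\<^sub>h > 0" "\<And>u. \<gamma>\<^sub>0 \<le> u \<Longrightarrow> opt_level h u \<in> {- K\<^sub>h<..<0}"
    and a: "a > 0" "\<And>z. 0 \<le> z \<Longrightarrow> h z \<le> a * exp (b * z)"
    and H: "H\<^sub>K > 0" "\<And>z. - K\<^sub>h \<le> z \<Longrightarrow> z \<le> 0 \<Longrightarrow> h z \<le> H\<^sub>K"
    and C: "C\<^sub>h = max a H\<^sub>K"
    and times: "0 \<le> x" "0 < \<tau>" "\<tau> \<le> T"
    and Z0: "reflected_bm F B \<theta> \<sigma> 0 (\<lambda>_. 0) (\<lambda>_. x) Z\<^sub>0 Y\<^sub>0"
    and Z\<tau>: "reflected_bm F B \<theta> \<sigma> \<tau> (lto_level h \<gamma>\<^sub>0 \<tau> Z\<^sub>0) (Z\<^sub>0 \<tau>) Z\<^sub>\<tau> Y\<^sub>\<tau>"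
    and Zs: "reflected_bm F B \<theta> \<sigma> 0 (\<lambda>_. opt_level h \<gamma>) (\<lambda>_. x) Z\<^sub>s Y\<^sub>s"
  shows "R1_LTO M h \<gamma> \<tau> Z\<^sub>0
           \<le> 8 * C\<^sub>h * (2 + exp (\<gamma>\<^sub>0 * x / 2)) / (\<sigma>\<^sup>2 * \<gamma>\<^sub>0 * (2 * \<gamma> - \<gamma>\<^sub>0))
       \<and> R3_LTO M h \<gamma> \<tau> T (lto_level h \<gamma>\<^sub>0 \<tau> Z\<^sub>0) Z\<^sub>\<tau>
           \<le> 8 * C\<^sub>h * (2 + exp (\<gamma>\<^sub>0 * K\<^sub>h / 2) * (4 + exp (\<gamma>\<^sub>0 * x / 2)))
               / (\<sigma>\<^sup>2 * \<gamma>\<^sub>0 * (2 * \<gamma> - \<gamma>\<^sub>0))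
       \<and> R5_LTO M h \<gamma> T Z\<^sub>s
           \<le> 8 * C\<^sub>h * (2 + exp (\<gamma>\<^sub>0 * (x + K\<^sub>h) / 2)) / (\<sigma>\<^sup>2 * \<gamma>\<^sub>0 * (2 * \<gamma> - \<gamma>\<^sub>0))"
proof -
  interpret drifted_bm M F B \<theta> \<sigma> \<gamma>
    using bm params by (simp add: drifted_bm_def drifted_bm_axioms_def)
  (* Growth rate of the bound on the cost: it exceeds b, and since it is at most \<gamma> / 2, the
     exponential law of rate \<gamma> has a moment generating function at most 2 there. *)
  define l where "l = \<gamma>\<^sub>0 / 2"
  define U where "U = 2 * C\<^sub>h / (\<sigma>\<^sup>2 * l * (\<gamma> - l))"
  have l: "0 < l" "l < \<gamma>" "b < l"
    using params cost by (auto simp: l_def admissible_cost_def)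
  have Ch: "0 < C\<^sub>h" "a \<le> C\<^sub>h" "H\<^sub>K \<le> C\<^sub>h" using C a(1) by auto
  have U: "U = 8 * C\<^sub>h / (\<sigma>\<^sup>2 * \<gamma>\<^sub>0 * (2 * \<gamma> - \<gamma>\<^sub>0))"
  proof -
    have "\<sigma>\<^sup>2 * l * (\<gamma> - l) = \<sigma>\<^sup>2 * \<gamma>\<^sub>0 * (2 * \<gamma> - \<gamma>\<^sub>0) / 4" by (simp add: l_def field_simps)
    then show ?thesis unfolding U_def by (simp only:) simp
  qed
  have U_nonneg: "0 \<le> U" using Ch l by (simp add: U_def)
  have ratio: "l / (\<gamma> - l) \<le> 1" "\<gamma> / (\<gamma> - l) \<le> 2"
    using l params(5) by (auto simp: divide_le_eq l_def)
  have h_cont: "continuous_on UNIV h" and h_nonneg: "\<And>v. 0 \<le> h v"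
    using cost by (auto simp: admissible_cost_def)
  have growth: "h v \<le> C\<^sub>h * exp (l * (v + K))" if "0 \<le> K" "K \<le> K\<^sub>h" "- K \<le> v" for K v
  proof (cases "0 \<le> v")
    case True
    have "h v \<le> a * exp (b * v)" by (rule a(2)[OF True])
    also have "\<dots> \<le> C\<^sub>h * exp (l * (v + K))"
    proof (intro mult_mono)
      have "b * v \<le> l * v" using True l by (intro mult_right_mono) auto
      also have "\<dots> \<le> l * (v + K)" using that l by (intro mult_left_mono) auto
      finally show "exp (b * v) \<le> exp (l * (v + K))" by simp
    qed (use Ch in auto)
    finally show ?thesis .
  next
    case False
    then have "h v \<le> C\<^sub>h * 1" using H(2)[of v] Ch that by simp
    also have "\<dots> \<le> C\<^sub>h * exp (l * (v + K))"
      using that l Ch by (intro mult_left_mono) auto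
    finally show ?thesis .
  qed
  note growth_0 = growth[of 0, simplified]
  note growth_K = growth[OF less_imp_le[OF K(1)] order_refl]
  have bowl: "bowl_cost h u" if "\<gamma>\<^sub>0 \<le> u" for u
  proof -
    have "discounted_cost h u"
      by (rule discounted_cost_of_growth[OF h_cont h_nonneg growth_K]) (use that l params in \<open>auto simp: l_def\<close>)
    then show ?thesis
      using cost by (simp add: bowl_cost_def bowl_cost_axioms_def admissible_cost_def)
  qed
  have level: "- K\<^sub>h \<le> opt_level h u" "opt_level h u < 0" if "\<gamma>\<^sub>0 \<le> u" for u
    using K(2)[OF that] by auto
  have bound: "x \<le> U * c \<Longrightarrow> c \<le> d \<Longrightarrow> x \<le> 8 * C\<^sub>h * d / (\<sigma>\<^sup>2 * \<gamma>\<^sub>0 * (2 * \<gamma> - \<gamma>\<^sub>0))" for x c d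
    using mult_left_mono[of c d U] U_nonneg by (simp add: U)

  interpret Z0: reflected_path_until M F B \<theta> \<sigma> \<gamma> 0 "\<lambda>_. 0" "\<lambda>_. x" Z\<^sub>0 Y\<^sub>0 \<tau>
    by unfold_locales (use Z0 times in auto)
  interpret Zs: reflected_path_until M F B \<theta> \<sigma> \<gamma> 0 "\<lambda>_. opt_level h \<gamma>" "\<lambda>_. x" Z\<^sub>s Y\<^sub>s T
    by unfold_locales (use Zs times in auto)
  let ?e = "exp (\<gamma>\<^sub>0 * x / 2)"
  have e: "exp (l * x) = ?e" by (simp add: l_def)

  have R1: "R1_LTO M h \<gamma> \<tau> Z\<^sub>0 \<le> U * (1 + ?e)"
  proof -
    have "R1_LTO M h \<gamma> \<tau> Z\<^sub>0 \<le> U * (exp (l * 0) * (l / (\<gamma> - l) + (LINT \<omega>|M. exp (l * x))))"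
      unfolding R1_LTO_def U_def
      by (rule Z0.regret_upper[OF h_cont h_nonneg _ l(1,2)]) (use growth_0 K(1) in auto)
    also have "\<dots> \<le> U * (1 + ?e)"
      using ratio U_nonneg by (intro mult_left_mono) (auto simp: prob_space e)
    finally show ?thesis .
  qed

  (* The state at the end of the learning interval is the initial state of the next phase. *)
  have X_exp: "integrable M (\<lambda>\<omega>. exp (l * Z\<^sub>0 \<tau> \<omega>))" "(LINT \<omega>|M. exp (l * Z\<^sub>0 \<tau> \<omega>)) \<le> ?e + 2"
    using Z0.Z_exp[OF l(1,2)] ratio by (auto simp: prob_space e)
  have R3: "R3_LTO M h \<gamma> \<tau> T (lto_level h \<gamma>\<^sub>0 \<tau> Z\<^sub>0) Z\<^sub>\<tau> \<le> U * (exp (l * K\<^sub>h) * (3 + ?e))"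
  proof (cases "\<tau> = T")
    case True
    (* An empty second phase: increments from \<tau> to T are then degenerate. *)
    have "(LBINT t:{T..T}. f t) = 0" for f :: "real \<Rightarrow> real"
      using interval_integral_Icc[of T T f] by simp
    then have "R3_LTO M h \<gamma> \<tau> T (lto_level h \<gamma>\<^sub>0 \<tau> Z\<^sub>0) Z\<^sub>\<tau> = 0"
      using True by (simp add: R3_LTO_def)
    then show ?thesis using U_nonneg by (simp add: add_nonneg_nonneg)
  next
    case False
    have rate: "rate_estimate \<gamma>\<^sub>0 \<tau> Z\<^sub>0 \<in> borel_measurable (F \<tau>)"
    proof -
      have [measurable]: "(\<lambda>\<omega>. LBINT t:{0..\<tau>}. Z\<^sub>0 t \<omega>) \<in> borel_measurable (F \<tau>)"
      proof (rule path_integral_measurable[OF times(2)])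
        show "Z\<^sub>0 t \<in> borel_measurable (F \<tau>)" if "0 \<le> t" "t \<le> \<tau>" for t
          by (rule F_measurable_mono[OF Z0.Z_meas[OF that(1)] that(2)])
        show "continuous_on {0..\<tau>} (\<lambda>t. Z\<^sub>0 t \<omega>)" if "\<omega> \<in> space (F \<tau>)" for \<omega>
          using that space_F by (intro continuous_on_subset[OF Z0.Z_cont]) auto
      qed
      show ?thesis unfolding rate_estimate_def[abs_def] by measurable
    qed
    have "(\<lambda>\<omega>. opt_level h (rate_estimate \<gamma>\<^sub>0 \<tau> Z\<^sub>0 \<omega>)) \<in> borel_measurable (F \<tau>)"
    proof (rule opt_level_measurable[where \<gamma>\<^sub>0=\<gamma>\<^sub>0 and X="rate_estimate \<gamma>\<^sub>0 \<tau> Z\<^sub>0"])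
      show "bowl_cost h u" if "\<gamma>\<^sub>0 \<le> u" for u by (rule bowl[OF that])
      show "opt_level h u < 0" if "\<gamma>\<^sub>0 \<le> u" for u by (rule level(2)[OF that])
      show "\<gamma>\<^sub>0 \<le> rate_estimate \<gamma>\<^sub>0 \<tau> Z\<^sub>0 \<omega>" for \<omega> by (simp add: rate_estimate_def)
    qed (rule rate)
    then have "lto_level h \<gamma>\<^sub>0 \<tau> Z\<^sub>0 \<in> borel_measurable (F \<tau>)"
      by (simp add: lto_level_def[abs_def])
    then interpret Zt: reflected_path_until M F B \<theta> \<sigma> \<gamma> \<tau> "lto_level h \<gamma>\<^sub>0 \<tau> Z\<^sub>0" "Z\<^sub>0 \<tau>" Z\<^sub>\<tau> Y\<^sub>\<tau> T
      by unfold_locales (use Z\<tau> times False in auto)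
    have lto: "- K\<^sub>h \<le> lto_level h \<gamma>\<^sub>0 \<tau> Z\<^sub>0 \<omega>" "lto_level h \<gamma>\<^sub>0 \<tau> Z\<^sub>0 \<omega> \<le> 0" for \<omega>
      using level[of "rate_estimate \<gamma>\<^sub>0 \<tau> Z\<^sub>0 \<omega>"] by (auto simp: lto_level_def rate_estimate_def)
    have "R3_LTO M h \<gamma> \<tau> T (lto_level h \<gamma>\<^sub>0 \<tau> Z\<^sub>0) Z\<^sub>\<tau>
        \<le> U * (exp (l * K\<^sub>h) * (l / (\<gamma> - l) + (LINT \<omega>|M. exp (l * Z\<^sub>0 \<tau> \<omega>))))"
      unfolding R3_LTO_def U_def
      by (rule Zt.regret_upper[OF h_cont h_nonneg growth_K l(1,2)]) (use K(1) lto X_exp in auto)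
    also have "\<dots> \<le> U * (exp (l * K\<^sub>h) * (3 + ?e))"
      using ratio(1) X_exp(2) U_nonneg by (intro mult_left_mono) auto
    finally show ?thesis .
  qed

  have R5: "R5_LTO M h \<gamma> T Z\<^sub>s \<le> U * exp (\<gamma>\<^sub>0 * (x + K\<^sub>h) / 2)"
  proof -
    have "R5_LTO M h \<gamma> T Z\<^sub>s = - (LINT \<omega>|M. (LBINT t:{0..T}. (h (Z\<^sub>s t \<omega>) - cost h \<gamma> (opt_level h \<gamma>))))"
      unfolding R5_LTO_def set_lebesgue_integral_def
      by (simp only: Bochner_Integration.integral_minus[symmetric] scaleR_minus_right[symmetric] minus_diff_eq)
    also have "\<dots> \<le> U * (exp (l * (x + K\<^sub>h)) * (l / (\<gamma> - l)))"
      unfolding U_def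
      by (rule Zs.regret_lower[OF h_cont h_nonneg growth_K l(1,2)])
         (use K(1) level[OF params(5)] bowl_cost.cost_ge_opt_cost[OF bowl[OF params(5)]] in auto)
    also have "\<dots> \<le> U * (exp (l * (x + K\<^sub>h)) * 1)"
      using ratio(1) U_nonneg by (intro mult_left_mono) auto
    finally show ?thesis by (simp add: l_def)
  qed

  show ?thesis
  proof (intro conjI)
    show "R1_LTO M h \<gamma> \<tau> Z\<^sub>0 \<le> 8 * C\<^sub>h * (2 + ?e) / (\<sigma>\<^sup>2 * \<gamma>\<^sub>0 * (2 * \<gamma> - \<gamma>\<^sub>0))"
      by (rule bound[OF R1]) simp
    show "R3_LTO M h \<gamma> \<tau> T (lto_level h \<gamma>\<^sub>0 \<tau> Z\<^sub>0) Z\<^sub>\<tau>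
        \<le> 8 * C\<^sub>h * (2 + exp (\<gamma>\<^sub>0 * K\<^sub>h / 2) * (4 + ?e)) / (\<sigma>\<^sup>2 * \<gamma>\<^sub>0 * (2 * \<gamma> - \<gamma>\<^sub>0))"
    proof (rule bound[OF R3])
      have "exp (l * K\<^sub>h) * (3 + ?e) \<le> exp (l * K\<^sub>h) * (4 + ?e)" by (intro mult_left_mono) auto
      moreover have "exp (l * K\<^sub>h) = exp (\<gamma>\<^sub>0 * K\<^sub>h / 2)" by (simp add: l_def)
      ultimately show "exp (l * K\<^sub>h) * (3 + ?e) \<le> 2 + exp (\<gamma>\<^sub>0 * K\<^sub>h / 2) * (4 + ?e)"
        by (simp only:)
    qed
    show "R5_LTO M h \<gamma> T Z\<^sub>s
        \<le> 8 * C\<^sub>h * (2 + exp (\<gamma>\<^sub>0 * (x + K\<^sub>h) / 2)) / (\<sigma>\<^sup>2 * \<gamma>\<^sub>0 * (2 * \<gamma> - \<gamma>\<^sub>0))"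
      by (rule bound[OF R5]) simp
  qed
qed

end
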